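(* Let $\mathbf{Q}=(Q_m)_{m\ge0}$ be a strictly increasing sequence of positive real numbers with $Q_0>1$, $Q_m\to\infty$ and $\inf_{m\ge0}Q_{m+1}/Q_m^{\tau}>0$ for some $\tau>1$. Put $$E=\Big\{(x,y)\in\mathbb{R}^2:\ \limsup_{Q\to+\infty}\ Q\cdot\min_{1\le q\le Q}\langle qx\rangle\langle qy\rangle>0\Big\},\qquad E_{\mathbf{Q}}=\Big\{(x,y)\in\mathbb{R}^2:\ \liminf_{m\to+\infty}\ Q_m\cdot\min_{1\le q\le Q_m}\langle qx\rangle\langle qy\rangle>0\Big\}.$$ Let $a,b\in\mathbb{R}$ and $\mathcal{C}=\{(x,y)\in\mathbb{R}^2:y=ax+b\}$. \begin{enumerate} \item If $a\ne0$ and for some $\varepsilon>0$ one has $$\liminf_{q\to+\infty}\ q^{2-\varepsilon}\cdot\max\{\langle qa\rangle,\langle qb\rangle\}>0,$$ then the sets $E\cap\mathcal{C}$ and $E_{\mathbf{Q}}\cap\mathcal{C}$ are absolutely winning on $\mathcal{C}$. \item If $a,b\in\mathbb{Q}$, then $\mathcal{C}\cap E=\mathcal{C}\cap E_{\mathbf{Q}}=\varnothing$. \end{enumerate}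
   Context: For $x\in\mathbb{R}$, $\langle x\rangle$ denotes the distance from $x$ to the nearest integer; $q$ ranges over positive integers. Hyperplane absolute winning (HAW). Let $U\subset\mathbb{R}^d$ be open, $S\subset\mathbb{R}^d$, $\beta\in(0,1/3)$. For an affine hyperplane $L\subset\mathbb{R}^d$ and $r>0$ put $L^{(r)}=\{z\in\mathbb{R}^d:\mathrm{dist}(z,L)\le r\}$. Bob first chooses a closed ball $B_0\subset U$ of radius $\rho_0>0$. After Bob chooses a closed ball $B_n$ of radius $\rho_n$, Alice chooses $L_n^{(r_n)}$ with $r_n\le\beta\rho_n$, and then Bob chooses a closed ball $B_{n+1}\subset B_n\setminus L_n^{(r_n)}$ of radius $\rho_{n+1}\ge\beta\rho_n$. Alice wins by default if at any time Bob has no legal move, or if $\rho_n\not\to0$; otherwise Alice wins iff $\bigcap_nB_n\cap S\ne\varnothing$. $S$ is HAW on $U$ if for every $\beta\in(0,1/3)$ Alice has a winning strategy. A subset $S$ of a $d$-dimensional $C^1$ manifold $M$ with $C^1$ atlas $\{(U_\alpha,\varphi_\alpha)\}$ is HAW on $M$ if $\varphi_\alpha(S\cap U_\alpha)$ is HAW on $\varphi_\alpha(U_\alpha)$ for each $\alpha$ (this is independent of the atlas). On a one-dimensional manifold (where affine hyperplanes of the chart space $\mathbb{R}$ are points), "absolutely winning" is equivalent to HAW. *)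

theory Defs
  imports "HOL-Analysis.Analysis"
begin

section \<open>The hyperplane absolute game\<close>

definition affine_hyperplane :: "'a::euclidean_space set \<Rightarrow> bool" where
  "affine_hyperplane L \<longleftrightarrow> (\<exists>n c. n \<noteq> 0 \<and> L = {z. n \<bullet> z = c})"

definition closed_nbhd :: "'a::euclidean_space set \<Rightarrow> real \<Rightarrow> 'a set" where
  "closed_nbhd L r = {z. infdist z L \<le> r}"

text \<open>A closed ball is encoded as the pair of its centre and its radius. Alice's moves are
  determined by Bob's, so a strategy for Alice is a function of the list of all balls
  \<open>[B\<^sub>0, \<dots>, B\<^sub>n]\<close> that Bob has chosen so far; it returns \<open>(L\<^sub>n, r\<^sub>n)\<close>.\<close>

type_synonym 'a strategy = "('a \<times> real) list \<Rightarrow> 'a set \<times> real"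

definition legal_strategy :: "real \<Rightarrow> 'a::euclidean_space strategy \<Rightarrow> bool" where
  "legal_strategy \<beta> \<sigma> \<longleftrightarrow>
     (\<forall>h. h \<noteq> [] \<and> snd (last h) > 0 \<longrightarrow>
        affine_hyperplane (fst (\<sigma> h)) \<and> 0 < snd (\<sigma> h) \<and> snd (\<sigma> h) \<le> \<beta> * snd (last h))"

text \<open>\<open>B\<close> is an infinite sequence of legal moves of Bob against \<open>\<sigma>\<close>.\<close>

definition bob_play ::
    "real \<Rightarrow> 'a::euclidean_space set \<Rightarrow> 'a strategy \<Rightarrow> (nat \<Rightarrow> 'a \<times> real) \<Rightarrow> bool" where
  "bob_play \<beta> U \<sigma> B \<longleftrightarrow>
     (\<forall>n. snd (B n) > 0) \<and>
     cball (fst (B 0)) (snd (B 0)) \<subseteq> U \<and>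
     (\<forall>n. snd (B (Suc n)) \<ge> \<beta> * snd (B n) \<and>
          cball (fst (B (Suc n))) (snd (B (Suc n))) \<subseteq>
            cball (fst (B n)) (snd (B n)) -
            closed_nbhd (fst (\<sigma> (map B [0..<Suc n]))) (snd (\<sigma> (map B [0..<Suc n]))))"

text \<open>If Bob runs out of legal moves then Alice wins, so only infinite plays give a condition.\<close>

definition winning_strategy ::
    "real \<Rightarrow> 'a::euclidean_space set \<Rightarrow> 'a set \<Rightarrow> 'a strategy \<Rightarrow> bool" where
  "winning_strategy \<beta> U S \<sigma> \<longleftrightarrow>
     legal_strategy \<beta> \<sigma> \<and>
     (\<forall>B. bob_play \<beta> U \<sigma> B \<longrightarrow>
        \<not> (\<lambda>n. snd (B n)) \<longlonglongrightarrow> 0 \<or>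
        (\<Inter>n. cball (fst (B n)) (snd (B n))) \<inter> S \<noteq> {})"

definition HAW_on :: "'a::euclidean_space set \<Rightarrow> 'a set \<Rightarrow> bool" where
  "HAW_on U S \<longleftrightarrow> open U \<and> (\<forall>\<beta>. 0 < \<beta> \<and> \<beta> < 1/3 \<longrightarrow> (\<exists>\<sigma>. winning_strategy \<beta> U S \<sigma>))"

section \<open>HAW sets on \<open>C\<^sup>1\<close> manifolds\<close>

definition C1_map_on ::
    "('a::euclidean_space \<Rightarrow> 'b::euclidean_space) \<Rightarrow> 'a set \<Rightarrow> bool" where
  "C1_map_on f S \<longleftrightarrow>
     (\<exists>f' :: 'a \<Rightarrow> 'a \<Rightarrow>\<^sub>L 'b.
        (\<forall>x\<in>S. (f has_derivative blinfun_apply (f' x)) (at x)) \<and> continuous_on S f')"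

text \<open>An atlas is a set of charts \<open>(U, \<phi>)\<close>; the dimension of the manifold is that of the
  type of the chart space. The topology of \<open>M\<close> is the subspace topology.\<close>

definition C1_atlas ::
    "'m::topological_space set \<Rightarrow> ('m set \<times> ('m \<Rightarrow> 'a::euclidean_space)) set \<Rightarrow> bool" where
  "C1_atlas M \<A> \<longleftrightarrow>
     (\<Union>(U, \<phi>)\<in>\<A>. U) = M \<and>
     (\<forall>(U, \<phi>)\<in>\<A>. openin (top_of_set M) U \<and> open (\<phi> ` U) \<and>
        (\<exists>\<psi>. homeomorphism U (\<phi> ` U) \<phi> \<psi>)) \<and>
     (\<forall>(U, \<phi>)\<in>\<A>. \<forall>(V, \<psi>)\<in>\<A>. C1_map_on (\<psi> \<circ> inv_into U \<phi>) (\<phi> ` (U \<inter> V)))"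

definition HAW_on_manifold ::
    "'m::topological_space set \<Rightarrow> ('m set \<times> ('m \<Rightarrow> 'a::euclidean_space)) set \<Rightarrow> 'm set \<Rightarrow> bool"
  where
  "HAW_on_manifold M \<A> S \<longleftrightarrow>
     C1_atlas M \<A> \<and> S \<subseteq> M \<and> (\<forall>(U, \<phi>)\<in>\<A>. HAW_on (\<phi> ` U) (\<phi> ` (S \<inter> U)))"

section \<open>Multiplicative approximation on planar lines\<close>

definition dist_int :: "real \<Rightarrow> real" where
  "dist_int x = \<bar>x - of_int (round x)\<bar>"

text \<open>Only meaningful for \<open>Q \<ge> 1\<close>, where the minimum is over a nonempty (finite) set.\<close>

definition min_prod :: "real \<Rightarrow> real \<Rightarrow> real \<Rightarrow> real" where
  "min_prod x y Q =
     Min ((\<lambda>q. dist_int (real q * x) * dist_int (real q * y)) ` {q::nat. 1 \<le> q \<and> real q \<le> Q})"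

definition E_set :: "(real \<times> real) set" where
  "E_set = {(x, y). Limsup at_top (\<lambda>Q::real. ereal (Q * min_prod x y Q)) > 0}"

definition E_seq :: "(nat \<Rightarrow> real) \<Rightarrow> (real \<times> real) set" where
  "E_seq Q = {(x, y). Liminf sequentially (\<lambda>m. ereal (Q m * min_prod x y (Q m))) > 0}"

definition line :: "real \<Rightarrow> real \<Rightarrow> (real \<times> real) set" where
  "line a b = {(x, y). y = a * x + b}"

text \<open>The standard \<open>C\<^sup>1\<close> structure of the line, given by one global chart \<open>(x, a x + b) \<mapsto> x\<close>.\<close>

definition line_atlas :: "real \<Rightarrow> real \<Rightarrow> ((real \<times> real) set \<times> (real \<times> real \<Rightarrow> real)) set" where
  "line_atlas a b = {(line a b, fst)}"

lemma C1_atlas_line: "C1_atlas (line a b) (line_atlas a b)"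
proof -
  have im: "fst ` line a b = UNIV"
    by (auto simp: line_def image_iff)
  have hom: "homeomorphism (line a b) UNIV fst (\<lambda>x. (x, a * x + b))"
    unfolding homeomorphism_def
    by (auto simp: line_def image_iff intro!: continuous_intros)
  have inv: "(fst \<circ> inv_into (line a b) fst) x = x" for x
    using f_inv_into_f[of x fst "line a b"] im by simp
  have "C1_map_on (fst \<circ> inv_into (line a b) fst) UNIV"
    unfolding C1_map_on_def
    by (rule exI[of _ "\<lambda>_. id_blinfun"]) (use inv in \<open>auto simp: fun_eq_iff comp_def id_blinfun.rep_eq intro!: has_derivative_eq_rhs[OF has_derivative_ident]\<close>)
  then show ?thesis
    unfolding C1_atlas_def line_atlas_def using hom im by auto
qed

end

theory Submission
  imports Defs
begin

text \<open>
  Fix a scale \<open>Q\<close> and let \<open>x\<close> parametrise the line. A rational point \<open>v = (p/q, r/q)\<close> with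
  \<open>q \<le> Q\<close> and \<open>|qx - p| |qy - r| < c/Q\<close> puts \<open>x\<close> into one of two short intervals, centred at the
  parameters of \<open>p/q\<close> and of \<open>r/q\<close>. Alice does not avoid all these intervals, but only the isolated
  ones, i.e. those far from the other centres of the same class (denominators, offsets and slopes are
  classified up to a factor \<open>1/\<beta>\<close>); she also avoids the isolated intervals around the intersections of the line with the rational lines \<open>A x + B y + C = 0\<close>
  with \<open>|A| |B| \<le> Q\<close>. If \<open>x\<close> is close to a point \<open>v\<close> that is not isolated, then \<open>x\<close> is close to
  the rational line spanned by \<open>v\<close> and its neighbour, and \<open>|A| |B|\<close> is much smaller than \<open>q\<close>; if \<open>x\<close> is
  close to a rational line that is not isolated, then \<open>x\<close> is close to the intersection point of this
  line and its neighbour, whose denominator is at most a constant times \<open>|A| |B|\<close>. Hence a bad \<open>x\<close>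
  with minimal \<open>q\<close> cannot avoid all isolated intervals.

  Isolated intervals are sparse: at each scale of the game only boundedly many scales \<open>Q\<^sub>m\<close> are relevant
  (by lacunarity, and by the Diophantine condition, which bounds the slopes \<open>|A + aB|\<close> from below),
  and the intervals have small total weight, where the weight of an interval is a small power of its
  radius. Alice always deletes a weighted median of the centres, which halves the weight that Bob can keep.
\<close>

section \<open>The one-dimensional game\<close>

text \<open>The obstacle is that intervals of one scale may cluster, so that deleting all of them
  would exceed any budget. Isolation cures this: the birth scale of an interval is the distance that
  it must keep from the other centres of its class, so in each level at most five intervals become
  relevant at a given radius of Bob. The radius of an interval is smaller than its birth scale by
  the factor K (Q/n)^delta, where n is the power of 1/\<beta> that represents the denominator (or
  the size of the rational line). The power of Q/n makes the sum over the levels geometric, and K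
  makes it as small as desired. The price is that a neighbour may be farther away by the same
  factor; n (Q/n)^(4 delta) <= Q pays for this, whence the condition delta <= 1/4. The descent
  closes because passing from a point to a line is linear in the constant, whereas passing from a
  line to a point squares it: the line has a value of order c/Q, the new point a product of order
  c^2/Q. Hence the constants are chosen last, after K, and only have to be small.\<close>

lemma weighted_median:
  fixes f :: "'a \<Rightarrow> real" and w :: "'a \<Rightarrow> real"
  assumes fin: "finite S" and w: "\<And>s. s \<in> S \<Longrightarrow> 0 \<le> w s"
  shows "\<exists>\<mu>. sum w {s \<in> S. f s < \<mu>} \<le> sum w S / 2 \<and> sum w {s \<in> S. \<mu> < f s} \<le> sum w S / 2"
proof (cases "S = {}")
  case False
  \<comment> \<open>The median is the smallest value of \<open>f\<close> at which the accumulated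
    weight reaches half of the total. Both sums in the claim leave out the ties.\<close>
  define M where "M = {s \<in> S. sum w S / 2 \<le> sum w {t \<in> S. f t \<le> f s}}"
  have "Max (f ` S) \<in> f ` S" using fin False by simp
  then obtain m where m: "m \<in> S" "f m = Max (f ` S)" by auto
  have "{t \<in> S. f t \<le> f m} = S" using fin m by auto
  moreover have "0 \<le> sum w S" using w by (simp add: sum_nonneg)
  ultimately have "m \<in> M" using m(1) by (simp add: M_def)
  moreover have finM: "finite M" using fin by (simp add: M_def)
  ultimately have "Min (f ` M) \<in> f ` M" by (intro Min_in) auto
  then obtain s where s: "s \<in> M" "f s = Min (f ` M)" by auto
  have minimal: "f s \<le> f t" if "t \<in> M" for t using s finM that by simp
  have "sum w S = sum w {t \<in> S. f t \<le> f s} + sum w {t \<in> S. f s < f t}"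
    by (subst sum.union_disjoint[symmetric]) (use fin in \<open>auto intro!: sum.cong\<close>)
  then have right: "sum w {t \<in> S. f s < f t} \<le> sum w S / 2"
    using s(1) by (simp add: M_def)
  have left: "sum w {t \<in> S. f t < f s} \<le> sum w S / 2"
  proof (cases "{t \<in> S. f t < f s} = {}")
    case True
    then show ?thesis using \<open>0 \<le> sum w S\<close> by (simp only: True) simp
  next
    case nonempty: False
    let ?L = "{t \<in> S. f t < f s}"
    have "finite ?L" using fin by simp
    then have "Max (f ` ?L) \<in> f ` ?L" using nonempty by (intro Max_in) auto
    then obtain t where t: "t \<in> ?L" "f t = Max (f ` ?L)" by force
    then have "f u \<le> f t" if "u \<in> ?L" for u
      using that \<open>finite ?L\<close> by simp
    then have "?L = {u \<in> S. f u \<le> f t}" using t(1) by force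
    moreover have "t \<notin> M" using minimal t(1) by force
    ultimately show ?thesis using t(1) by (simp add: M_def)
  qed
  show ?thesis using left right by blast
qed auto

text \<open>A triple \<open>(z, r, R)\<close> encodes the interval of radius \<open>r\<close> around \<open>z\<close>, which Alice takes into account
  as soon as Bob's radius has dropped to the birth scale \<open>R\<close>. The set \<open>hits\<close> collects the intervals that become
  relevant when Bob's radius drops to \<open>\<rho>\<close> from a radius of at most \<open>D * \<rho>\<close>, with \<open>D = 1/\<beta>\<close>.\<close>

definition hits :: "real \<Rightarrow> (real \<times> real \<times> real) set \<Rightarrow> real \<Rightarrow> real \<Rightarrow> (real \<times> real \<times> real) set" where
  "hits D F x \<rho> = {(z, r, R) \<in> F. \<rho> \<le> R \<and> R < D * \<rho> \<and> \<bar>z - x\<bar> \<le> \<rho> + r}"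

text \<open>Finiteness belongs to the notion because a sum over an infinite set is 0 by convention
  and would bound nothing.\<close>

definition light ::
    "real \<Rightarrow> real \<Rightarrow> (real \<times> real \<times> real) set \<Rightarrow> real \<Rightarrow> real \<Rightarrow> real \<Rightarrow> bool" where
  "light D \<gamma> F x \<rho> w \<longleftrightarrow>
     finite (hits D F x \<rho>) \<and> (\<Sum>(z, r, R)\<in>hits D F x \<rho>. r powr \<gamma>) \<le> w"

definition active :: "(real \<times> real \<times> real) set \<Rightarrow> real \<times> real \<Rightarrow> (real \<times> real \<times> real) set" where
  "active F B = {(z, r, R) \<in> F. snd B \<le> R \<and> \<bar>z - fst B\<bar> \<le> snd B + r}"

definition weight :: "real \<Rightarrow> real \<times> real \<times> real \<Rightarrow> real" where
  "weight \<gamma> t = fst (snd t) powr \<gamma>"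

lemma weight_nonneg: "0 \<le> weight \<gamma> t"
  by (simp add: weight_def)

text \<open>The budget \<open>(\<beta> * snd (B n)) powr \<gamma>\<close> is an invariant. Deleting
  around the median halves the inherited weight, while the budget shrinks at most by the factor
  \<open>\<beta> powr \<gamma> \<ge> 2/3\<close>. So the old intervals take at most three quarters
  of the new budget, and one quarter is left for the intervals just born.\<close>

lemma active_potential:
  fixes B :: "nat \<Rightarrow> real \<times> real"
  assumes \<beta>: "0 < \<beta>" "\<beta> < 1" and \<gamma>: "0 < \<gamma>" and \<beta>\<gamma>: "2/3 \<le> \<beta> powr \<gamma>"
    and pos: "\<And>z r R. (z, r, R) \<in> F \<Longrightarrow> 0 < r"
    and birth: "\<And>z r R. (z, r, R) \<in> F \<Longrightarrow> R < snd (B 0)"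
    and light: "\<And>x \<rho>. 0 < \<rho> \<Longrightarrow> light (1/\<beta>) \<gamma> F x \<rho> ((\<beta> * \<rho>) powr \<gamma> / 4)"
    and rad: "\<And>n. 0 < snd (B n)"
    and big: "\<And>n. \<beta> * snd (B n) \<le> snd (B (Suc n))"
    and nested: "\<And>n. \<bar>fst (B (Suc n)) - fst (B n)\<bar> \<le> snd (B n) - snd (B (Suc n))"
    and left: "\<And>n. finite (active F (B n)) \<Longrightarrow> sum (weight \<gamma>) {t \<in> active F (B n). fst t < \<mu> n} \<le> sum (weight \<gamma>) (active F (B n)) / 2"
    and right: "\<And>n. finite (active F (B n)) \<Longrightarrow> sum (weight \<gamma>) {t \<in> active F (B n). \<mu> n < fst t} \<le> sum (weight \<gamma>) (active F (B n)) / 2"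
    and away: "\<And>n. fst (B (Suc n)) + snd (B (Suc n)) < \<mu> n - \<beta> * snd (B n) \<or>
                    \<mu> n + \<beta> * snd (B n) < fst (B (Suc n)) - snd (B (Suc n))"
  shows "finite (active F (B n)) \<and> sum (weight \<gamma>) (active F (B n)) \<le> (\<beta> * snd (B n)) powr \<gamma>"
proof (induction n)
  case 0
  \<comment> \<open>All birth scales lie below Bob's first radius, so the game starts with an empty
    account.\<close>
  have "active F (B 0) = {}" using birth by (force simp: active_def)
  then show ?case by simp
next
  case (Suc n)
  let ?\<rho> = "snd (B n)" and ?\<rho>' = "snd (B (Suc n))" and ?x' = "fst (B (Suc n))"
  define Old where "Old = {t \<in> active F (B (Suc n)). ?\<rho> \<le> snd (snd t)}"
  define New where "New = hits (1/\<beta>) F ?x' ?\<rho>'"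
  have fin: "finite (active F (B n))"
    and pot: "sum (weight \<gamma>) (active F (B n)) \<le> (\<beta> * ?\<rho>) powr \<gamma>" using Suc by auto
  \<comment> \<open>The budget bounds each single weight, so every active radius is at most the
    radius that Alice deletes.\<close>
  have small: "r \<le> \<beta> * ?\<rho>" if "(z, r, R) \<in> active F (B n)" for z r R
  proof -
    have "weight \<gamma> (z, r, R) \<le> sum (weight \<gamma>) (active F (B n))"
      by (rule member_le_sum[OF that _ fin]) (simp add: weight_nonneg)
    then have "r powr \<gamma> \<le> (\<beta> * ?\<rho>) powr \<gamma>" using pot by (simp add: weight_def)
    then show ?thesis
      by (rule contrapos_pp) (use \<beta> \<gamma> rad[of n] in \<open>auto intro!: powr_less_mono2 simp: not_le\<close>)
  qed
  have Old_active: "t \<in> active F (B n)" if "t \<in> Old" for t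
    using that nested[of n] by (auto simp: Old_def active_def)
  \<comment> \<open>Bob's next ball lies on one side of \<open>\<mu> n\<close> at distance more than
    \<open>\<beta> * ?\<rho>\<close>, and no active radius exceeds this; an interval centred at
    \<open>\<mu> n\<close> or beyond cannot reach the ball.\<close>
  have Old_side: "Old \<subseteq> {t \<in> active F (B n). fst t < \<mu> n} \<or> Old \<subseteq> {t \<in> active F (B n). \<mu> n < fst t}"
    using away[of n]
  proof
    assume *: "?x' + ?\<rho>' < \<mu> n - \<beta> * ?\<rho>"
    have "fst t < \<mu> n" if "t \<in> Old" for t
      using that small[of "fst t" "fst (snd t)" "snd (snd t)"] Old_active[OF that] *
      by (auto simp: Old_def active_def)
    then show ?thesis using Old_active by blast
  next
    assume *: "\<mu> n + \<beta> * ?\<rho> < ?x' - ?\<rho>'"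
    have "\<mu> n < fst t" if "t \<in> Old" for t
      using that small[of "fst t" "fst (snd t)" "snd (snd t)"] Old_active[OF that] *
      by (auto simp: Old_def active_def)
    then show ?thesis using Old_active by blast
  qed
  have "sum (weight \<gamma>) Old \<le> sum (weight \<gamma>) (active F (B n)) / 2"
    using Old_side
  proof
    assume "Old \<subseteq> {t \<in> active F (B n). fst t < \<mu> n}"
    then have "sum (weight \<gamma>) Old \<le> sum (weight \<gamma>) {t \<in> active F (B n). fst t < \<mu> n}"
      using fin by (intro sum_mono2) (auto simp: weight_nonneg)
    then show ?thesis using left[of n] fin by linarith
  next
    assume "Old \<subseteq> {t \<in> active F (B n). \<mu> n < fst t}"
    then have "sum (weight \<gamma>) Old \<le> sum (weight \<gamma>) {t \<in> active F (B n). \<mu> n < fst t}"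
      using fin by (intro sum_mono2) (auto simp: weight_nonneg)
    then show ?thesis using right[of n] fin by linarith
  qed
  then have "sum (weight \<gamma>) Old \<le> (\<beta> * ?\<rho>) powr \<gamma> / 2" using pot by linarith
  also have "\<dots> \<le> 3/4 * (\<beta> * (\<beta> * ?\<rho>)) powr \<gamma>"
  proof -
    have "2/3 * (\<beta> * ?\<rho>) powr \<gamma> \<le> \<beta> powr \<gamma> * (\<beta> * ?\<rho>) powr \<gamma>"
      using \<beta>\<gamma> by (intro mult_right_mono) auto
    also have "\<dots> = (\<beta> * (\<beta> * ?\<rho>)) powr \<gamma>"
      using \<beta> rad[of n] by (subst powr_mult) (auto intro!: less_imp_le)
    finally show ?thesis by linarith
  qed
  also have "\<dots> \<le> 3/4 * (\<beta> * ?\<rho>') powr \<gamma>"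
    using \<beta> \<gamma> rad[of n] big[of n] by (intro mult_left_mono powr_mono2) auto
  finally have old: "sum (weight \<gamma>) Old \<le> 3/4 * (\<beta> * ?\<rho>') powr \<gamma>" .
  have New: "finite New" "sum (weight \<gamma>) New \<le> (\<beta> * ?\<rho>') powr \<gamma> / 4"
    using light[OF rad[of "Suc n"], of ?x']
    by (auto simp: light_def New_def weight_def[abs_def] case_prod_unfold)
  have finOld: "finite Old" using fin Old_active by (meson finite_subset subsetI)
  \<comment> \<open>An active interval outside \<open>Old\<close> has its birth scale between
    \<open>?\<rho>'\<close> and \<open>?\<rho>\<close>, hence inside the window of
    \<open>hits\<close>.\<close>
  have "?\<rho> \<le> 1 / \<beta> * ?\<rho>'" using big[of n] \<beta> by (simp add: field_simps)
  then have sub: "active F (B (Suc n)) \<subseteq> Old \<union> New"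
    by (auto simp: active_def Old_def New_def hits_def)
  have "sum (weight \<gamma>) (active F (B (Suc n))) \<le> sum (weight \<gamma>) (Old \<union> New)"
    using sub finOld New(1) by (intro sum_mono2) (auto simp: weight_nonneg)
  also have "\<dots> \<le> sum (weight \<gamma>) Old + sum (weight \<gamma>) New"
    using sum.union_inter[OF finOld New(1), of "weight \<gamma>"] sum_nonneg[of "Old \<inter> New" "weight \<gamma>"]
    by (simp add: weight_nonneg)
  finally show ?case using old New sub finOld by (auto intro: finite_subset)
qed

lemma closed_nbhd_singleton: "closed_nbhd {\<mu>::real} r = cball \<mu> r"
  by (auto simp: closed_nbhd_def dist_commute)

lemma affine_hyperplane_singleton: "affine_hyperplane {\<mu>::real}"
  unfolding affine_hyperplane_def by (rule exI[of _ 1]) auto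

lemma cball_real_subset_diff:
  fixes x y \<rho> \<rho>' \<mu> s :: real
  assumes "0 < \<rho>'" "0 \<le> s" and sub: "cball x \<rho>' \<subseteq> cball y \<rho> - cball \<mu> s"
  shows "\<bar>x - y\<bar> \<le> \<rho> - \<rho>'" "x + \<rho>' < \<mu> - s \<or> \<mu> + s < x - \<rho>'"
proof -
  have "x + \<rho>' \<in> cball y \<rho> - cball \<mu> s" "x - \<rho>' \<in> cball y \<rho> - cball \<mu> s"
    by (intro subsetD[OF sub]; use assms(1) in \<open>simp add: dist_real_def\<close>)+
  then have *: "\<bar>y - (x + \<rho>')\<bar> \<le> \<rho>" "\<bar>y - (x - \<rho>')\<bar> \<le> \<rho>"
    "\<not> \<bar>\<mu> - (x + \<rho>')\<bar> \<le> s" "\<not> \<bar>\<mu> - (x - \<rho>')\<bar> \<le> s"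
    by (auto simp: dist_real_def)
  then show "\<bar>x - y\<bar> \<le> \<rho> - \<rho>'" by linarith
  show "x + \<rho>' < \<mu> - s \<or> \<mu> + s < x - \<rho>'"
  proof (rule ccontr)
    assume "\<not> ?thesis"
    then have "\<mu> \<in> cball x \<rho>'"
      using * assms(2) by (auto simp: dist_real_def)
    then show False using sub assms(2) by auto
  qed
qed

text \<open>The family may depend on Bob's first ball, which makes it possible to drop early scales
  and to treat \<open>x\<close> as bounded. If the limit point lay in an interval of the family,
  this interval would be active at all late stages, and its fixed weight would exceed a budget that
  tends to 0.\<close>

lemma winning_strategy_of_light_families:
  assumes \<beta>: "0 < \<beta>" "\<beta> < 1" and \<gamma>: "0 < \<gamma>" and \<beta>\<gamma>: "2/3 \<le> \<beta> powr \<gamma>"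
    and fam: "\<And>x\<^sub>0 \<rho>\<^sub>0. 0 < \<rho>\<^sub>0 \<Longrightarrow> \<exists>F.
        (\<forall>z r R. (z, r, R) \<in> F \<longrightarrow> 0 < r \<and> 0 < R \<and> R < \<rho>\<^sub>0) \<and>
        (\<forall>x \<rho>. 0 < \<rho> \<longrightarrow> light (1/\<beta>) \<gamma> F x \<rho> ((\<beta> * \<rho>) powr \<gamma> / 4)) \<and>
        (\<forall>x. \<bar>x - x\<^sub>0\<bar> \<le> \<rho>\<^sub>0 \<longrightarrow> (\<forall>z r R. (z, r, R) \<in> F \<longrightarrow> r < \<bar>x - z\<bar>) \<longrightarrow> x \<in> S)"
  shows "\<exists>\<sigma>. winning_strategy \<beta> (UNIV :: real set) S \<sigma>"
proof -
  define ok where "ok B F \<longleftrightarrow>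
        (\<forall>z r R. (z, r, R) \<in> F \<longrightarrow> 0 < r \<and> 0 < R \<and> R < snd B) \<and>
        (\<forall>x \<rho>. 0 < \<rho> \<longrightarrow> light (1/\<beta>) \<gamma> F x \<rho> ((\<beta> * \<rho>) powr \<gamma> / 4)) \<and>
        (\<forall>x. \<bar>x - fst B\<bar> \<le> snd B \<longrightarrow> (\<forall>z r R. (z, r, R) \<in> F \<longrightarrow> r < \<bar>x - z\<bar>) \<longrightarrow> x \<in> S)"
    for B :: "real \<times> real" and F
  define Fam where "Fam B = (SOME F. ok B F)" for B
  have Fam: "ok B (Fam B)" if "0 < snd B" for B
    unfolding Fam_def by (rule someI_ex) (use fam[OF that, of "fst B"] in \<open>simp add: ok_def\<close>)
  define median where "median A = (SOME \<mu>.
      sum (weight \<gamma>) {t \<in> A. fst t < \<mu>} \<le> sum (weight \<gamma>) A / 2 \<and>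
      sum (weight \<gamma>) {t \<in> A. \<mu> < fst t} \<le> sum (weight \<gamma>) A / 2)" for A
  have median: "sum (weight \<gamma>) {t \<in> A. fst t < median A} \<le> sum (weight \<gamma>) A / 2 \<and>
      sum (weight \<gamma>) {t \<in> A. median A < fst t} \<le> sum (weight \<gamma>) A / 2" if "finite A" for A
    unfolding median_def by (rule someI_ex) (rule weighted_median[OF that weight_nonneg])
  define \<sigma> :: "real strategy" where
    "\<sigma> h = ({median (active (Fam (hd h)) (last h))}, \<beta> * snd (last h))" for h
  have "legal_strategy \<beta> \<sigma>"
    using \<beta> by (auto simp: legal_strategy_def \<sigma>_def affine_hyperplane_singleton)
  moreover have "(\<Inter>n. cball (fst (B n)) (snd (B n))) \<inter> S \<noteq> {}"
    if play: "bob_play \<beta> UNIV \<sigma> B" and lim: "(\<lambda>n. snd (B n)) \<longlonglongrightarrow> 0" for B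
  proof -
    define F where "F = Fam (B 0)"
    define \<mu> where "\<mu> n = median (active F (B n))" for n
    have rad: "0 < snd (B n)" and big: "\<beta> * snd (B n) \<le> snd (B (Suc n))" for n
      using play by (auto simp: bob_play_def)
    have \<sigma>_B: "\<sigma> (map B [0..<Suc n]) = ({\<mu> n}, \<beta> * snd (B n))" for n
      by (simp add: \<sigma>_def \<mu>_def F_def hd_map last_map del: upt_Suc)
    have sub: "cball (fst (B (Suc n))) (snd (B (Suc n))) \<subseteq>
        cball (fst (B n)) (snd (B n)) - cball (\<mu> n) (\<beta> * snd (B n))" for n
      using play \<sigma>_B by (auto simp: bob_play_def closed_nbhd_singleton simp del: upt_Suc)
    have s_nonneg: "0 \<le> \<beta> * snd (B n)" for n using \<beta> rad[of n] by simp
    note geo = cball_real_subset_diff[OF rad s_nonneg sub]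
    have F: "ok (B 0) F" unfolding F_def by (rule Fam[OF rad])
    have pot: "finite (active F (B n)) \<and> sum (weight \<gamma>) (active F (B n)) \<le> (\<beta> * snd (B n)) powr \<gamma>" for n
      by (rule active_potential[where \<mu> = \<mu> and B = B, OF \<beta> \<gamma> \<beta>\<gamma> _ _ _ rad big geo(1) _ _ geo(2)])
        (use F median in \<open>auto simp: ok_def \<mu>_def\<close>)
    have "\<exists>x. x \<in> (\<Inter>n. cball (fst (B n)) (snd (B n)))"
    proof -
      have "decseq (\<lambda>n. cball (fst (B n)) (snd (B n)))"
        using sub by (intro decseq_SucI) blast
      then have "\<Inter> (range (\<lambda>n. cball (fst (B n)) (snd (B n)))) \<noteq> {}"
        using less_imp_le[OF rad] by (intro compact_nest) (auto simp: decseq_def not_less)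
      then show ?thesis by blast
    qed
    then obtain x where x: "x \<in> (\<Inter>n. cball (fst (B n)) (snd (B n)))" ..
    then have x_B: "\<bar>x - fst (B n)\<bar> \<le> snd (B n)" for n
      by (auto simp: dist_real_def abs_minus_commute)
    have "r < \<bar>x - z\<bar>" if zrR: "(z, r, R) \<in> F" for z r R
    proof (rule ccontr)
      assume "\<not> r < \<bar>x - z\<bar>"
      have pos: "0 < r" "0 < R" using F zrR by (auto simp: ok_def)
      have "eventually (\<lambda>n. snd (B n) < min r R) sequentially"
        using lim pos by (intro order_tendstoD(2)) auto
      then obtain n where n: "snd (B n) < min r R" by (auto simp: eventually_sequentially)
      have "(z, r, R) \<in> active F (B n)"
        using zrR n x_B[of n] \<open>\<not> r < \<bar>x - z\<bar>\<close> by (auto simp: active_def)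
      then have "weight \<gamma> (z, r, R) \<le> sum (weight \<gamma>) (active F (B n))"
        using pot[of n] by (intro member_le_sum) (auto simp: weight_nonneg)
      also have "\<dots> \<le> (\<beta> * snd (B n)) powr \<gamma>" using pot by blast
      also have "\<dots> < r powr \<gamma>"
      proof (rule powr_less_mono2)
        have "\<beta> * snd (B n) \<le> 1 * snd (B n)" using \<beta> rad[of n] by (intro mult_right_mono) auto
        then show "\<beta> * snd (B n) < r" using n by simp
      qed (use \<gamma> s_nonneg in auto)
      finally show False by (simp add: weight_def)
    qed
    then have "x \<in> S" using F x_B[of 0] unfolding ok_def by blast
    then show ?thesis using x by blast
  qed
  ultimately have "winning_strategy \<beta> UNIV S \<sigma>" by (auto simp: winning_strategy_def)
  then show ?thesis by (rule exI[where x = \<sigma>])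
qed

section \<open>Families of small total weight\<close>

lemma light_mono: "light D \<gamma> F x \<rho> v \<Longrightarrow> v \<le> w \<Longrightarrow> light D \<gamma> F x \<rho> w"
  by (auto simp: light_def)

lemma light_hits_cong: "hits D F x \<rho> = hits D G x \<rho> \<Longrightarrow> light D \<gamma> G x \<rho> w \<Longrightarrow> light D \<gamma> F x \<rho> w"
  by (simp add: light_def)

lemma light_Un:
  assumes F: "light D \<gamma> F x \<rho> v" and G: "light D \<gamma> G x \<rho> w"
  shows "light D \<gamma> (F \<union> G) x \<rho> (v + w)"
proof -
  let ?w = "\<lambda>(z, r, R). r powr \<gamma>"
  have hits: "hits D (F \<union> G) x \<rho> = hits D F x \<rho> \<union> hits D G x \<rho>"
    by (auto simp: hits_def)
  have fin: "finite (hits D F x \<rho>)" "finite (hits D G x \<rho>)"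
    using F G by (auto simp: light_def)
  have "0 \<le> sum ?w (hits D F x \<rho> \<inter> hits D G x \<rho>)" by (intro sum_nonneg) auto
  then have "sum ?w (hits D F x \<rho> \<union> hits D G x \<rho>) \<le> sum ?w (hits D F x \<rho>) + sum ?w (hits D G x \<rho>)"
    using sum.union_inter[OF fin, of ?w] by linarith
  then show ?thesis using F G hits by (auto simp: light_def)
qed

lemma light_UN:
  assumes "finite I" and "\<And>i. i \<in> I \<Longrightarrow> light D \<gamma> (F i) x \<rho> (w i)"
  shows "light D \<gamma> (\<Union>i\<in>I. F i) x \<rho> (\<Sum>i\<in>I. w i)"
  using assms
proof (induction I rule: finite_induct)
  case empty
  then have "hits D (\<Union>i\<in>{}. F i) x \<rho> = {}" by (auto simp: hits_def)
  then show ?case by (simp add: light_def)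
next
  case (insert i I)
  then show ?case using light_Un[of D \<gamma> "F i" x \<rho> "w i" "\<Union>i\<in>I. F i" "\<Sum>i\<in>I. w i"] by simp
qed

text \<open>The integer parts of \<open>(z - x) / \<rho>\<close> are pairwise distinct and lie
  between -2 and 2.\<close>

lemma card_separated:
  fixes Z :: "real set"
  assumes \<rho>: "0 < \<rho>" and sep: "\<And>z z'. z \<in> Z \<Longrightarrow> z' \<in> Z \<Longrightarrow> z \<noteq> z' \<Longrightarrow> \<rho> \<le> \<bar>z - z'\<bar>"
    and near: "\<And>z. z \<in> Z \<Longrightarrow> \<bar>z - x\<bar> \<le> 2 * \<rho>"
  shows "finite Z \<and> card Z \<le> 5"
proof -
  let ?f = "\<lambda>z. \<lfloor>(z - x) / \<rho>\<rfloor>"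
  have inj: "inj_on ?f Z"
  proof (rule inj_onI, rule ccontr)
    fix z z' assume zz': "z \<in> Z" "z' \<in> Z" "?f z = ?f z'" "z \<noteq> z'"
    then have "\<bar>(z - x) / \<rho> - (z' - x) / \<rho>\<bar> < 1" by linarith
    also have "(z - x) / \<rho> - (z' - x) / \<rho> = (z - z') / \<rho>" by (simp add: diff_divide_distrib)
    finally have "\<bar>z - z'\<bar> < \<rho>" using \<rho> by (simp add: abs_divide)
    then show False using sep zz' by fastforce
  qed
  have "?f ` Z \<subseteq> {-2..2}"
  proof
    fix k assume "k \<in> ?f ` Z"
    then obtain z where z: "z \<in> Z" "k = ?f z" by auto
    have "\<bar>(z - x) / \<rho>\<bar> \<le> 2" using near[OF z(1)] \<rho> by (simp add: field_simps)
    then have "-2 \<le> (z - x) / \<rho>" "(z - x) / \<rho> \<le> 2" by linarith+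
    then show "k \<in> {-2..2}" unfolding z(2) atLeastAtMost_iff by linarith
  qed
  then have "finite (?f ` Z)" "card (?f ` Z) \<le> card {-2..2::int}"
    by (auto intro: finite_subset simp del: card_atLeastAtMost_int intro!: card_mono)
  then show ?thesis using inj by (auto simp: card_image finite_image_iff)
qed

text \<open>The birth scales \<open>b j\<close> are a geometric progression of ratio
  \<open>1/D\<close>, so at most one \<open>j\<close> falls into the window from
  \<open>\<rho>\<close> to \<open>D * \<rho>\<close>. The centres of that class are
  \<open>\<rho>\<close>-separated and within \<open>2 * \<rho>\<close> of \<open>x\<close>, and each
  radius is at most \<open>D * \<rho> * l\<close>.\<close>

lemma light_level:
  fixes T :: "(real \<times> int) set" and c D :: real
  defines "b \<equiv> \<lambda>j::int. c * D powr - real_of_int j"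
  assumes D: "1 < D" and \<rho>: "0 < \<rho>" and \<gamma>: "0 < \<gamma>" and c: "0 < c" and l: "0 < l" "D * l \<le> 1"
    and sep: "\<And>z z' j. (z, j) \<in> T \<Longrightarrow> (z', j) \<in> T \<Longrightarrow> z \<noteq> z' \<Longrightarrow> b j \<le> \<bar>z - z'\<bar>"
  shows "light D \<gamma> ((\<lambda>(z, j). (z, l * b j, b j)) ` T) x \<rho> (5 * (D * \<rho> * l) powr \<gamma>)"
proof (cases "hits D ((\<lambda>(z, j). (z, l * b j, b j)) ` T) x \<rho> = {}")
  case False
  let ?H = "hits D ((\<lambda>(z, j). (z, l * b j, b j)) ` T) x \<rho>"
  obtain j where j: "\<rho> \<le> b j" "b j < D * \<rho>"
    using False by (auto simp: hits_def)
  have unique: "j' = j" if j': "\<rho> \<le> b j'" "b j' < D * \<rho>" for j'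
  proof -
    have step: "D * b j\<^sub>2 \<le> b j\<^sub>1" if "j\<^sub>1 < j\<^sub>2" for j\<^sub>1 j\<^sub>2
    proof -
      have "D * b j\<^sub>2 = c * D powr (1 - real_of_int j\<^sub>2)"
        using D by (simp add: b_def powr_diff powr_minus divide_simps)
      also have "\<dots> \<le> b j\<^sub>1"
        unfolding b_def using that D c by (intro mult_left_mono powr_mono) auto
      finally show ?thesis .
    qed
    have "D * \<rho> \<le> D * b j" "D * \<rho> \<le> D * b j'" using D j j' by auto
    then show ?thesis using step[of j j'] step[of j' j] j j' by (cases j j' rule: linorder_cases) auto
  qed
  define Z where "Z = {z. (z, j) \<in> T \<and> \<bar>z - x\<bar> \<le> 2 * \<rho>}"
  have Z: "finite Z \<and> card Z \<le> 5"
    by (rule card_separated[OF \<rho>]) (use sep j in \<open>fastforce simp: Z_def\<close>)+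
  have lb: "l * b j' \<le> \<rho>" if "b j' < D * \<rho>" for j'
  proof -
    have "l * b j' \<le> l * (D * \<rho>)" using that l by (intro mult_left_mono) auto
    also have "\<dots> \<le> 1 * \<rho>" unfolding mult.assoc[symmetric] using l \<rho> by (intro mult_right_mono) (auto simp: mult.commute)
    finally show ?thesis by simp
  qed
  have H: "?H \<subseteq> (\<lambda>z. (z, l * b j, b j)) ` Z"
  proof
    fix t assume "t \<in> ?H"
    then obtain z j' where t: "t = (z, l * b j', b j')" "(z, j') \<in> T"
      "\<rho> \<le> b j'" "b j' < D * \<rho>" "\<bar>z - x\<bar> \<le> \<rho> + l * b j'"
      by (auto simp: hits_def)
    then show "t \<in> (\<lambda>z. (z, l * b j, b j)) ` Z"
      using unique[OF t(3,4)] lb[OF t(4)] by (auto simp: Z_def)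
  qed
  then have finH: "finite ?H" using Z by (meson finite_imageI finite_subset)
  have "card ?H \<le> card ((\<lambda>z. (z, l * b j, b j)) ` Z)" using H Z by (intro card_mono) auto
  also have "\<dots> \<le> 5" using Z card_image_le le_trans by blast
  finally have card: "card ?H \<le> 5" .
  have term_le: "r powr \<gamma> \<le> (D * \<rho> * l) powr \<gamma>" if "(z, r, R) \<in> ?H" for z r R
  proof -
    have "r = l * b j" using H that by auto
    moreover have "0 \<le> b j" using c by (simp add: b_def)
    ultimately show ?thesis
      using j l \<gamma> by (intro powr_mono2) (auto simp: mult.commute)
  qed
  have "(\<Sum>(z, r, R)\<in>?H. r powr \<gamma>) \<le> of_nat (card ?H) * (D * \<rho> * l) powr \<gamma>"
    by (rule sum_bounded_above) (use term_le in auto)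
  also have "\<dots> \<le> 5 * (D * \<rho> * l) powr \<gamma>"
    using card by (intro mult_right_mono) auto
  finally show ?thesis using finH by (simp add: light_def)
qed (simp add: light_def)

definition shrink :: "real \<Rightarrow> real \<Rightarrow> real \<Rightarrow> real \<Rightarrow> int \<Rightarrow> real" where
  "shrink D \<delta> K Q i = (D powr real_of_int i / Q) powr \<delta> / K"

text \<open>In level \<open>i\<close> the radius is smaller than the birth scale by the factor \<open>shrink D \<delta> K Q i\<close>;
  these factors form a geometric series in \<open>i\<close>, so that all levels together are light.\<close>

definition graded ::
    "real \<Rightarrow> real \<Rightarrow> real \<Rightarrow> real \<Rightarrow> (int \<Rightarrow> real) \<Rightarrow> (real \<times> int \<times> int) set \<Rightarrow> (real \<times> real \<times> real) set" where
  "graded D \<delta> K Q c T =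
     (\<lambda>(z, i, j). (z, shrink D \<delta> K Q i * (c i * D powr - real_of_int j), c i * D powr - real_of_int j)) ` T"

lemma sum_geometric_int:
  fixes x :: real
  assumes "0 < x" "x < 1"
  shows "(\<Sum>i\<in>{0..n::int}. x ^ nat (n - i)) \<le> 1 / (1 - x)"
proof -
  have "(\<Sum>i\<in>{0..n}. x ^ nat (n - i)) = (\<Sum>k\<in>{k. int k \<le> n}. x ^ k)"
    by (rule sum.reindex_bij_witness[where i = "\<lambda>k. n - int k" and j = "\<lambda>i. nat (n - i)"]) auto
  also have "\<dots> \<le> (\<Sum>k. x ^ k)"
  proof (rule sum_le_suminf)
    show "finite {k. int k \<le> n}" by (rule finite_subset[of _ "{..nat n}"]) auto
  qed (use assms in auto)
  also have "\<dots> = 1 / (1 - x)" using assms by (simp add: suminf_geometric)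
  finally show ?thesis .
qed

text \<open>Relative to the top level \<open>\<lfloor>log D Q\<rfloor>\<close>, each step down costs
  a factor \<open>D powr - \<delta>\<close> in the radii, hence
  \<open>D powr - (\<delta> * \<gamma>)\<close> in the weights.\<close>

lemma light_graded:
  assumes D: "1 < D" and KD: "D \<le> K" and \<delta>: "0 < \<delta>" and \<gamma>: "0 < \<gamma>" and Q: "1 \<le> Q" and \<rho>: "0 < \<rho>"
    and c: "\<And>i. 0 < c i"
    and T: "\<And>z i j. (z, i, j) \<in> T \<Longrightarrow> 0 \<le> i \<and> D powr real_of_int i \<le> Q"
    and sep: "\<And>z z' i j. (z, i, j) \<in> T \<Longrightarrow> (z', i, j) \<in> T \<Longrightarrow> z \<noteq> z' \<Longrightarrow>
                c i * D powr - real_of_int j \<le> \<bar>z - z'\<bar>"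
  shows "light D \<gamma> (graded D \<delta> K Q c T) x \<rho> (5 * (D * \<rho> / K) powr \<gamma> / (1 - D powr - (\<delta> * \<gamma>)))"
proof -
  define n where "n = \<lfloor>log D Q\<rfloor>"
  define q where "q = D powr - (\<delta> * \<gamma>)"
  have q: "0 < q" "q < 1"
    using D \<delta> \<gamma> by (auto simp: q_def powr_less_one)
  have n: "i \<in> {0..n} \<longleftrightarrow> 0 \<le> i \<and> D powr real_of_int i \<le> Q" for i
    using D Q by (simp add: n_def le_floor_iff le_log_iff)
  have graded_UN: "graded D \<delta> K Q c T = (\<Union>i\<in>{0..n}. (\<lambda>(z, j). (z, shrink D \<delta> K Q i * (c i * D powr - real_of_int j),
     c i * D powr - real_of_int j)) ` {(z, j). (z, i, j) \<in> T})" (is "_ = (\<Union>i\<in>_. ?F i)")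
  proof -
    have "\<exists>i\<in>{0..n}. t \<in> ?F i" if mem: "t \<in> graded D \<delta> K Q c T" for t
    proof -
      obtain z i j where "(z, i, j) \<in> T" and t: "t = (z, shrink D \<delta> K Q i * (c i * D powr - real_of_int j),
          c i * D powr - real_of_int j)"
        using mem unfolding graded_def by auto
      then have "i \<in> {0..n}" "(z, j) \<in> {(z, j). (z, i, j) \<in> T}" using T n by auto
      then show ?thesis unfolding t by (intro bexI[of _ i] image_eqI[of _ _ "(z, j)"]) auto
    qed
    moreover have "t \<in> graded D \<delta> K Q c T" if "t \<in> ?F i" for t i
      using that unfolding graded_def by (auto intro: image_eqI[of _ _ "(_, i, _)"])
    ultimately show ?thesis by blast
  qed
  have shrink_pos: "0 < shrink D \<delta> K Q i" for i using D KD Q by (simp add: shrink_def)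
  have level: "light D \<gamma> (?F i) x \<rho> (5 * (D * \<rho> * shrink D \<delta> K Q i) powr \<gamma>)" if "i \<in> {0..n}" for i
  proof (rule light_level[OF D \<rho> \<gamma> c shrink_pos])
    have "D powr real_of_int i / Q \<le> 1" using that n Q by auto
    then have "(D powr real_of_int i / Q) powr \<delta> \<le> 1"
      using \<delta> Q D by (intro powr_le1) auto
    then have "D * (D powr real_of_int i / Q) powr \<delta> \<le> K * 1"
      using D KD by (intro mult_mono) auto
    then show "D * shrink D \<delta> K Q i \<le> 1" using D KD by (simp add: shrink_def field_simps)
  qed (use sep in auto)
  have "(D * \<rho> * shrink D \<delta> K Q i) powr \<gamma> \<le> (D * \<rho> / K) powr \<gamma> * q ^ nat (n - i)" if "i \<in> {0..n}" for i
  proof -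
    have "D powr real_of_int n \<le> Q" using D Q by (simp add: n_def powr_le_iff)
    then have "D powr real_of_int i / Q \<le> D powr real_of_int i / D powr real_of_int n"
      using D Q by (intro divide_left_mono) auto
    also have "\<dots> = D powr - real (nat (n - i))" using that D by (simp add: powr_diff[symmetric])
    finally have "(D powr real_of_int i / Q) powr (\<delta> * \<gamma>) \<le> (D powr - real (nat (n - i))) powr (\<delta> * \<gamma>)"
      using \<delta> \<gamma> D Q by (intro powr_mono2) auto
    also have "\<dots> = q ^ nat (n - i)"
      using q D by (simp add: powr_powr q_def powr_realpow[symmetric] algebra_simps)
    finally have *: "(D powr real_of_int i / Q) powr (\<delta> * \<gamma>) \<le> q ^ nat (n - i)" .
    have "(D * \<rho> * shrink D \<delta> K Q i) powr \<gamma> = (D * \<rho> / K) powr \<gamma> * (D powr real_of_int i / Q) powr (\<delta> * \<gamma>)"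
      using D \<rho> KD Q by (simp add: shrink_def powr_mult powr_divide powr_powr mult_ac)
    also have "\<dots> \<le> (D * \<rho> / K) powr \<gamma> * q ^ nat (n - i)"
      using * by (intro mult_left_mono) auto
    finally show ?thesis .
  qed
  then have "(\<Sum>i\<in>{0..n}. 5 * (D * \<rho> * shrink D \<delta> K Q i) powr \<gamma>) \<le>
      (\<Sum>i\<in>{0..n}. 5 * ((D * \<rho> / K) powr \<gamma> * q ^ nat (n - i)))"
    by (intro sum_mono mult_left_mono) auto
  also have "\<dots> = 5 * (D * \<rho> / K) powr \<gamma> * (\<Sum>i\<in>{0..n}. q ^ nat (n - i))"
    by (simp add: sum_distrib_left mult.assoc)
  also have "\<dots> \<le> 5 * (D * \<rho> / K) powr \<gamma> * (1 / (1 - q))"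
    using q by (intro mult_left_mono sum_geometric_int) auto
  finally have "(\<Sum>i\<in>{0..n}. 5 * (D * \<rho> * shrink D \<delta> K Q i) powr \<gamma>) \<le>
      5 * (D * \<rho> / K) powr \<gamma> / (1 - D powr - (\<delta> * \<gamma>))" by (simp add: q_def)
  then show ?thesis
    unfolding graded_UN by (rule light_mono[OF light_UN, rotated 2]) (use level in auto)
qed

section \<open>Two neighbouring lines, two neighbouring points\<close>

text \<open>The line is \<open>x \<mapsto> (a\<^sub>1 * x + b\<^sub>1, a\<^sub>2 * x + b\<^sub>2)\<close>; keeping both coordinates general makes the situation
  symmetric under exchanging them. A triple \<open>(A, B, C)\<close> is a rational line, a triple \<open>(q, p, r)\<close> the
  rational point \<open>(p/q, r/q)\<close>, and \<open>offset\<close> measures the distance of this point to the line.\<close>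

definition lin :: "real \<Rightarrow> real \<Rightarrow> real \<Rightarrow> real \<Rightarrow> int \<Rightarrow> int \<Rightarrow> int \<Rightarrow> real \<Rightarrow> real" where
  "lin a\<^sub>1 b\<^sub>1 a\<^sub>2 b\<^sub>2 A B C x = of_int A * (a\<^sub>1 * x + b\<^sub>1) + of_int B * (a\<^sub>2 * x + b\<^sub>2) + of_int C"

definition slope :: "real \<Rightarrow> real \<Rightarrow> int \<Rightarrow> int \<Rightarrow> real" where
  "slope a\<^sub>1 a\<^sub>2 A B = of_int A * a\<^sub>1 + of_int B * a\<^sub>2"

text \<open>The truncation at 1 keeps the product at least 1 for horizontal and vertical lines too,
  so that it has a nonnegative level and can be a divisor.\<close>

definition size2 :: "int \<Rightarrow> int \<Rightarrow> real" where
  "size2 A B = max 1 \<bar>of_int A\<bar> * max 1 \<bar>of_int B\<bar>"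

definition defect :: "real \<Rightarrow> real \<Rightarrow> int \<Rightarrow> int \<Rightarrow> real \<Rightarrow> real" where
  "defect a b q p x = of_int q * (a * x + b) - of_int p"

definition offset :: "real \<Rightarrow> real \<Rightarrow> real \<Rightarrow> real \<Rightarrow> int \<Rightarrow> int \<Rightarrow> int \<Rightarrow> real" where
  "offset a\<^sub>1 b\<^sub>1 a\<^sub>2 b\<^sub>2 q p r = a\<^sub>1 * (of_int q * b\<^sub>2 - of_int r) - a\<^sub>2 * (of_int q * b\<^sub>1 - of_int p)"

lemma offset_eq: "offset a\<^sub>1 b\<^sub>1 a\<^sub>2 b\<^sub>2 q p r = a\<^sub>1 * defect a\<^sub>2 b\<^sub>2 q r x - a\<^sub>2 * defect a\<^sub>1 b\<^sub>1 q p x"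
  by (simp add: offset_def defect_def algebra_simps)

text \<open>The point is the cross product of the two lines; its defects at \<open>x\<close> are bilinear in \<open>(A, B)\<close> and the
  values of the two linear forms at \<open>x\<close>.\<close>

lemma lines_meet_near:
  fixes a\<^sub>1 b\<^sub>1 a\<^sub>2 b\<^sub>2 D G :: real and A\<^sub>1 B\<^sub>1 C\<^sub>1 A\<^sub>2 B\<^sub>2 C\<^sub>2 :: int
  defines "\<sigma>\<^sub>1 \<equiv> slope a\<^sub>1 a\<^sub>2 A\<^sub>1 B\<^sub>1" and "\<sigma>\<^sub>2 \<equiv> slope a\<^sub>1 a\<^sub>2 A\<^sub>2 B\<^sub>2"
    and "F\<^sub>1 \<equiv> lin a\<^sub>1 b\<^sub>1 a\<^sub>2 b\<^sub>2 A\<^sub>1 B\<^sub>1 C\<^sub>1" and "F\<^sub>2 \<equiv> lin a\<^sub>1 b\<^sub>1 a\<^sub>2 b\<^sub>2 A\<^sub>2 B\<^sub>2 C\<^sub>2"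
  assumes D: "1 \<le> D" and G: "1 \<le> G" "\<bar>a\<^sub>1\<bar> \<le> G" "\<bar>a\<^sub>2\<bar> \<le> G" "1 \<le> G * \<bar>a\<^sub>1\<bar>"
    and type: "\<bar>B\<^sub>1\<bar> \<le> \<bar>A\<^sub>1\<bar>" "\<bar>B\<^sub>2\<bar> \<le> \<bar>A\<^sub>2\<bar>"
    and size: "size2 A\<^sub>1 B\<^sub>1 \<le> D * p" "size2 A\<^sub>2 B\<^sub>2 \<le> D * p"
    and s: "0 < s" "s \<le> \<bar>\<sigma>\<^sub>1\<bar>" "\<bar>\<sigma>\<^sub>1\<bar> \<le> D * s" "s \<le> \<bar>\<sigma>\<^sub>2\<bar>" "\<bar>\<sigma>\<^sub>2\<bar> \<le> D * s"
    and p: "0 < p" "p * W^4 \<le> Q" and W: "1 \<le> W" and Q: "1 \<le> Q"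
    and zeros: "F\<^sub>1 z\<^sub>1 = 0" "F\<^sub>2 z\<^sub>2 = 0" "z\<^sub>1 \<noteq> z\<^sub>2" and near: "\<bar>z\<^sub>1 - z\<^sub>2\<bar> \<le> R" "\<bar>x - z\<^sub>1\<bar> \<le> R"
    and R: "s * R \<le> E * W^2 / Q" and E: "5 * G^2 * D^3 * E < 1"
  shows "\<exists>q p' r. 1 \<le> q \<and> real_of_int q \<le> 4 * G^2 * D^2 * p \<and>
           \<bar>defect a\<^sub>1 b\<^sub>1 q p' x * defect a\<^sub>2 b\<^sub>2 q r x\<bar> \<le> 15 * G^2 * D^4 * E^2 / Q"
proof -
  define q p' r where "q = A\<^sub>1 * B\<^sub>2 - A\<^sub>2 * B\<^sub>1" and "p' = B\<^sub>1 * C\<^sub>2 - B\<^sub>2 * C\<^sub>1" and "r = C\<^sub>1 * A\<^sub>2 - C\<^sub>2 * A\<^sub>1"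
  define \<xi> \<eta> \<theta> where "\<xi> = defect a\<^sub>1 b\<^sub>1 q p' x" and "\<eta> = defect a\<^sub>2 b\<^sub>2 q r x" and "\<theta> = offset a\<^sub>1 b\<^sub>1 a\<^sub>2 b\<^sub>2 q p' r"
  \<comment> \<open>Up to factors \<open>D\<close> and \<open>2 * D\<close>, \<open>y\<close> bounds
    the two linear forms at \<open>x\<close>; \<open>h\<close> bounds both coefficients
    \<open>B\<close>, the smaller ones.\<close>
  define y h where "y = s * R" and "h = sqrt (D * p)"
  have R0: "0 \<le> R" and R_pos: "0 < R" using near zeros by linarith+
  have y0: "0 < y" using s R_pos by (simp add: y_def)
  have E0: "0 < E"
  proof (rule ccontr)
    assume "\<not> 0 < E"
    then have "E * W^2 / Q \<le> 0" using Q by (auto simp: divide_le_0_iff mult_le_0_iff)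
    then show False using R y0 by (simp add: y_def)
  qed
  have aff: "F\<^sub>1 u = \<sigma>\<^sub>1 * (u - z\<^sub>1)" "F\<^sub>2 u = \<sigma>\<^sub>2 * (u - z\<^sub>2)" for u
    using zeros by (simp_all add: F\<^sub>1_def F\<^sub>2_def \<sigma>\<^sub>1_def \<sigma>\<^sub>2_def lin_def slope_def algebra_simps)
  have \<xi>: "\<xi> = of_int B\<^sub>2 * F\<^sub>1 x - of_int B\<^sub>1 * F\<^sub>2 x"
    by (simp add: \<xi>_def defect_def F\<^sub>1_def F\<^sub>2_def lin_def q_def p'_def algebra_simps)
  have \<theta>: "\<theta> = \<sigma>\<^sub>1 * \<sigma>\<^sub>2 * (z\<^sub>1 - z\<^sub>2)"
  proof -
    have "\<sigma>\<^sub>1 * F\<^sub>2 0 - \<sigma>\<^sub>2 * F\<^sub>1 0 = \<theta>"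
      by (simp add: \<theta>_def offset_def F\<^sub>1_def F\<^sub>2_def lin_def \<sigma>\<^sub>1_def \<sigma>\<^sub>2_def slope_def q_def p'_def r_def algebra_simps)
    then show ?thesis by (simp add: aff algebra_simps)
  qed
  have a1q: "a\<^sub>1 * of_int q = \<sigma>\<^sub>1 * of_int B\<^sub>2 - \<sigma>\<^sub>2 * of_int B\<^sub>1"
    by (simp add: q_def \<sigma>\<^sub>1_def \<sigma>\<^sub>2_def slope_def algebra_simps)
  have a1\<eta>: "a\<^sub>1 * \<eta> = \<theta> + a\<^sub>2 * \<xi>"
    using offset_eq[of a\<^sub>1 b\<^sub>1 a\<^sub>2 b\<^sub>2 q p' r x] by (simp add: \<theta>_def \<xi>_def \<eta>_def)
  have F1: "\<bar>F\<^sub>1 x\<bar> \<le> D * y"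
  proof -
    have "\<bar>F\<^sub>1 x\<bar> \<le> (D * s) * R" unfolding aff abs_mult using s near by (intro mult_mono) auto
    then show ?thesis by (simp add: y_def)
  qed
  have F2: "\<bar>F\<^sub>2 x\<bar> \<le> 2 * D * y"
  proof -
    have "\<bar>F\<^sub>2 x\<bar> \<le> (D * s) * (2 * R)" unfolding aff abs_mult using s near by (intro mult_mono) auto
    then show ?thesis by (simp add: y_def)
  qed
  \<comment> \<open>Two bounds for the smaller coefficient: \<open>B^2\<close> is at most the
    product of the coefficients, and the slope is at most \<open>2 * G\<close> times the larger one,
    so that \<open>B\<close> times the slope is again controlled by the size. The first serves the
    square of \<open>\<xi>\<close>, the second the product of \<open>\<xi>\<close> and
    \<open>\<theta>\<close>.\<close>
  have B_h: "\<bar>of_int B\<bar> \<le> h" and Bs: "\<bar>of_int B\<bar> * \<bar>slope a\<^sub>1 a\<^sub>2 A B\<bar> \<le> 2 * G * (D * p)"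
    if BA: "\<bar>B\<bar> \<le> \<bar>A\<bar>" and sz: "size2 A B \<le> D * p" for A B
  proof -
    have BA': "\<bar>real_of_int B\<bar> \<le> \<bar>real_of_int A\<bar>" using BA by linarith
    have AB: "\<bar>real_of_int A\<bar> * \<bar>real_of_int B\<bar> \<le> D * p"
      by (rule order_trans[OF _ sz]) (unfold size2_def, intro mult_mono, auto)
    have "(real_of_int B)^2 \<le> \<bar>real_of_int A\<bar> * \<bar>real_of_int B\<bar>"
      using mult_right_mono[OF BA', of "\<bar>real_of_int B\<bar>"] by (simp add: power2_eq_square)
    then show "\<bar>of_int B\<bar> \<le> h" unfolding h_def using AB by (intro real_le_rsqrt) simp
    have "\<bar>slope a\<^sub>1 a\<^sub>2 A B\<bar> \<le> \<bar>real_of_int A\<bar> * \<bar>a\<^sub>1\<bar> + \<bar>real_of_int B\<bar> * \<bar>a\<^sub>2\<bar>"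
      unfolding slope_def abs_mult[symmetric] by (rule abs_triangle_ineq)
    also have "\<dots> \<le> \<bar>real_of_int A\<bar> * G + \<bar>real_of_int A\<bar> * G"
      using G BA' by (intro add_mono mult_mono) auto
    finally have "\<bar>of_int B\<bar> * \<bar>slope a\<^sub>1 a\<^sub>2 A B\<bar> \<le> \<bar>of_int B\<bar> * (2 * G * \<bar>real_of_int A\<bar>)"
      by (intro mult_left_mono) auto
    also have "\<dots> = 2 * G * (\<bar>real_of_int A\<bar> * \<bar>real_of_int B\<bar>)" by simp
    also have "\<dots> \<le> 2 * G * (D * p)" using AB G by (intro mult_left_mono) auto
    finally show "\<bar>of_int B\<bar> * \<bar>slope a\<^sub>1 a\<^sub>2 A B\<bar> \<le> 2 * G * (D * p)" .
  qed
  note B_h = B_h[OF type(1) size(1)] B_h[OF type(2) size(2)]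
  note Bs = Bs[OF type(1) size(1), folded \<sigma>\<^sub>1_def] Bs[OF type(2) size(2), folded \<sigma>\<^sub>2_def]
  have Bs': "\<bar>of_int B\<^sub>1\<bar> * s \<le> 2 * G * (D * p)" "\<bar>of_int B\<^sub>2\<bar> * s \<le> 2 * G * (D * p)"
    by (rule order_trans[OF mult_left_mono Bs(1)]; use s in simp)
      (rule order_trans[OF mult_left_mono Bs(2)]; use s in simp)
  have \<xi>_le: "\<bar>\<xi>\<bar> \<le> (\<bar>of_int B\<^sub>2\<bar> + 2 * \<bar>of_int B\<^sub>1\<bar>) * (D * y)"
  proof -
    have "\<bar>\<xi>\<bar> \<le> \<bar>of_int B\<^sub>2\<bar> * \<bar>F\<^sub>1 x\<bar> + \<bar>of_int B\<^sub>1\<bar> * \<bar>F\<^sub>2 x\<bar>"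
      unfolding \<xi> abs_mult[symmetric] by (rule abs_triangle_ineq4)
    also have "\<dots> \<le> \<bar>of_int B\<^sub>2\<bar> * (D * y) + \<bar>of_int B\<^sub>1\<bar> * (2 * D * y)"
      using F1 F2 by (intro add_mono mult_left_mono) auto
    finally show ?thesis by (simp add: algebra_simps)
  qed
  have h0: "0 \<le> h" and h2: "h^2 = D * p" using D p by (auto simp: h_def)
  have \<xi>_h: "\<bar>\<xi>\<bar> \<le> 3 * h * (D * y)"
    by (rule order_trans[OF \<xi>_le], rule mult_right_mono) (use B_h D y0 in auto)
  have \<xi>_s: "\<bar>\<xi>\<bar> * s \<le> 6 * G * (D * p) * (D * y)"
  proof -
    have "\<bar>\<xi>\<bar> * s \<le> (\<bar>of_int B\<^sub>2\<bar> + 2 * \<bar>of_int B\<^sub>1\<bar>) * (D * y) * s"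
      using \<xi>_le s by (intro mult_right_mono) auto
    also have "\<dots> = (\<bar>of_int B\<^sub>2\<bar> * s + 2 * (\<bar>of_int B\<^sub>1\<bar> * s)) * (D * y)" by (simp add: algebra_simps)
    also have "\<dots> \<le> (2 * G * (D * p) + 2 * (2 * G * (D * p))) * (D * y)"
      by (intro mult_right_mono add_mono mult_left_mono Bs') (use D y0 in auto)
    finally show ?thesis by (simp add: algebra_simps)
  qed
  have \<theta>_le: "\<bar>\<theta>\<bar> \<le> D^2 * s * y"
  proof -
    have "\<bar>\<theta>\<bar> \<le> (D * s) * (D * s) * R"
      unfolding \<theta> abs_mult using s near D by (intro mult_mono) auto
    then show ?thesis by (simp add: y_def power2_eq_square algebra_simps)
  qed
  have \<eta>_le: "\<bar>\<eta>\<bar> \<le> G * (G * \<bar>\<xi>\<bar> + D^2 * s * y)"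
  proof -
    have "\<bar>\<eta>\<bar> \<le> G * \<bar>a\<^sub>1\<bar> * \<bar>\<eta>\<bar>" using mult_right_mono[OF G(4), of "\<bar>\<eta>\<bar>"] by simp
    also have "\<dots> = G * \<bar>\<theta> + a\<^sub>2 * \<xi>\<bar>" using a1\<eta> by (simp add: abs_mult[symmetric] mult.assoc)
    also have "\<dots> \<le> G * (D^2 * s * y + G * \<bar>\<xi>\<bar>)"
    proof (intro mult_left_mono)
      have "\<bar>a\<^sub>2 * \<xi>\<bar> \<le> G * \<bar>\<xi>\<bar>" unfolding abs_mult using G by (intro mult_right_mono) auto
      then show "\<bar>\<theta> + a\<^sub>2 * \<xi>\<bar> \<le> D^2 * s * y + G * \<bar>\<xi>\<bar>" using \<theta>_le by linarith
    qed (use G in simp)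
    finally show ?thesis by (simp add: algebra_simps)
  qed
  have y_le: "y \<le> E * W^2 / Q" using R by (simp add: y_def)
  have W2: "W^2 \<le> W^4" using W by (intro power_increasing) auto
  have py2: "p * y^2 \<le> E^2 / Q"
  proof -
    have "p * y^2 \<le> p * (E * W^2 / Q)^2" using y_le y0 p by (intro mult_left_mono power_mono) auto
    also have "\<dots> = (p * W^4) * (E^2 / Q^2)" by (simp add: power_mult_distrib power_divide)
    also have "\<dots> \<le> Q * (E^2 / Q^2)" using p by (intro mult_right_mono) auto
    also have "\<dots> = E^2 / Q" using Q by (simp add: power2_eq_square)
    finally show ?thesis .
  qed
  \<comment> \<open>Replacing \<open>a\<^sub>1 * \<eta>\<close> by
    \<open>\<theta> + a\<^sub>2 * \<xi>\<close> splits the product into a square of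
    \<open>\<xi>\<close>, estimated by \<open>\<xi>_h\<close>, and a mixed term, estimated by
    \<open>\<xi>_s\<close>; both end in \<open>p * y^2\<close>.\<close>
  have prod: "\<bar>\<xi> * \<eta>\<bar> \<le> 15 * G^2 * D^4 * E^2 / Q"
  proof -
    have "\<bar>\<xi> * \<eta>\<bar> \<le> \<bar>\<xi>\<bar> * (G * (G * \<bar>\<xi>\<bar> + D^2 * s * y))"
      unfolding abs_mult using \<eta>_le by (intro mult_left_mono) auto
    also have "\<dots> = G * (G * \<bar>\<xi>\<bar>^2 + (\<bar>\<xi>\<bar> * s) * (D^2 * y))" by (simp add: algebra_simps power2_eq_square)
    also have "\<dots> \<le> G * (G * (3 * h * (D * y))^2 + (6 * G * (D * p) * (D * y)) * (D^2 * y))"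
      using \<xi>_h \<xi>_s G D y0 by (intro mult_left_mono add_mono mult_right_mono power_mono) auto
    also have "(3 * h * (D * y))^2 = 9 * (D * p) * (D^2 * y^2)" by (simp add: power_mult_distrib h2)
    also have "G * (G * (9 * (D * p) * (D^2 * y^2)) + (6 * G * (D * p) * (D * y)) * (D^2 * y)) =
        G^2 * (9 * D^3 + 6 * D^4) * (p * y^2)"
      by (simp add: algebra_simps eval_nat_numeral)
    also have "\<dots> \<le> G^2 * (9 * D^4 + 6 * D^4) * (p * y^2)"
    proof -
      have "D^3 \<le> D^4" using D by (intro power_increasing) auto
      then show ?thesis using p by (intro mult_right_mono mult_left_mono) auto
    qed
    also have "\<dots> \<le> G^2 * (9 * D^4 + 6 * D^4) * (E^2 / Q)"
      using py2 by (intro mult_left_mono) auto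
    also have "\<dots> = 15 * G^2 * D^4 * E^2 / Q" by simp
    finally show ?thesis .
  qed
  have q_le: "\<bar>real_of_int q\<bar> \<le> 4 * G^2 * D^2 * p"
  proof -
    have "\<bar>real_of_int q\<bar> \<le> G * \<bar>a\<^sub>1\<bar> * \<bar>of_int q\<bar>" using mult_right_mono[OF G(4), of "\<bar>real_of_int q\<bar>"] by simp
    also have "\<dots> = G * \<bar>\<sigma>\<^sub>1 * of_int B\<^sub>2 - \<sigma>\<^sub>2 * of_int B\<^sub>1\<bar>" using a1q by (simp add: abs_mult[symmetric] mult.assoc)
    also have "\<dots> \<le> G * (D * (\<bar>of_int B\<^sub>2\<bar> * s) + D * (\<bar>of_int B\<^sub>1\<bar> * s))"
    proof (intro mult_left_mono)
      have "\<bar>\<sigma>\<^sub>1\<bar> * \<bar>of_int B\<^sub>2\<bar> \<le> (D * s) * \<bar>of_int B\<^sub>2\<bar>" "\<bar>\<sigma>\<^sub>2\<bar> * \<bar>of_int B\<^sub>1\<bar> \<le> (D * s) * \<bar>of_int B\<^sub>1\<bar>"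
        using s by (auto intro!: mult_right_mono)
      then show "\<bar>\<sigma>\<^sub>1 * of_int B\<^sub>2 - \<sigma>\<^sub>2 * of_int B\<^sub>1\<bar> \<le> D * (\<bar>of_int B\<^sub>2\<bar> * s) + D * (\<bar>of_int B\<^sub>1\<bar> * s)"
        using abs_triangle_ineq4[of "\<sigma>\<^sub>1 * of_int B\<^sub>2" "\<sigma>\<^sub>2 * of_int B\<^sub>1"] by (simp add: abs_mult algebra_simps)
    qed (use G in simp)
    also have "\<dots> \<le> G * (D * (2 * G * (D * p)) + D * (2 * G * (D * p)))"
      using Bs' G D by (intro mult_left_mono add_mono) auto
    finally show ?thesis by (simp add: power2_eq_square algebra_simps)
  qed
  \<comment> \<open>For \<open>q = 0\<close> both defects are integers of absolute value below 1,
    hence 0. Then \<open>\<theta>\<close> vanishes, although it is the product of two nonzero slopes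
    and \<open>z\<^sub>1 - z\<^sub>2\<close>.\<close>
  have "q \<noteq> 0"
  proof
    assume q0: "q = 0"
    have hW: "h * W^2 \<le> D * Q"
    proof -
      have "(h * W^2)^2 = D * (p * W^4)" by (simp add: power_mult_distrib h2 algebra_simps)
      also have "\<dots> \<le> D * Q" using p D by (intro mult_left_mono) auto
      also have "\<dots> \<le> (D * Q) * (D * Q)"
        using mult_left_mono[of 1 "D * Q" "D * Q"] mult_mono[of 1 D 1 Q] D Q by simp
      finally have "(h * W^2)^2 \<le> (D * Q)^2" by (simp add: power2_eq_square)
      then show ?thesis by (rule power2_le_imp_le) (use D Q in auto)
    qed
    have hy: "h * y \<le> D * E"
    proof -
      have "h * y \<le> h * (E * W^2 / Q)" using y_le h0 by (intro mult_left_mono) auto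
      also have "\<dots> = (h * W^2) * (E / Q)" by simp
      also have "\<dots> \<le> (D * Q) * (E / Q)" using hW E0 Q by (intro mult_right_mono) auto
      finally show ?thesis using Q by simp
    qed
    have s_le: "s \<le> 2 * G * (D * p)"
    proof -
      have "\<sigma>\<^sub>1 \<noteq> 0" using s by auto
      then have "A\<^sub>1 \<noteq> 0" using type(1) by (auto simp: \<sigma>\<^sub>1_def slope_def)
      have "\<bar>\<sigma>\<^sub>1\<bar> \<le> \<bar>real_of_int A\<^sub>1\<bar> * \<bar>a\<^sub>1\<bar> + \<bar>real_of_int B\<^sub>1\<bar> * \<bar>a\<^sub>2\<bar>"
        unfolding \<sigma>\<^sub>1_def slope_def abs_mult[symmetric] by (rule abs_triangle_ineq)
      also have "\<dots> \<le> \<bar>real_of_int A\<^sub>1\<bar> * G + \<bar>real_of_int A\<^sub>1\<bar> * G"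
        using G type(1) by (intro add_mono mult_mono) auto
      also have "\<dots> = 2 * G * \<bar>real_of_int A\<^sub>1\<bar>" by simp
      also have "\<dots> \<le> 2 * G * (D * p)"
      proof (intro mult_left_mono)
        have "\<bar>real_of_int A\<^sub>1\<bar> * 1 \<le> size2 A\<^sub>1 B\<^sub>1" unfolding size2_def by (intro mult_mono) auto
        then show "\<bar>real_of_int A\<^sub>1\<bar> \<le> D * p" using size by simp
      qed (use G in simp)
      finally show ?thesis using s by simp
    qed
    have sy: "s * y \<le> 2 * G * D * E"
    proof -
      have "s * y \<le> (2 * G * (D * p)) * (E * W^2 / Q)" using y_le s_le y0 G D p by (intro mult_mono) auto
      also have "\<dots> = 2 * G * D * E * ((p * W^2) / Q)" by simp
      also have "\<dots> \<le> 2 * G * D * E * 1"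
      proof (intro mult_left_mono)
        have "p * W^2 \<le> p * W^4" using W2 p by (intro mult_left_mono) auto
        then have "p * W^2 \<le> Q" using p(2) by linarith
        then show "p * W^2 / Q \<le> 1" using Q by simp
      qed (use G D E0 in auto)
      finally show ?thesis by simp
    qed
    have "\<bar>\<xi>\<bar> \<le> 3 * D * (h * y)" using \<xi>_h by (simp add: algebra_simps)
    also have "\<dots> \<le> 3 * D * (D * E)" using hy D by (intro mult_left_mono) auto
    finally have \<xi>E: "\<bar>\<xi>\<bar> \<le> 3 * D^2 * E" by (simp add: power2_eq_square)
    have \<eta>E: "\<bar>\<eta>\<bar> \<le> 5 * G^2 * D^3 * E"
    proof -
      have "\<bar>\<eta>\<bar> \<le> G * (G * \<bar>\<xi>\<bar> + D^2 * (s * y))" using \<eta>_le by (simp add: mult.assoc)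
      also have "\<dots> \<le> G * (G * (3 * D^2 * E) + D^2 * (2 * G * D * E))"
        using \<xi>E sy G by (intro mult_left_mono add_mono) auto
      also have "\<dots> = G^2 * E * (3 * D^2 + 2 * D^3)" by (simp add: power2_eq_square power3_eq_cube algebra_simps)
      also have "\<dots> \<le> G^2 * E * (3 * D^3 + 2 * D^3)"
        using power_increasing[of 2 3 D] D E0 by (intro mult_left_mono add_mono) auto
      also have "\<dots> = 5 * G^2 * D^3 * E" by simp
      finally show ?thesis .
    qed
    have "3 * D^2 * E \<le> 5 * G^2 * D^3 * E"
    proof -
      have "3 * D^2 \<le> 5 * 1 * D^3"
        using power_increasing[of 2 3 D] zero_le_power2[of D] D by linarith
      also have "\<dots> \<le> 5 * G^2 * D^3" using G D by (intro mult_right_mono mult_left_mono) (auto simp: one_le_power)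
      finally show ?thesis using E0 by (intro mult_right_mono) auto
    qed
    then have "\<bar>\<xi>\<bar> < 1" "\<bar>\<eta>\<bar> < 1" using \<xi>E \<eta>E E by linarith+
    then have "p' = 0" "r = 0" using q0 by (auto simp: \<xi>_def \<eta>_def defect_def)
    then have "\<theta> = 0" using q0 by (simp add: \<theta>_def offset_def)
    then show False using \<theta> zeros s by auto
  qed
  then consider "1 \<le> q" | "1 \<le> - q" by linarith
  then show ?thesis
  proof cases
    case 1
    then show ?thesis using q_le prod by (intro exI[of _ q] exI[of _ p'] exI[of _ r]) (auto simp: \<xi>_def \<eta>_def)
  next
    case 2
    have "defect a\<^sub>1 b\<^sub>1 (-q) (-p') x * defect a\<^sub>2 b\<^sub>2 (-q) (-r) x = \<xi> * \<eta>"
      by (simp add: \<xi>_def \<eta>_def defect_def algebra_simps)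
    then show ?thesis using 2 q_le prod
      by (intro exI[of _ "-q"] exI[of _ "-p'"] exI[of _ "-r"]) auto
  qed
qed

text \<open>The line is the cross product of the two points; \<open>a\<^sub>1\<close> times its linear form at \<open>x\<close>
  is \<open>\<xi>\<^sub>1 * \<theta>\<^sub>2 - \<xi>\<^sub>2 * \<theta>\<^sub>1\<close> with the defects \<open>\<xi>\<^sub>k\<close> and the offsets \<open>\<theta>\<^sub>k\<close>.\<close>

lemma points_span_near:
  fixes a\<^sub>1 b\<^sub>1 a\<^sub>2 b\<^sub>2 D G :: real and q\<^sub>1 p\<^sub>1 r\<^sub>1 q\<^sub>2 p\<^sub>2 r\<^sub>2 :: int
  defines "\<theta>\<^sub>1 \<equiv> offset a\<^sub>1 b\<^sub>1 a\<^sub>2 b\<^sub>2 q\<^sub>1 p\<^sub>1 r\<^sub>1" and "\<theta>\<^sub>2 \<equiv> offset a\<^sub>1 b\<^sub>1 a\<^sub>2 b\<^sub>2 q\<^sub>2 p\<^sub>2 r\<^sub>2"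
  assumes D: "1 \<le> D" and G: "1 \<le> G" "\<bar>a\<^sub>1\<bar> \<le> G" "\<bar>a\<^sub>2\<bar> \<le> G" "1 \<le> G * \<bar>a\<^sub>1\<bar>"
    and q: "1 \<le> q\<^sub>1" "1 \<le> q\<^sub>2" "of_int q\<^sub>1 \<le> D * n" "of_int q\<^sub>2 \<le> D * n"
    and \<theta>: "\<bar>\<theta>\<^sub>1\<bar> \<le> D * t" "\<bar>\<theta>\<^sub>2\<bar> \<le> D * t"
    and t: "0 < t" "c \<le> D^2 * t^2 * Q" and c: "0 < c" and n: "0 < n" "n * W^2 \<le> Q" "n \<le> Q" and W: "1 \<le> W"
    and zeros: "defect a\<^sub>1 b\<^sub>1 q\<^sub>1 p\<^sub>1 z\<^sub>1 = 0" "defect a\<^sub>1 b\<^sub>1 q\<^sub>2 p\<^sub>2 z\<^sub>2 = 0" "z\<^sub>1 \<noteq> z\<^sub>2"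
    and near: "\<bar>z\<^sub>1 - z\<^sub>2\<bar> \<le> R" "\<bar>x - z\<^sub>1\<bar> \<le> R"
    and R: "n * t * R \<le> E * W / Q"
  shows "\<exists>A B C. (A, B) \<noteq> (0, 0) \<and> \<bar>lin a\<^sub>1 b\<^sub>1 a\<^sub>2 b\<^sub>2 A B C x\<bar> \<le> 3 * G^2 * D^2 * E * W / Q \<and>
           size2 A B \<le> n * (2 * G^4 * D^6 * E^2 / c + 2 * G^2 * D^4 * E)"
proof -
  define A B C where "A = r\<^sub>1 * q\<^sub>2 - q\<^sub>1 * r\<^sub>2" and "B = q\<^sub>1 * p\<^sub>2 - p\<^sub>1 * q\<^sub>2" and "C = p\<^sub>1 * r\<^sub>2 - r\<^sub>1 * p\<^sub>2"
  define \<xi>\<^sub>1 \<xi>\<^sub>2 F \<sigma> where "\<xi>\<^sub>1 = defect a\<^sub>1 b\<^sub>1 q\<^sub>1 p\<^sub>1 x" and "\<xi>\<^sub>2 = defect a\<^sub>1 b\<^sub>1 q\<^sub>2 p\<^sub>2 x"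
    and "F = lin a\<^sub>1 b\<^sub>1 a\<^sub>2 b\<^sub>2 A B C x" and "\<sigma> = slope a\<^sub>1 a\<^sub>2 A B"
  have R_pos: "0 < R" using near zeros by linarith
  have Q: "0 < Q" using n by linarith
  have E0: "0 < E"
  proof (rule ccontr)
    assume "\<not> 0 < E"
    then have "E * W / Q \<le> 0" using Q W by (auto simp: divide_le_0_iff mult_le_0_iff)
    moreover have "0 < n * t * R" using n t R_pos by simp
    ultimately show False using R by simp
  qed
  have aff: "\<xi>\<^sub>1 = of_int q\<^sub>1 * a\<^sub>1 * (x - z\<^sub>1)" "\<xi>\<^sub>2 = of_int q\<^sub>2 * a\<^sub>1 * (x - z\<^sub>2)"
    using zeros by (simp_all add: \<xi>\<^sub>1_def \<xi>\<^sub>2_def defect_def algebra_simps)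
  have a1F: "a\<^sub>1 * F = \<xi>\<^sub>1 * \<theta>\<^sub>2 - \<xi>\<^sub>2 * \<theta>\<^sub>1"
    by (simp add: F_def lin_def \<xi>\<^sub>1_def \<xi>\<^sub>2_def \<theta>\<^sub>1_def \<theta>\<^sub>2_def defect_def offset_def A_def B_def C_def algebra_simps)
  have \<sigma>: "\<sigma> = of_int q\<^sub>1 * \<theta>\<^sub>2 - of_int q\<^sub>2 * \<theta>\<^sub>1"
    by (simp add: \<sigma>_def slope_def \<theta>\<^sub>1_def \<theta>\<^sub>2_def offset_def A_def B_def algebra_simps)
  have B: "of_int B = of_int q\<^sub>1 * of_int q\<^sub>2 * a\<^sub>1 * (z\<^sub>2 - z\<^sub>1)"
  proof -
    have "of_int p\<^sub>1 = of_int q\<^sub>1 * (a\<^sub>1 * z\<^sub>1 + b\<^sub>1)" "of_int p\<^sub>2 = of_int q\<^sub>2 * (a\<^sub>1 * z\<^sub>2 + b\<^sub>1)"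
      using zeros by (simp_all add: defect_def)
    then show ?thesis by (simp add: B_def algebra_simps)
  qed
  have "a\<^sub>1 \<noteq> 0" using G by auto
  \<comment> \<open>Distinct centres force the cross product to be a genuine line.\<close>
  then have "B \<noteq> 0" using B q zeros by auto
  then have B1: "1 \<le> \<bar>real_of_int B\<bar>" by linarith
  have \<xi>_le: "\<bar>\<xi>\<^sub>1\<bar> \<le> D * n * G * R" "\<bar>\<xi>\<^sub>2\<bar> \<le> D * n * G * (2 * R)"
    unfolding aff abs_mult using q G near D n by (auto intro!: mult_mono)
  have F_le: "\<bar>F\<bar> \<le> 3 * G^2 * D^2 * E * W / Q"
  proof -
    have "\<bar>F\<bar> \<le> G * \<bar>a\<^sub>1\<bar> * \<bar>F\<bar>" using mult_right_mono[OF G(4), of "\<bar>F\<bar>"] by simp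
    also have "\<dots> = G * \<bar>\<xi>\<^sub>1 * \<theta>\<^sub>2 - \<xi>\<^sub>2 * \<theta>\<^sub>1\<bar>" using a1F by (simp add: abs_mult[symmetric] mult.assoc)
    also have "\<dots> \<le> G * (D * n * G * R * (D * t) + D * n * G * (2 * R) * (D * t))"
    proof (intro mult_left_mono)
      have "\<bar>\<xi>\<^sub>1\<bar> * \<bar>\<theta>\<^sub>2\<bar> \<le> D * n * G * R * (D * t)" "\<bar>\<xi>\<^sub>2\<bar> * \<bar>\<theta>\<^sub>1\<bar> \<le> D * n * G * (2 * R) * (D * t)"
        using \<xi>_le \<theta> D n G R_pos by (auto intro!: mult_mono)
      then show "\<bar>\<xi>\<^sub>1 * \<theta>\<^sub>2 - \<xi>\<^sub>2 * \<theta>\<^sub>1\<bar> \<le> D * n * G * R * (D * t) + D * n * G * (2 * R) * (D * t)"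
        using abs_triangle_ineq4[of "\<xi>\<^sub>1 * \<theta>\<^sub>2" "\<xi>\<^sub>2 * \<theta>\<^sub>1"] unfolding abs_mult by linarith
    qed (use G in simp)
    also have "\<dots> = 3 * G^2 * D^2 * (n * t * R)" by (simp add: power2_eq_square)
    also have "\<dots> \<le> 3 * G^2 * D^2 * (E * W / Q)" using R by (intro mult_left_mono) auto
    finally show ?thesis by simp
  qed
  have B_le: "\<bar>real_of_int B\<bar> \<le> D^2 * G * n * (n * R)"
  proof -
    have "\<bar>real_of_int B\<bar> \<le> (D * n) * (D * n) * G * R"
      unfolding B abs_mult using q G near D n by (intro mult_mono) auto
    then show ?thesis by (simp add: power2_eq_square algebra_simps)
  qed
  have \<sigma>_le: "\<bar>\<sigma>\<bar> \<le> 2 * D^2 * n * t"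
  proof -
    have "\<bar>of_int q\<^sub>1 * \<theta>\<^sub>2\<bar> \<le> (D * n) * (D * t)" "\<bar>of_int q\<^sub>2 * \<theta>\<^sub>1\<bar> \<le> (D * n) * (D * t)"
      unfolding abs_mult using q \<theta> D n by (auto intro!: mult_mono)
    then show ?thesis unfolding \<sigma> power2_eq_square by (simp add: algebra_simps)
  qed
  \<comment> \<open>The lower bound for \<open>t^2 * Q\<close> enters here: it converts the factor
    1/t^2 into \<open>Q / c\<close> up to \<open>D\<close>, and \<open>n * W^2 \<le> Q\<close>
    absorbs what remains.\<close>
  have B2: "\<bar>real_of_int B\<bar>^2 \<le> D^6 * G^2 * (E^2 / c) * n"
  proof -
    have "n * R \<le> E * W / (Q * t)" using R t Q by (simp add: field_simps)
    then have "(n * R)^2 \<le> (E * W / (Q * t))^2" using n R_pos by (intro power_mono) auto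
    also have "\<dots> = E^2 * W^2 / (Q * (Q * t^2))" by (simp add: power2_eq_square algebra_simps)
    also have "\<dots> \<le> E^2 * W^2 / (Q * (c / D^2))"
      using t Q c D by (intro divide_left_mono mult_left_mono mult_pos_pos) (auto simp: field_simps)
    finally have nR: "(n * R)^2 \<le> E^2 * W^2 / (Q * (c / D^2))" .
    have "\<bar>real_of_int B\<bar>^2 \<le> (D^2 * G * n * (n * R))^2" using B_le by (intro power_mono) auto
    also have "\<dots> = D^4 * G^2 * n^2 * (n * R)^2" by (simp add: power_mult_distrib)
    also have "\<dots> \<le> D^4 * G^2 * n^2 * (E^2 * W^2 / (Q * (c / D^2)))"
      using nR by (intro mult_left_mono) auto
    also have "\<dots> = D^6 * G^2 * (E^2 / c) * n * ((n * W^2) / Q)"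
      using D by (simp add: divide_simps) (simp add: algebra_simps eval_nat_numeral)
    also have "\<dots> \<le> D^6 * G^2 * (E^2 / c) * n * 1"
      using n Q c by (intro mult_left_mono) auto
    finally show ?thesis by simp
  qed
  \<comment> \<open>In this product \<open>t\<close> comes from the slope and \<open>R\<close> from
    \<open>B\<close>, so the hypothesis on \<open>n * t * R\<close> applies directly.\<close>
  have \<sigma>B: "\<bar>\<sigma>\<bar> * \<bar>real_of_int B\<bar> \<le> 2 * D^4 * G * E * n"
  proof -
    have "\<bar>\<sigma>\<bar> * \<bar>real_of_int B\<bar> \<le> (2 * D^2 * n * t) * (D^2 * G * n * (n * R))"
      using \<sigma>_le B_le D n t by (intro mult_mono) auto
    also have "\<dots> = 2 * D^4 * G * n^2 * (n * t * R)" by (simp add: eval_nat_numeral)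
    also have "\<dots> \<le> 2 * D^4 * G * n^2 * (E * W / Q)" using R G by (intro mult_left_mono) auto
    also have "\<dots> = 2 * D^4 * G * E * n * (n * W / Q)" by (simp add: power2_eq_square)
    also have "\<dots> \<le> 2 * D^4 * G * E * n * 1"
    proof (intro mult_left_mono)
      have "n * W \<le> n * W^2" using W n by (intro mult_left_mono) (auto simp: power2_eq_square)
      then have "n * W \<le> Q" using n(2) by linarith
      then show "n * W / Q \<le> 1" using Q by simp
    qed (use G E0 n in auto)
    finally show ?thesis by simp
  qed
  have A_le: "\<bar>real_of_int A\<bar> \<le> G * (\<bar>\<sigma>\<bar> + G * \<bar>real_of_int B\<bar>)"
  proof -
    have "\<bar>real_of_int A\<bar> \<le> G * \<bar>a\<^sub>1\<bar> * \<bar>of_int A\<bar>" using mult_right_mono[OF G(4), of "\<bar>real_of_int A\<bar>"] by simp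
    also have "\<dots> = G * \<bar>\<sigma> - of_int B * a\<^sub>2\<bar>" by (simp add: \<sigma>_def slope_def abs_mult)
    also have "\<dots> \<le> G * (\<bar>\<sigma>\<bar> + \<bar>of_int B * a\<^sub>2\<bar>)" using G by (intro mult_left_mono) auto
    also have "\<dots> \<le> G * (\<bar>\<sigma>\<bar> + G * \<bar>real_of_int B\<bar>)"
    proof (intro mult_left_mono add_left_mono)
      show "\<bar>of_int B * a\<^sub>2\<bar> \<le> G * \<bar>real_of_int B\<bar>"
        unfolding abs_mult mult.commute[of "\<bar>real_of_int B\<bar>"] using G by (intro mult_right_mono) auto
    qed (use G in auto)
    finally show ?thesis .
  qed
  have "size2 A B = max 1 \<bar>real_of_int A\<bar> * \<bar>real_of_int B\<bar>" using B1 by (simp add: size2_def)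
  also have "\<dots> \<le> (2 * G^2 * \<bar>real_of_int B\<bar> + G * \<bar>\<sigma>\<bar>) * \<bar>real_of_int B\<bar>"
  proof (intro mult_right_mono)
    have "1 \<le> G^2 * \<bar>real_of_int B\<bar>" using mult_mono[of 1 "G^2" 1 "\<bar>real_of_int B\<bar>"] G B1 by (simp add: one_le_power)
    moreover have "0 \<le> G * \<bar>\<sigma>\<bar>" using G by simp
    ultimately show "max 1 \<bar>real_of_int A\<bar> \<le> 2 * G^2 * \<bar>real_of_int B\<bar> + G * \<bar>\<sigma>\<bar>"
      using A_le by (simp add: algebra_simps power2_eq_square)
  qed simp
  also have "\<dots> = 2 * G^2 * \<bar>real_of_int B\<bar>^2 + G * (\<bar>\<sigma>\<bar> * \<bar>real_of_int B\<bar>)"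
    by (simp add: algebra_simps power2_eq_square)
  also have "\<dots> \<le> 2 * G^2 * (D^6 * G^2 * (E^2 / c) * n) + G * (2 * D^4 * G * E * n)"
    using B2 \<sigma>B G by (intro add_mono mult_left_mono) auto
  also have "\<dots> = n * (2 * G^4 * D^6 * E^2 / c + 2 * G^2 * D^4 * E)"
    by (simp add: algebra_simps eval_nat_numeral)
  finally show ?thesis using F_le \<open>B \<noteq> 0\<close>
    by (intro exI[of _ A] exI[of _ B] exI[of _ C]) (auto simp: F_def)
qed

section \<open>Isolated intervals at a fixed scale\<close>

definition level :: "real \<Rightarrow> real \<Rightarrow> int" where
  "level D y = \<lfloor>log D y\<rfloor>"

lemma level:
  assumes "1 < D" "0 < y"
  shows "D powr real_of_int (level D y) \<le> y" "y \<le> D * D powr real_of_int (level D y)"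
proof -
  show "D powr real_of_int (level D y) \<le> y"
    using assms by (simp add: level_def powr_le_iff)
  have "log D y \<le> real_of_int (level D y) + 1" by (simp add: level_def)
  then have "y \<le> D powr (real_of_int (level D y) + 1)" using assms by (simp add: log_le_iff)
  then show "y \<le> D * D powr real_of_int (level D y)" using assms by (simp add: powr_add mult.commute)
qed

lemma level_nonneg: "1 < D \<Longrightarrow> 1 \<le> y \<Longrightarrow> 0 \<le> level D y"
  by (simp add: level_def)

text \<open>In the triples \<open>(z, i, j)\<close> below, \<open>z\<close> is a centre and \<open>(i, j)\<close> is a class: \<open>i\<close> is the level of the
  denominator (of \<open>size2\<close>), and \<open>j\<close> that of the offset (of the slope). Offsets below \<open>sqrt (c / Q)\<close>
  share one class, since they no longer influence the length of the interval.\<close>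

definition point_classes ::
    "real \<Rightarrow> real \<Rightarrow> real \<Rightarrow> real \<Rightarrow> real \<Rightarrow> real \<Rightarrow> real \<Rightarrow> real \<Rightarrow> (real \<times> int \<times> int) set" where
  "point_classes a\<^sub>1 b\<^sub>1 a\<^sub>2 b\<^sub>2 D G c Q = {(z, i, j). \<exists>q p r. 1 \<le> q \<and> real_of_int q \<le> Q \<and>
     defect a\<^sub>1 b\<^sub>1 q p z = 0 \<and> \<bar>offset a\<^sub>1 b\<^sub>1 a\<^sub>2 b\<^sub>2 q p r\<bar> \<le> G \<and>
     i = level D (real_of_int q) \<and> j = level D (max \<bar>offset a\<^sub>1 b\<^sub>1 a\<^sub>2 b\<^sub>2 q p r\<bar> (sqrt (c / Q)))}"

definition line_classes ::
    "real \<Rightarrow> real \<Rightarrow> real \<Rightarrow> real \<Rightarrow> real \<Rightarrow> real \<Rightarrow> real \<Rightarrow> (real \<times> int \<times> int) set" where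
  "line_classes a\<^sub>1 b\<^sub>1 a\<^sub>2 b\<^sub>2 D s Q = {(z, i, j). \<exists>A B C. \<bar>B\<bar> \<le> \<bar>A\<bar> \<and> size2 A B \<le> Q \<and>
     s \<le> \<bar>slope a\<^sub>1 a\<^sub>2 A B\<bar> \<and> lin a\<^sub>1 b\<^sub>1 a\<^sub>2 b\<^sub>2 A B C z = 0 \<and>
     i = level D (size2 A B) \<and> j = level D \<bar>slope a\<^sub>1 a\<^sub>2 A B\<bar>}"

definition isolated :: "real \<Rightarrow> (int \<Rightarrow> real) \<Rightarrow> (real \<times> int \<times> int) set \<Rightarrow> (real \<times> int \<times> int) set" where
  "isolated D f T = {(z, i, j) \<in> T.
     \<forall>z'. (z', i, j) \<in> T \<longrightarrow> z' = z \<or> f i * D powr - real_of_int j \<le> \<bar>z - z'\<bar>}"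

text \<open>The fraction, divided by \<open>D\<close> to the power of the offset class, bounds the
  distance from \<open>x\<close> to the centre of a dangerous point. The factor in front is the
  inverse of \<open>shrink\<close>: the deleted radius equals this bound, and the birth scale is
  larger.\<close>

definition point_scale :: "real \<Rightarrow> real \<Rightarrow> real \<Rightarrow> real \<Rightarrow> real \<Rightarrow> real \<Rightarrow> int \<Rightarrow> real" where
  "point_scale D G c \<delta> K Q i =
     K * (Q / D powr real_of_int i) powr \<delta> * (2 * G^2 * c) / (D powr real_of_int i * Q)"

text \<open>One of the two powers cancels \<open>shrink\<close>. The other one stays in the deleted
  radius, because it already occurs in the bound for the linear form that a non-isolated point
  provides.\<close>

definition line_scale :: "real \<Rightarrow> real \<Rightarrow> real \<Rightarrow> real \<Rightarrow> real \<Rightarrow> int \<Rightarrow> real" where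
  "line_scale D c \<delta> K Q i = K * ((Q / D powr real_of_int i) powr \<delta>)^2 * c / Q"

definition point_family where
  "point_family a\<^sub>1 b\<^sub>1 a\<^sub>2 b\<^sub>2 D G c \<delta> K Q =
     graded D \<delta> K Q (point_scale D G c \<delta> K Q)
       (isolated D (point_scale D G c \<delta> K Q) (point_classes a\<^sub>1 b\<^sub>1 a\<^sub>2 b\<^sub>2 D G c Q))"

definition line_family where
  "line_family a\<^sub>1 b\<^sub>1 a\<^sub>2 b\<^sub>2 D c s \<delta> K Q =
     graded D \<delta> K Q (line_scale D c \<delta> K Q)
       (isolated D (line_scale D c \<delta> K Q) (line_classes a\<^sub>1 b\<^sub>1 a\<^sub>2 b\<^sub>2 D s Q))"

lemma shrink_cancel:
  assumes "1 < D" "0 < Q" "K \<noteq> 0"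
  shows "shrink D \<delta> K Q i * (K * (Q / D powr real_of_int i) powr \<delta> * y) = y"
proof -
  have "(D powr real_of_int i / Q) powr \<delta> * (Q / D powr real_of_int i) powr \<delta> = 1"
    using assms by (subst powr_mult[symmetric]) auto
  then show ?thesis using assms by (simp add: shrink_def field_simps)
qed

text \<open>Points need the case \<open>k = 2\<close>, lines the case \<open>k = 4\<close>; the
  latter asks for \<open>\<delta> \<le> 1/4\<close>.\<close>

lemma powr_weight:
  fixes n Q \<delta> :: real
  assumes "0 < n" "n \<le> Q" "0 \<le> \<delta>" "\<delta> * real k \<le> 1"
  shows "1 \<le> (Q / n) powr \<delta>" "n * ((Q / n) powr \<delta>)^k \<le> Q"
proof -
  have Qn: "1 \<le> Q / n" using assms by simp
  then show "1 \<le> (Q / n) powr \<delta>" using assms by (simp add: ge_one_powr_ge_zero)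
  have "((Q / n) powr \<delta>)^k = (Q / n) powr (\<delta> * real k)"
    using Qn by (subst powr_power) (auto simp: mult.commute)
  also have "\<dots> \<le> (Q / n) powr 1" using Qn assms by (intro powr_mono) auto
  finally show "n * ((Q / n) powr \<delta>)^k \<le> Q" using assms Qn by (simp add: field_simps)
qed

text \<open>Since the deleted radius equals the bound for \<open>\<bar>x - z\<bar>\<close>, a
  dangerous point cannot be isolated, and \<open>points_span_near\<close> applies to it and a
  neighbour of its class. The gain \<open>4 * G^2 * D^2\<close> in the size of the line is what
  \<open>line_step\<close> loses again.\<close>

lemma point_step:
  fixes a\<^sub>1 b\<^sub>1 a\<^sub>2 b\<^sub>2 D G :: real and q p r :: int
  defines "\<theta> \<equiv> offset a\<^sub>1 b\<^sub>1 a\<^sub>2 b\<^sub>2 q p r"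
  assumes D: "1 < D" and G: "1 \<le> G" "\<bar>a\<^sub>1\<bar> \<le> G" "\<bar>a\<^sub>2\<bar> \<le> G" "1 \<le> G * \<bar>a\<^sub>1\<bar>"
    and c: "0 < c" and K: "1 \<le> K" and \<delta>: "0 < \<delta>" "\<delta> \<le> 1/4"
    and q: "1 \<le> q" "real_of_int q \<le> Q" and \<theta>: "\<bar>\<theta>\<bar> \<le> G"
    and close: "\<bar>defect a\<^sub>1 b\<^sub>1 q p x\<bar> * max \<bar>\<theta>\<bar> (sqrt (c / Q)) \<le> 2 * G * c / Q"
    and avoid: "\<And>z \<rho> R. (z, \<rho>, R) \<in> point_family a\<^sub>1 b\<^sub>1 a\<^sub>2 b\<^sub>2 D G c \<delta> K Q \<Longrightarrow> \<rho> < \<bar>x - z\<bar>"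
    and const: "4 * G^2 * D^2 * (2 * G^4 * D^6 * (2 * G^2 * K * c)^2 / c + 2 * G^2 * D^4 * (2 * G^2 * K * c)) < 1"
  shows "\<exists>A B C. (A, B) \<noteq> (0, 0) \<and> 4 * G^2 * D^2 * size2 A B < real_of_int q \<and>
           \<bar>lin a\<^sub>1 b\<^sub>1 a\<^sub>2 b\<^sub>2 A B C x\<bar> \<le> 3 * G^2 * D^2 * (2 * G^2 * K * c) * (Q / size2 A B) powr \<delta> / Q"
proof -
  define i j where "i = level D (real_of_int q)" and "j = level D (max \<bar>\<theta>\<bar> (sqrt (c / Q)))"
  define n t where "n = D powr real_of_int i" and "t = D powr real_of_int j"
  define W where "W = (Q / n) powr \<delta>"
  define z where "z = (of_int p / of_int q - b\<^sub>1) / a\<^sub>1"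
  define R where "R = point_scale D G c \<delta> K Q i * D powr - real_of_int j"
  define E where "E = 2 * G^2 * K * c"
  have Q: "1 \<le> Q" using q by linarith
  have a1: "a\<^sub>1 \<noteq> 0" using G by auto
  have n: "0 < n" "n \<le> of_int q" "n \<le> Q" using level(1)[OF D, of "real_of_int q"] q D by (auto simp: n_def i_def)
  have \<omega>: "0 < sqrt (c / Q)" "0 < max y (sqrt (c / Q))" for y
    using c Q by (auto simp: less_max_iff_disj)
  have t: "0 < t" "t \<le> max \<bar>\<theta>\<bar> (sqrt (c / Q))"
    using level(1)[OF D, of "max \<bar>\<theta>\<bar> (sqrt (c / Q))"] \<omega> D by (auto simp: t_def j_def)
  have W: "1 \<le> W" "n * W^2 \<le> Q"
    using powr_weight[OF n(1,3), of \<delta> 2] \<delta> by (auto simp: W_def)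
  have R_eq: "R = K * W * (2 * G^2 * c / (n * Q * t))"
    by (simp add: R_def point_scale_def W_def n_def t_def powr_minus divide_inverse mult_ac)
  have z: "defect a\<^sub>1 b\<^sub>1 q p z = 0" using q a1 by (simp add: defect_def z_def)
  have mem: "(z, i, j) \<in> point_classes a\<^sub>1 b\<^sub>1 a\<^sub>2 b\<^sub>2 D G c Q"
    using z q \<theta> by (auto simp: point_classes_def i_def j_def \<theta>_def)
  have x_z: "\<bar>x - z\<bar> \<le> 2 * G^2 * c / (n * Q * t)"
  proof -
    have "defect a\<^sub>1 b\<^sub>1 q p x = of_int q * a\<^sub>1 * (x - z)" using z by (simp add: defect_def algebra_simps)
    then have eq: "\<bar>defect a\<^sub>1 b\<^sub>1 q p x\<bar> = of_int q * \<bar>a\<^sub>1\<bar> * \<bar>x - z\<bar>" using q by (simp add: abs_mult)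
    have "n * t * \<bar>x - z\<bar> \<le> of_int q * t * (G * \<bar>a\<^sub>1\<bar> * \<bar>x - z\<bar>)"
      using n t mult_right_mono[OF G(4), of "\<bar>x - z\<bar>"] q by (intro mult_mono) auto
    also have "\<dots> = G * (\<bar>defect a\<^sub>1 b\<^sub>1 q p x\<bar> * t)" by (simp add: eq)
    also have "\<dots> \<le> G * (\<bar>defect a\<^sub>1 b\<^sub>1 q p x\<bar> * max \<bar>\<theta>\<bar> (sqrt (c / Q)))"
      using G t by (intro mult_left_mono) auto
    also have "\<dots> \<le> G * (2 * G * c / Q)" using close G by (intro mult_left_mono) auto
    finally show ?thesis using n t Q by (simp add: field_simps power2_eq_square)
  qed
  have "(z, i, j) \<notin> isolated D (point_scale D G c \<delta> K Q) (point_classes a\<^sub>1 b\<^sub>1 a\<^sub>2 b\<^sub>2 D G c Q)"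
  proof
    assume "(z, i, j) \<in> isolated D (point_scale D G c \<delta> K Q) (point_classes a\<^sub>1 b\<^sub>1 a\<^sub>2 b\<^sub>2 D G c Q)"
    then have "(z, shrink D \<delta> K Q i * R, R) \<in> point_family a\<^sub>1 b\<^sub>1 a\<^sub>2 b\<^sub>2 D G c \<delta> K Q"
      unfolding point_family_def graded_def R_def by (intro image_eqI[of _ _ "(z, i, j)"]) auto
    then have "shrink D \<delta> K Q i * R < \<bar>x - z\<bar>" by (rule avoid)
    moreover have "shrink D \<delta> K Q i * R = 2 * G^2 * c / (n * Q * t)"
      unfolding R_eq W_def n_def using D Q K by (intro shrink_cancel) auto
    ultimately show False using x_z by linarith
  qed
  then obtain z' where z': "(z', i, j) \<in> point_classes a\<^sub>1 b\<^sub>1 a\<^sub>2 b\<^sub>2 D G c Q" "z' \<noteq> z" "\<bar>z - z'\<bar> < R"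
    using mem by (auto simp: isolated_def R_def not_le)
  then obtain q' p' r' where v': "1 \<le> q'" "defect a\<^sub>1 b\<^sub>1 q' p' z' = 0"
      "i = level D (real_of_int q')" "j = level D (max \<bar>offset a\<^sub>1 b\<^sub>1 a\<^sub>2 b\<^sub>2 q' p' r'\<bar> (sqrt (c / Q)))"
    by (auto simp: point_classes_def)
  have up: "of_int q \<le> D * n" "of_int q' \<le> D * n"
    using level(2)[OF D, of "real_of_int q"] level(2)[OF D, of "real_of_int q'", folded v'(3)] q(1) v'(1)
    by (simp_all add: n_def i_def)
  have upt: "max \<bar>\<theta>\<bar> (sqrt (c / Q)) \<le> D * t" "max \<bar>offset a\<^sub>1 b\<^sub>1 a\<^sub>2 b\<^sub>2 q' p' r'\<bar> (sqrt (c / Q)) \<le> D * t"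
    using level(2)[OF D \<omega>(2)[of "\<bar>\<theta>\<bar>"]]
      level(2)[OF D \<omega>(2)[of "\<bar>offset a\<^sub>1 b\<^sub>1 a\<^sub>2 b\<^sub>2 q' p' r'\<bar>"], folded v'(4)]
    by (simp_all only: t_def j_def)
  \<comment> \<open>This is the purpose of truncating offsets at \<open>sqrt (c / Q)\<close>: the
    class then bounds \<open>t\<close> from below.\<close>
  have "c \<le> D^2 * t^2 * Q"
  proof -
    have "(sqrt (c / Q))^2 \<le> (D * t)^2" using upt \<omega> by (intro power_mono) auto
    then show ?thesis using c Q by (simp add: field_simps power_mult_distrib)
  qed
  have ntR: "n * t * R = E * W / Q"
    using n t Q by (simp add: R_eq E_def field_simps)
  have "2 * G^2 * c / (n * Q * t) \<le> R"
  proof -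
    have "1 * (2 * G^2 * c / (n * Q * t)) \<le> K * W * (2 * G^2 * c / (n * Q * t))"
      using mult_mono[of 1 K 1 W] K W c n t Q by (intro mult_right_mono) auto
    then show ?thesis by (simp add: R_eq)
  qed
  then have "\<bar>x - z\<bar> \<le> R" using x_z by linarith
  then obtain A B C where ABC: "(A, B) \<noteq> (0, 0)" "\<bar>lin a\<^sub>1 b\<^sub>1 a\<^sub>2 b\<^sub>2 A B C x\<bar> \<le> 3 * G^2 * D^2 * E * W / Q"
    "size2 A B \<le> n * (2 * G^4 * D^6 * E^2 / c + 2 * G^2 * D^4 * E)"
    using points_span_near[where b\<^sub>2 = b\<^sub>2 and r\<^sub>1 = r and r\<^sub>2 = r' and R = R and x = x and E = E, OF less_imp_le[OF D] G q(1) v'(1) up _ _ t(1) \<open>c \<le> _\<close> c n(1) W(2) n(3) W(1) z v'(2) z'(2)[symmetric]]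
      upt z'(3) ntR by (auto simp: \<theta>_def)
  have sz1: "1 \<le> size2 A B" unfolding size2_def using mult_mono[of 1 "max 1 \<bar>real_of_int A\<bar>" 1 "max 1 \<bar>real_of_int B\<bar>"] by simp
  have "4 * G^2 * D^2 * size2 A B \<le> 4 * G^2 * D^2 * (n * (2 * G^4 * D^6 * E^2 / c + 2 * G^2 * D^4 * E))"
    using ABC by (intro mult_left_mono) auto
  also have "\<dots> = n * (4 * G^2 * D^2 * (2 * G^4 * D^6 * E^2 / c + 2 * G^2 * D^4 * E))" by (simp only: mult_ac)
  also have "\<dots> < n * 1" using const n by (intro mult_strict_left_mono) (auto simp: E_def)
  finally have sz: "4 * G^2 * D^2 * size2 A B < n" by simp
  \<comment> \<open>As the size of the line is at most \<open>n\<close>, the weight \<open>W\<close>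
    may be enlarged to the power built from this size, the form in which closeness to a line is
    measured.\<close>
  have "1 * size2 A B \<le> 4 * G^2 * D^2 * size2 A B"
  proof (intro mult_right_mono)
    have "1 \<le> G^2 * D^2" using mult_mono[of 1 "G^2" 1 "D^2"] G D by (simp add: one_le_power)
    then show "1 \<le> 4 * G^2 * D^2" by simp
  qed (use sz1 in simp)
  then have "size2 A B \<le> n" using sz by simp
  then have "W \<le> (Q / size2 A B) powr \<delta>"
    unfolding W_def using sz1 Q n \<delta> by (intro powr_mono2 divide_left_mono) auto
  moreover have "0 \<le> E" using K c by (simp add: E_def)
  ultimately have "3 * G^2 * D^2 * E * W / Q \<le> 3 * G^2 * D^2 * E * (Q / size2 A B) powr \<delta> / Q"
    using Q by (intro divide_right_mono mult_left_mono) auto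
  then show ?thesis using ABC sz n unfolding E_def by (intro exI[of _ A] exI[of _ B] exI[of _ C]) auto
qed

text \<open>A line close to \<open>x\<close> whose deleted interval is avoided has a neighbour in
  its class, and \<open>lines_meet_near\<close> applies to the two. The result is quadratic in
  \<open>c\<close>, which is what lets the descent close.\<close>

lemma line_step:
  fixes a\<^sub>1 b\<^sub>1 a\<^sub>2 b\<^sub>2 D G :: real and A B C :: int
  defines "\<sigma> \<equiv> slope a\<^sub>1 a\<^sub>2 A B"
  assumes D: "1 < D" and G: "1 \<le> G" "\<bar>a\<^sub>1\<bar> \<le> G" "\<bar>a\<^sub>2\<bar> \<le> G" "1 \<le> G * \<bar>a\<^sub>1\<bar>"
    and c: "0 < c" and K: "1 \<le> K" and \<delta>: "0 < \<delta>" "\<delta> \<le> 1/4" and Q: "1 \<le> Q"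
    and type: "\<bar>B\<bar> \<le> \<bar>A\<bar>" and size: "size2 A B \<le> Q" and s: "0 < s" "s \<le> \<bar>\<sigma>\<bar>"
    and close: "\<bar>lin a\<^sub>1 b\<^sub>1 a\<^sub>2 b\<^sub>2 A B C x\<bar> \<le> c * (Q / size2 A B) powr \<delta> / Q"
    and avoid: "\<And>z \<rho> R. (z, \<rho>, R) \<in> line_family a\<^sub>1 b\<^sub>1 a\<^sub>2 b\<^sub>2 D c s \<delta> K Q \<Longrightarrow> \<rho> < \<bar>x - z\<bar>"
    and const: "5 * G^2 * D^3 * (K * c) < 1"
  shows "\<exists>q p r. 1 \<le> q \<and> real_of_int q \<le> 4 * G^2 * D^2 * size2 A B \<and>
           \<bar>defect a\<^sub>1 b\<^sub>1 q p x * defect a\<^sub>2 b\<^sub>2 q r x\<bar> \<le> 15 * G^2 * D^4 * (K * c)^2 / Q"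
proof -
  define i j where "i = level D (size2 A B)" and "j = level D \<bar>\<sigma>\<bar>"
  define n t where "n = D powr real_of_int i" and "t = D powr real_of_int j"
  define W where "W = (Q / n) powr \<delta>"
  define z where "z = - lin a\<^sub>1 b\<^sub>1 a\<^sub>2 b\<^sub>2 A B C 0 / \<sigma>"
  define R where "R = line_scale D c \<delta> K Q i * D powr - real_of_int j"
  have sz1: "1 \<le> size2 A B" for A B
    unfolding size2_def using mult_mono[of 1 "max 1 \<bar>real_of_int A\<bar>" 1 "max 1 \<bar>real_of_int B\<bar>"] by simp
  have n: "0 < n" "n \<le> size2 A B" "n \<le> Q"
    using level(1)[OF D, of "size2 A B"] sz1[of A B] size D by (auto simp: n_def i_def)
  have t: "0 < t" "t \<le> \<bar>\<sigma>\<bar>" using level(1)[OF D, of "\<bar>\<sigma>\<bar>"] s D by (auto simp: t_def j_def)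
  have W: "1 \<le> W" "n * W^4 \<le> Q"
    using powr_weight[OF n(1,3), of \<delta> 4] \<delta> by (auto simp: W_def)
  have R_eq: "R = K * W * (c * W / (Q * t))"
    by (simp add: R_def line_scale_def W_def n_def t_def powr_minus divide_inverse power2_eq_square mult_ac)
  have "\<sigma> \<noteq> 0" using s by auto
  have aff: "lin a\<^sub>1 b\<^sub>1 a\<^sub>2 b\<^sub>2 A B C u = \<sigma> * (u - z)" for u
  proof -
    have "\<sigma> * z = - lin a\<^sub>1 b\<^sub>1 a\<^sub>2 b\<^sub>2 A B C 0" using \<open>\<sigma> \<noteq> 0\<close> by (simp add: z_def)
    moreover have "lin a\<^sub>1 b\<^sub>1 a\<^sub>2 b\<^sub>2 A B C u = \<sigma> * u + lin a\<^sub>1 b\<^sub>1 a\<^sub>2 b\<^sub>2 A B C 0"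
      by (simp add: lin_def \<sigma>_def slope_def algebra_simps)
    ultimately show ?thesis by (simp add: algebra_simps)
  qed
  have z: "lin a\<^sub>1 b\<^sub>1 a\<^sub>2 b\<^sub>2 A B C z = 0" by (simp add: aff)
  have mem: "(z, i, j) \<in> line_classes a\<^sub>1 b\<^sub>1 a\<^sub>2 b\<^sub>2 D s Q"
    using z type size s by (auto simp: line_classes_def i_def j_def \<sigma>_def)
  have x_z: "\<bar>x - z\<bar> \<le> c * W / (Q * t)"
  proof -
    have "t * \<bar>x - z\<bar> \<le> \<bar>\<sigma>\<bar> * \<bar>x - z\<bar>" using t by (intro mult_right_mono) auto
    also have "\<dots> \<le> c * (Q / size2 A B) powr \<delta> / Q" using close by (simp add: aff abs_mult)
    also have "\<dots> \<le> c * W / Q"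
      unfolding W_def using n sz1[of A B] Q c \<delta>
      by (intro divide_right_mono mult_left_mono powr_mono2 divide_left_mono) auto
    finally show ?thesis using t Q by (simp add: field_simps)
  qed
  have "(z, i, j) \<notin> isolated D (line_scale D c \<delta> K Q) (line_classes a\<^sub>1 b\<^sub>1 a\<^sub>2 b\<^sub>2 D s Q)"
  proof
    assume "(z, i, j) \<in> isolated D (line_scale D c \<delta> K Q) (line_classes a\<^sub>1 b\<^sub>1 a\<^sub>2 b\<^sub>2 D s Q)"
    then have "(z, shrink D \<delta> K Q i * R, R) \<in> line_family a\<^sub>1 b\<^sub>1 a\<^sub>2 b\<^sub>2 D c s \<delta> K Q"
      unfolding line_family_def graded_def R_def by (intro image_eqI[of _ _ "(z, i, j)"]) auto
    then have "shrink D \<delta> K Q i * R < \<bar>x - z\<bar>" by (rule avoid)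
    moreover have "shrink D \<delta> K Q i * R = c * W / (Q * t)"
      unfolding R_eq W_def n_def using D Q K by (intro shrink_cancel) auto
    ultimately show False using x_z by linarith
  qed
  then obtain z' where z': "(z', i, j) \<in> line_classes a\<^sub>1 b\<^sub>1 a\<^sub>2 b\<^sub>2 D s Q" "z' \<noteq> z" "\<bar>z - z'\<bar> < R"
    using mem by (auto simp: isolated_def R_def not_le)
  then obtain A' B' C' where L': "\<bar>B'\<bar> \<le> \<bar>A'\<bar>" "s \<le> \<bar>slope a\<^sub>1 a\<^sub>2 A' B'\<bar>" "lin a\<^sub>1 b\<^sub>1 a\<^sub>2 b\<^sub>2 A' B' C' z' = 0"
      "i = level D (size2 A' B')" "j = level D \<bar>slope a\<^sub>1 a\<^sub>2 A' B'\<bar>"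
    by (auto simp: line_classes_def)
  have up: "size2 A B \<le> D * n" "size2 A' B' \<le> D * n"
    using level(2)[OF D, of "size2 A B"] level(2)[OF D, of "size2 A' B'", folded L'(4)] sz1[of A B] sz1[of A' B']
    by (simp_all add: n_def i_def)
  have upt: "\<bar>\<sigma>\<bar> \<le> D * t" "t \<le> \<bar>slope a\<^sub>1 a\<^sub>2 A' B'\<bar>" "\<bar>slope a\<^sub>1 a\<^sub>2 A' B'\<bar> \<le> D * t"
    using level(2)[OF D, of "\<bar>\<sigma>\<bar>"] level[OF D, of "\<bar>slope a\<^sub>1 a\<^sub>2 A' B'\<bar>", folded L'(5)] s L'(2)
    by (simp_all add: t_def j_def)
  have tR: "t * R = (K * c) * W^2 / Q"
    using t Q by (simp add: R_eq field_simps power2_eq_square)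
  have "c * W / (Q * t) \<le> R"
  proof -
    have "1 * (c * W / (Q * t)) \<le> K * W * (c * W / (Q * t))"
      using mult_mono[of 1 K 1 W] K W c t Q by (intro mult_right_mono) auto
    then show ?thesis by (simp add: R_eq)
  qed
  then have xR: "\<bar>x - z\<bar> \<le> R" using x_z by linarith
  obtain q p r where q: "1 \<le> q" "real_of_int q \<le> 4 * G^2 * D^2 * n"
    "\<bar>defect a\<^sub>1 b\<^sub>1 q p x * defect a\<^sub>2 b\<^sub>2 q r x\<bar> \<le> 15 * G^2 * D^4 * (K * c)^2 / Q"
    using lines_meet_near[OF less_imp_le[OF D] G type L'(1) up t(1) t(2)[unfolded \<sigma>_def] upt[unfolded \<sigma>_def] n(1) W(2,1) Q z L'(3)
      z'(2)[symmetric] less_imp_le[OF z'(3)] xR _ const] tR by auto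
  have "4 * G^2 * D^2 * n \<le> 4 * G^2 * D^2 * size2 A B" using n by (intro mult_left_mono) auto
  then show ?thesis using q by (intro exI[of _ q] exI[of _ p] exI[of _ r]) auto
qed

section \<open>Exchange of the coordinates, and descent on the denominator\<close>

lemma lin_swap: "lin a\<^sub>2 b\<^sub>2 a\<^sub>1 b\<^sub>1 B A C x = lin a\<^sub>1 b\<^sub>1 a\<^sub>2 b\<^sub>2 A B C x"
  by (simp add: lin_def)

lemma slope_swap: "slope a\<^sub>2 a\<^sub>1 B A = slope a\<^sub>1 a\<^sub>2 A B"
  by (simp add: slope_def)

lemma size2_swap: "size2 B A = size2 A B"
  by (simp add: size2_def mult.commute)

lemma offset_swap: "offset a\<^sub>2 b\<^sub>2 a\<^sub>1 b\<^sub>1 q r p = - offset a\<^sub>1 b\<^sub>1 a\<^sub>2 b\<^sub>2 q p r"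
  by (simp add: offset_def)

lemma size2_ge_1: "1 \<le> size2 A B"
  unfolding size2_def using mult_mono[of 1 "max 1 \<bar>real_of_int A\<bar>" 1 "max 1 \<bar>real_of_int B\<bar>"] by simp

text \<open>The last four inequalities say in turn: the line found from a point is close enough to
  be treated as dangerous; its size is smaller than the denominator by the factor that is lost
  later; the point found from a line is dangerous again; and the smallness condition of
  \<open>lines_meet_near\<close>, which excludes a zero denominator, holds.\<close>

definition admissible_constants :: "real \<Rightarrow> real \<Rightarrow> real \<Rightarrow> real \<Rightarrow> real \<Rightarrow> bool" where
  "admissible_constants D G K c\<^sub>P c\<^sub>L \<longleftrightarrow> 1 < D \<and> 1 \<le> G \<and> 1 \<le> K \<and> 0 < c\<^sub>P \<and> c\<^sub>P \<le> c\<^sub>L \<and> c\<^sub>L \<le> 1 \<and>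
     3 * G^2 * D^2 * (2 * G^2 * K * c\<^sub>P) \<le> c\<^sub>L \<and>
     4 * G^2 * D^2 * (2 * G^4 * D^6 * (2 * G^2 * K * c\<^sub>P)^2 / c\<^sub>P + 2 * G^2 * D^4 * (2 * G^2 * K * c\<^sub>P)) < 1 \<and>
     15 * G^2 * D^4 * (K * c\<^sub>L)^2 < c\<^sub>P \<and> 5 * G^2 * D^3 * (K * c\<^sub>L) < 1"

text \<open>With \<open>c\<^sub>L\<close> a fixed multiple of \<open>c\<^sub>P\<close>, the
  remaining conditions only ask that certain monomials in \<open>G\<close>, \<open>D\<close>,
  \<open>K\<close> times \<open>c\<^sub>P\<close> be small. \<open>M\<close> dominates all of
  them.\<close>

lemma admissible_constants_exist:
  assumes D: "1 < D" and G: "1 \<le> G" and K: "1 \<le> K"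
  shows "\<exists>c\<^sub>P c\<^sub>L. admissible_constants D G K c\<^sub>P c\<^sub>L"
proof -
  define M where "M = G^10 * D^8 * K^4"
  define c\<^sub>P where "c\<^sub>P = 1 / (1000 * M)"
  define c\<^sub>L where "c\<^sub>L = 6 * G^4 * D^2 * K * c\<^sub>P"
  have ge: "1 \<le> G^i * D^j * K^k" for i j k
    using mult_mono[of 1 "G^i * D^j" 1 "K^k"] mult_mono[of 1 "G^i" 1 "D^j"] D G K by (simp add: one_le_power)
  have M: "G^i * D^j * K^k \<le> M" if "i \<le> 10" "j \<le> 8" "k \<le> 4" for i j k
    unfolding M_def using that D G K by (intro mult_mono power_increasing) auto
  have M1: "1 \<le> M" using ge unfolding M_def by blast
  have c0: "0 < c\<^sub>P" using M1 by (simp add: c\<^sub>P_def)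
  have mono: "G^i * D^j * K^k * c\<^sub>P \<le> 1 / 1000" if "i \<le> 10" "j \<le> 8" "k \<le> 4" for i j k
    using M[OF that] M1 by (simp add: c\<^sub>P_def field_simps)
  have eq1: "4 * G^2 * D^2 * (2 * G^4 * D^6 * (2 * G^2 * K * c\<^sub>P)^2 / c\<^sub>P + 2 * G^2 * D^4 * (2 * G^2 * K * c\<^sub>P)) =
      32 * (G^10 * D^8 * K^2 * c\<^sub>P) + 16 * (G^6 * D^6 * K^1 * c\<^sub>P)"
    using c0 by (simp add: field_simps eval_nat_numeral)
  have eq2: "15 * G^2 * D^4 * (K * c\<^sub>L)^2 = 540 * (G^10 * D^8 * K^4 * c\<^sub>P) * c\<^sub>P"
    by (simp add: c\<^sub>L_def field_simps eval_nat_numeral)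
  have eq3: "5 * G^2 * D^3 * (K * c\<^sub>L) = 30 * (G^6 * D^5 * K^2 * c\<^sub>P)"
    by (simp add: c\<^sub>L_def field_simps eval_nat_numeral)
  have eq4: "c\<^sub>L = 6 * (G^4 * D^2 * K^1 * c\<^sub>P)" by (simp add: c\<^sub>L_def)
  have eq5: "3 * G^2 * D^2 * (2 * G^2 * K * c\<^sub>P) = c\<^sub>L" by (simp add: c\<^sub>L_def eval_nat_numeral)
  have "1 * c\<^sub>P \<le> (6 * (G^4 * D^2 * K^1)) * c\<^sub>P" using ge[of 4 2 1] c0 by (intro mult_right_mono) linarith+
  then have "c\<^sub>P \<le> c\<^sub>L" unfolding eq4 by simp
  moreover have "540 * (G^10 * D^8 * K^4 * c\<^sub>P) * c\<^sub>P < 1 * c\<^sub>P"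
    using mono[of 10 8 4] c0 by (intro mult_strict_right_mono) auto
  ultimately have "admissible_constants D G K c\<^sub>P c\<^sub>L"
    unfolding admissible_constants_def eq1 eq2 eq3 eq5
    using D G K c0 mono[of 10 8 2] mono[of 6 6 1] mono[of 6 5 2] mono[of 4 2 1] eq4 by auto
  then show ?thesis by blast
qed

definition danger_family where
  "danger_family a\<^sub>1 b\<^sub>1 a\<^sub>2 b\<^sub>2 D G c\<^sub>P c\<^sub>L s \<delta> K Q =
     (point_family a\<^sub>1 b\<^sub>1 a\<^sub>2 b\<^sub>2 D G c\<^sub>P \<delta> K Q \<union> line_family a\<^sub>1 b\<^sub>1 a\<^sub>2 b\<^sub>2 D c\<^sub>L s \<delta> K Q) \<union>
     (point_family a\<^sub>2 b\<^sub>2 a\<^sub>1 b\<^sub>1 D G c\<^sub>P \<delta> K Q \<union> line_family a\<^sub>2 b\<^sub>2 a\<^sub>1 b\<^sub>1 D c\<^sub>L s \<delta> K Q)"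

text \<open>The exchange of coordinates covers the intervals centred at the zero of the second defect, and the
  rational lines with \<open>\<bar>A\<bar> < \<bar>B\<bar>\<close>.\<close>

lemma descent:
  fixes a\<^sub>1 b\<^sub>1 a\<^sub>2 b\<^sub>2 D G :: real and q p r :: int
  assumes const: "admissible_constants D G K c\<^sub>P c\<^sub>L"
    and G: "\<bar>a\<^sub>1\<bar> \<le> G" "\<bar>a\<^sub>2\<bar> \<le> G" "1 \<le> G * \<bar>a\<^sub>1\<bar>" "1 \<le> G * \<bar>a\<^sub>2\<bar>"
    and \<delta>: "0 < \<delta>" "\<delta> \<le> 1/4" and s: "0 < s"
    and q: "1 \<le> q" "real_of_int q \<le> Q" and \<theta>: "\<bar>offset a\<^sub>1 b\<^sub>1 a\<^sub>2 b\<^sub>2 q p r\<bar> \<le> G"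
    and close: "\<bar>defect a\<^sub>1 b\<^sub>1 q p x\<bar> * max \<bar>offset a\<^sub>1 b\<^sub>1 a\<^sub>2 b\<^sub>2 q p r\<bar> (sqrt (c\<^sub>P / Q)) \<le> 2 * G * c\<^sub>P / Q"
    and avoid: "\<And>z \<rho> R. (z, \<rho>, R) \<in> danger_family a\<^sub>1 b\<^sub>1 a\<^sub>2 b\<^sub>2 D G c\<^sub>P c\<^sub>L s \<delta> K Q \<Longrightarrow> \<rho> < \<bar>x - z\<bar>"
    and slope: "\<And>A B C. (A, B) \<noteq> (0, 0) \<Longrightarrow> size2 A B \<le> Q \<Longrightarrow>
        \<bar>lin a\<^sub>1 b\<^sub>1 a\<^sub>2 b\<^sub>2 A B C x\<bar> \<le> (Q / size2 A B) powr \<delta> / Q \<Longrightarrow> s \<le> \<bar>slope a\<^sub>1 a\<^sub>2 A B\<bar>"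
  shows "\<exists>q' p' r'. 1 \<le> q' \<and> q' < q \<and>
           \<bar>defect a\<^sub>1 b\<^sub>1 q' p' x * defect a\<^sub>2 b\<^sub>2 q' r' x\<bar> < c\<^sub>P / Q"
proof -
  have const': "1 < D" "1 \<le> G" "1 \<le> K" "0 < c\<^sub>P" "0 < c\<^sub>L" "c\<^sub>L \<le> 1"
     "3 * G^2 * D^2 * (2 * G^2 * K * c\<^sub>P) \<le> c\<^sub>L"
     "4 * G^2 * D^2 * (2 * G^4 * D^6 * (2 * G^2 * K * c\<^sub>P)^2 / c\<^sub>P + 2 * G^2 * D^4 * (2 * G^2 * K * c\<^sub>P)) < 1"
     "15 * G^2 * D^4 * (K * c\<^sub>L)^2 < c\<^sub>P" "5 * G^2 * D^3 * (K * c\<^sub>L) < 1"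
    using const unfolding admissible_constants_def by linarith+
  have Q: "1 \<le> Q" using q by linarith
  have "\<exists>A B C. (A, B) \<noteq> (0, 0) \<and> 4 * G^2 * D^2 * size2 A B < real_of_int q \<and>
      \<bar>lin a\<^sub>1 b\<^sub>1 a\<^sub>2 b\<^sub>2 A B C x\<bar> \<le> 3 * G^2 * D^2 * (2 * G^2 * K * c\<^sub>P) * (Q / size2 A B) powr \<delta> / Q"
    by (rule point_step[OF const'(1,2) G(1-3) const'(4,3) \<delta> q \<theta> close _ const'(8)])
      (use avoid in \<open>auto simp: danger_family_def\<close>)
  then obtain A B C where L: "(A, B) \<noteq> (0, 0)" "4 * G^2 * D^2 * size2 A B < real_of_int q"
    "\<bar>lin a\<^sub>1 b\<^sub>1 a\<^sub>2 b\<^sub>2 A B C x\<bar> \<le> 3 * G^2 * D^2 * (2 * G^2 * K * c\<^sub>P) * (Q / size2 A B) powr \<delta> / Q"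
    by blast
  have le: "\<bar>lin a\<^sub>1 b\<^sub>1 a\<^sub>2 b\<^sub>2 A B C x\<bar> \<le> c\<^sub>L * (Q / size2 A B) powr \<delta> / Q"
    by (rule order_trans[OF L(3)], intro divide_right_mono mult_right_mono) (use const' Q in auto)
  have "1 * size2 A B \<le> 4 * G^2 * D^2 * size2 A B"
  proof (intro mult_right_mono)
    have "1 \<le> G^2 * D^2" using mult_mono[of 1 "G^2" 1 "D^2"] const' by (simp add: one_le_power)
    then show "1 \<le> 4 * G^2 * D^2" by simp
  qed (use size2_ge_1[of A B] in simp)
  then have size: "size2 A B \<le> Q" using L(2) q by linarith
  have "c\<^sub>L * (Q / size2 A B) powr \<delta> / Q \<le> 1 * (Q / size2 A B) powr \<delta> / Q"
    using const' Q by (intro divide_right_mono mult_right_mono) auto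
  \<comment> \<open>Without a lower bound for its slope the line would not belong to
    \<open>line_classes\<close>, and Alice would not have taken care of it.\<close>
  then have s_le: "s \<le> \<bar>slope a\<^sub>1 a\<^sub>2 A B\<bar>" using le by (intro slope[OF L(1) size, of C]) auto
  have final: "\<exists>q' p' r'. 1 \<le> q' \<and> real_of_int q' \<le> 4 * G^2 * D^2 * size2 A B \<and>
      \<bar>defect a\<^sub>1 b\<^sub>1 q' p' x * defect a\<^sub>2 b\<^sub>2 q' r' x\<bar> \<le> 15 * G^2 * D^4 * (K * c\<^sub>L)^2 / Q"
  proof (cases "\<bar>B\<bar> \<le> \<bar>A\<bar>")
    case True
    show ?thesis
      by (rule line_step[OF const'(1,2) G(1-3) const'(5,3) \<delta> Q True size s s_le le _ const'(10)])
        (use avoid in \<open>auto simp: danger_family_def\<close>)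
  next
    case False
    have "\<exists>q' p' r'. 1 \<le> q' \<and> real_of_int q' \<le> 4 * G^2 * D^2 * size2 B A \<and>
      \<bar>defect a\<^sub>2 b\<^sub>2 q' p' x * defect a\<^sub>1 b\<^sub>1 q' r' x\<bar> \<le> 15 * G^2 * D^4 * (K * c\<^sub>L)^2 / Q"
      by (rule line_step[where C = C, OF const'(1,2) G(2,1,4) const'(5,3) \<delta> Q _ _ s _ _ _ const'(10)])
        (use avoid False size s_le le in \<open>auto simp: danger_family_def size2_swap[of B A] slope_swap[of a\<^sub>2 a\<^sub>1] lin_swap[of a\<^sub>2 b\<^sub>2]\<close>)
    then show ?thesis by (metis mult.commute size2_swap)
  qed
  have "15 * G^2 * D^4 * (K * c\<^sub>L)^2 / Q < c\<^sub>P / Q"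
    using const' Q by (intro divide_strict_right_mono) auto
  then show ?thesis using final L(2) by (meson le_less_trans of_int_less_iff)
qed

lemma defect_round_le: "\<bar>defect a b q (round (of_int q * (a * x + b))) x\<bar> \<le> \<bar>defect a b q p x\<bar>"
  "\<bar>defect a b q (round (of_int q * (a * x + b))) x\<bar> \<le> 1/2"
  using round_diff_minimal[of "of_int q * (a * x + b)" p] of_int_round_abs_le[of "of_int q * (a * x + b)"]
  by (simp_all add: defect_def abs_minus_commute)

text \<open>Of the two weighted defects, \<open>a\<^sub>2 * \<xi>\<close> is the smaller. So the
  offset is at most twice the larger one, which bounds \<open>\<xi>\<close> times the offset by the
  product; and \<open>\<xi>^2\<close> is itself controlled by the product, which bounds
  \<open>\<xi>\<close> times the truncation.\<close>

lemma close_to_zero: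
  fixes \<xi> \<eta> :: real
  assumes G: "1 \<le> G" "\<bar>a\<^sub>1\<bar> \<le> G" "1 \<le> G * \<bar>a\<^sub>2\<bar>" and c: "0 < c" and Q: "0 < Q"
    and prod: "\<bar>\<xi> * \<eta>\<bar> < c / Q" and \<theta>: "\<theta> = a\<^sub>1 * \<eta> - a\<^sub>2 * \<xi>" and le: "\<bar>a\<^sub>2 * \<xi>\<bar> \<le> \<bar>a\<^sub>1 * \<eta>\<bar>"
  shows "\<bar>\<xi>\<bar> * max \<bar>\<theta>\<bar> (sqrt (c / Q)) \<le> 2 * G * c / Q"
proof -
  have "\<bar>\<xi>\<bar> * \<bar>\<theta>\<bar> \<le> 2 * G * c / Q"
  proof -
    have "\<bar>\<theta>\<bar> \<le> 2 * \<bar>a\<^sub>1 * \<eta>\<bar>" using \<theta> le by linarith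
    then have "\<bar>\<xi>\<bar> * \<bar>\<theta>\<bar> \<le> \<bar>\<xi>\<bar> * (2 * \<bar>a\<^sub>1 * \<eta>\<bar>)" by (intro mult_left_mono) auto
    also have "\<dots> = 2 * \<bar>a\<^sub>1\<bar> * \<bar>\<xi> * \<eta>\<bar>" by (simp add: abs_mult)
    also have "\<dots> \<le> 2 * G * (c / Q)" using prod G by (intro mult_mono) auto
    finally show ?thesis by simp
  qed
  moreover have "\<bar>\<xi>\<bar> * sqrt (c / Q) \<le> 2 * G * c / Q"
  proof -
    have "\<bar>\<xi>\<bar>^2 \<le> G * \<bar>a\<^sub>2\<bar> * \<bar>\<xi>\<bar>^2" using mult_right_mono[OF G(3), of "\<bar>\<xi>\<bar>^2"] by simp
    also have "\<dots> = G * \<bar>\<xi>\<bar> * \<bar>a\<^sub>2 * \<xi>\<bar>" by (simp add: abs_mult power2_eq_square)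
    also have "\<dots> \<le> G * \<bar>\<xi>\<bar> * \<bar>a\<^sub>1 * \<eta>\<bar>" using le G by (intro mult_left_mono) auto
    also have "\<dots> = G * \<bar>a\<^sub>1\<bar> * \<bar>\<xi> * \<eta>\<bar>" by (simp add: abs_mult)
    also have "\<dots> \<le> G * G * (c / Q)" using prod G by (intro mult_mono) auto
    also have "\<dots> = (G * sqrt (c / Q))^2" using c Q by (simp add: power_mult_distrib) (simp add: power2_eq_square)
    finally have "\<bar>\<xi>\<bar> \<le> G * sqrt (c / Q)" by (rule power2_le_imp_le) (use G c Q in auto)
    then have "\<bar>\<xi>\<bar> * sqrt (c / Q) \<le> G * sqrt (c / Q) * sqrt (c / Q)" using c Q by (intro mult_right_mono) auto
    also have "\<dots> = G * c / Q" using c Q by (simp add: mult.assoc)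
    also have "\<dots> \<le> 2 * G * c / Q" using G c Q by (simp add: field_simps)
    finally show ?thesis .
  qed
  ultimately show ?thesis by (simp add: max_def)
qed

text \<open>Infinite descent, in the form of an induction on \<open>q\<close>: a violation yields
  one with a smaller denominator. Passing to nearest integers as numerators only decreases the
  product, and it keeps the offset within the bound \<open>G\<close> of
  \<open>point_classes\<close>.\<close>

lemma avoid_imp_badly_approximable:
  fixes a\<^sub>1 b\<^sub>1 a\<^sub>2 b\<^sub>2 D G :: real
  assumes const: "admissible_constants D G K c\<^sub>P c\<^sub>L"
    and G: "\<bar>a\<^sub>1\<bar> \<le> G" "\<bar>a\<^sub>2\<bar> \<le> G" "1 \<le> G * \<bar>a\<^sub>1\<bar>" "1 \<le> G * \<bar>a\<^sub>2\<bar>"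
    and \<delta>: "0 < \<delta>" "\<delta> \<le> 1/4" and s: "0 < s"
    and avoid: "\<And>z \<rho> R. (z, \<rho>, R) \<in> danger_family a\<^sub>1 b\<^sub>1 a\<^sub>2 b\<^sub>2 D G c\<^sub>P c\<^sub>L s \<delta> K Q \<Longrightarrow> \<rho> < \<bar>x - z\<bar>"
    and slope: "\<And>A B C. (A, B) \<noteq> (0, 0) \<Longrightarrow> size2 A B \<le> Q \<Longrightarrow>
        \<bar>lin a\<^sub>1 b\<^sub>1 a\<^sub>2 b\<^sub>2 A B C x\<bar> \<le> (Q / size2 A B) powr \<delta> / Q \<Longrightarrow> s \<le> \<bar>slope a\<^sub>1 a\<^sub>2 A B\<bar>"
  shows "1 \<le> q \<Longrightarrow> real_of_int q \<le> Q \<Longrightarrow> c\<^sub>P / Q \<le> \<bar>defect a\<^sub>1 b\<^sub>1 q p x * defect a\<^sub>2 b\<^sub>2 q r x\<bar>"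
proof (induction "nat q" arbitrary: q p r rule: less_induct)
  case less
  show ?case
  proof (rule ccontr)
    assume bad: "\<not> ?thesis"
    have const': "1 \<le> G" "0 < c\<^sub>P" using const by (auto simp: admissible_constants_def)
    have Q: "0 < Q" using less.prems by linarith
    define p' r' where "p' = round (of_int q * (a\<^sub>1 * x + b\<^sub>1))" and "r' = round (of_int q * (a\<^sub>2 * x + b\<^sub>2))"
    define \<xi> \<eta> \<theta> where "\<xi> = defect a\<^sub>1 b\<^sub>1 q p' x" and "\<eta> = defect a\<^sub>2 b\<^sub>2 q r' x" and "\<theta> = offset a\<^sub>1 b\<^sub>1 a\<^sub>2 b\<^sub>2 q p' r'"
    have \<xi>: "\<bar>\<xi>\<bar> \<le> \<bar>defect a\<^sub>1 b\<^sub>1 q p x\<bar>" "\<bar>\<xi>\<bar> \<le> 1/2" and \<eta>: "\<bar>\<eta>\<bar> \<le> \<bar>defect a\<^sub>2 b\<^sub>2 q r x\<bar>" "\<bar>\<eta>\<bar> \<le> 1/2"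
      unfolding \<xi>_def \<eta>_def p'_def r'_def by (rule defect_round_le)+
    have "\<bar>\<xi> * \<eta>\<bar> \<le> \<bar>defect a\<^sub>1 b\<^sub>1 q p x * defect a\<^sub>2 b\<^sub>2 q r x\<bar>"
      unfolding abs_mult using \<xi> \<eta> by (intro mult_mono) auto
    then have prod: "\<bar>\<xi> * \<eta>\<bar> < c\<^sub>P / Q" using bad by linarith
    have \<theta>: "\<theta> = a\<^sub>1 * \<eta> - a\<^sub>2 * \<xi>" by (simp add: \<theta>_def \<xi>_def \<eta>_def offset_eq[of _ _ _ _ _ _ _ x])
    have \<theta>G: "\<bar>\<theta>\<bar> \<le> G"
    proof -
      have "\<bar>a\<^sub>1 * \<eta>\<bar> \<le> G * (1/2)" "\<bar>a\<^sub>2 * \<xi>\<bar> \<le> G * (1/2)"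
        unfolding abs_mult by (intro mult_mono; use G \<xi> \<eta> const' in simp)+
      then show ?thesis unfolding \<theta> by linarith
    qed
    have "\<exists>q' p'' r''. 1 \<le> q' \<and> q' < q \<and> \<bar>defect a\<^sub>1 b\<^sub>1 q' p'' x * defect a\<^sub>2 b\<^sub>2 q' r'' x\<bar> < c\<^sub>P / Q"
    proof (cases "\<bar>a\<^sub>2 * \<xi>\<bar> \<le> \<bar>a\<^sub>1 * \<eta>\<bar>")
      case True
      have "\<bar>\<xi>\<bar> * max \<bar>\<theta>\<bar> (sqrt (c\<^sub>P / Q)) \<le> 2 * G * c\<^sub>P / Q"
        by (rule close_to_zero[OF const'(1) G(1,4) const'(2) Q prod \<theta> True])
      then show ?thesis
        by (intro descent[OF const G \<delta> s less.prems, where p = p' and r = r'])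
          (use avoid slope \<theta>G in \<open>auto simp: \<theta>_def \<xi>_def\<close>)
    next
      case False
      have "\<bar>\<eta>\<bar> * max \<bar>- \<theta>\<bar> (sqrt (c\<^sub>P / Q)) \<le> 2 * G * c\<^sub>P / Q"
        by (rule close_to_zero[OF const'(1) G(2,3) const'(2) Q]) (use prod \<theta> False in \<open>auto simp: mult.commute\<close>)
      then have "\<exists>q' p'' r''. 1 \<le> q' \<and> q' < q \<and> \<bar>defect a\<^sub>2 b\<^sub>2 q' p'' x * defect a\<^sub>1 b\<^sub>1 q' r'' x\<bar> < c\<^sub>P / Q"
        by (intro descent[OF const G(2,1,4,3) \<delta> s less.prems, where p = r' and r = p'])
          (use avoid slope \<theta>G in \<open>auto simp: \<theta>_def \<eta>_def danger_family_def offset_swap[of a\<^sub>2] size2_swap[of B A for A B]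
             slope_swap[of a\<^sub>2 a\<^sub>1] lin_swap[of a\<^sub>2 b\<^sub>2]\<close>)
      then show ?thesis by (metis mult.commute)
    qed
    then obtain q' p'' r'' where "1 \<le> q'" "q' < q"
      "\<bar>defect a\<^sub>1 b\<^sub>1 q' p'' x * defect a\<^sub>2 b\<^sub>2 q' r'' x\<bar> < c\<^sub>P / Q" by blast
    then show False using less.hyps[of q' p'' r''] less.prems by auto
  qed
qed

section \<open>Sizes of the isolated intervals\<close>

lemma isolated_sep:
  assumes "(z, i, j) \<in> isolated D f T" "(z', i, j) \<in> isolated D f T" "z \<noteq> z'"
  shows "f i * D powr - real_of_int j \<le> \<bar>z - z'\<bar>"
  using assms by (auto simp: isolated_def)

lemma light_point_family:
  assumes const: "admissible_constants D G K c\<^sub>P c\<^sub>L" and KD: "D \<le> K" and \<delta>: "0 < \<delta>" and \<gamma>: "0 < \<gamma>"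
    and Q: "1 \<le> Q" and \<rho>: "0 < \<rho>"
  shows "light D \<gamma> (point_family a\<^sub>1 b\<^sub>1 a\<^sub>2 b\<^sub>2 D G c\<^sub>P \<delta> K Q) x \<rho> (5 * (D * \<rho> / K) powr \<gamma> / (1 - D powr - (\<delta> * \<gamma>)))"
proof -
  have D: "1 < D" "0 < K" "0 < G" "0 < c\<^sub>P" using const by (auto simp: admissible_constants_def)
  show ?thesis unfolding point_family_def
  proof (rule light_graded[OF D(1) KD \<delta> \<gamma> Q \<rho>])
    show "0 < point_scale D G c\<^sub>P \<delta> K Q i" for i
      using D Q by (auto simp: point_scale_def intro!: divide_pos_pos mult_pos_pos)
    fix z i j assume "(z, i, j) \<in> isolated D (point_scale D G c\<^sub>P \<delta> K Q) (point_classes a\<^sub>1 b\<^sub>1 a\<^sub>2 b\<^sub>2 D G c\<^sub>P Q)"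
    then obtain q where q: "1 \<le> q" "real_of_int q \<le> Q" "i = level D (real_of_int q)"
      by (auto simp: isolated_def point_classes_def)
    then show "0 \<le> i \<and> D powr real_of_int i \<le> Q"
      using level(1)[OF D(1), of "real_of_int q"] level_nonneg[OF D(1), of "real_of_int q"] by auto
  qed (rule isolated_sep)
qed

lemma light_line_family:
  assumes const: "admissible_constants D G K c\<^sub>P c\<^sub>L" and KD: "D \<le> K" and \<delta>: "0 < \<delta>" and \<gamma>: "0 < \<gamma>"
    and Q: "1 \<le> Q" and \<rho>: "0 < \<rho>"
  shows "light D \<gamma> (line_family a\<^sub>1 b\<^sub>1 a\<^sub>2 b\<^sub>2 D c\<^sub>L s \<delta> K Q) x \<rho> (5 * (D * \<rho> / K) powr \<gamma> / (1 - D powr - (\<delta> * \<gamma>)))"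
proof -
  have D: "1 < D" "0 < K" "0 < c\<^sub>L" using const by (auto simp: admissible_constants_def)
  show ?thesis unfolding line_family_def
  proof (rule light_graded[OF D(1) KD \<delta> \<gamma> Q \<rho>])
    show "0 < line_scale D c\<^sub>L \<delta> K Q i" for i
      using D Q by (auto simp: line_scale_def intro!: divide_pos_pos mult_pos_pos)
    fix z i j assume "(z, i, j) \<in> isolated D (line_scale D c\<^sub>L \<delta> K Q) (line_classes a\<^sub>1 b\<^sub>1 a\<^sub>2 b\<^sub>2 D s Q)"
    then obtain A B where L: "size2 A B \<le> Q" "i = level D (size2 A B)"
      by (auto simp: isolated_def line_classes_def)
    then show "0 \<le> i \<and> D powr real_of_int i \<le> Q"
      using level(1)[OF D(1), of "size2 A B"] level_nonneg[OF D(1) size2_ge_1] size2_ge_1[of A B] by auto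
  qed (rule isolated_sep)
qed

lemma light_danger_family:
  assumes "admissible_constants D G K c\<^sub>P c\<^sub>L" and "D \<le> K" and "0 < \<delta>" and "0 < \<gamma>" and "1 \<le> Q" and "0 < \<rho>"
  shows "light D \<gamma> (danger_family a\<^sub>1 b\<^sub>1 a\<^sub>2 b\<^sub>2 D G c\<^sub>P c\<^sub>L s \<delta> K Q) x \<rho>
           (20 * (D * \<rho> / K) powr \<gamma> / (1 - D powr - (\<delta> * \<gamma>)))"
proof -
  note pt = light_point_family[OF assms] and ln = light_line_family[OF assms]
  show ?thesis
    unfolding danger_family_def by (rule light_mono[OF light_Un[OF light_Un[OF pt ln] light_Un[OF pt ln]]]) simp
qed

text \<open>Birth scales lie between two negative powers of \<open>Q\<close>, so a given radius of
  Bob sees few scales. The upper bound comes from the truncated offset, which leaves order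
  \<open>Q powr (\<delta> - 1/2)\<close>; the power \<open>Q powr \<eta>\<close> absorbs the
  constants.\<close>

lemma point_family_birth:
  assumes const: "admissible_constants D G K c\<^sub>P c\<^sub>L" and \<delta>: "0 < \<delta>" and Q: "1 \<le> Q"
    and large: "1 \<le> c\<^sub>P * Q" "2 * G^2 * D * K \<le> Q powr \<eta>" and exps: "\<delta> + \<eta> + \<delta>' \<le> 1/2"
    and mem: "(z, r, R) \<in> point_family a\<^sub>1 b\<^sub>1 a\<^sub>2 b\<^sub>2 D G c\<^sub>P \<delta> K Q"
  shows "0 < r" "Q powr -3 \<le> R" "R \<le> Q powr - \<delta>'"
proof -
  have D: "1 < D" "1 \<le> G" "1 \<le> K" "0 < c\<^sub>P" "c\<^sub>P \<le> 1" using const by (auto simp: admissible_constants_def)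
  obtain i j where ij: "(z, i, j) \<in> point_classes a\<^sub>1 b\<^sub>1 a\<^sub>2 b\<^sub>2 D G c\<^sub>P Q" and r: "r = shrink D \<delta> K Q i * R"
    and R: "R = point_scale D G c\<^sub>P \<delta> K Q i * D powr - real_of_int j"
    using mem by (auto simp: point_family_def graded_def isolated_def)
  then obtain q p r' where q: "1 \<le> q" "real_of_int q \<le> Q" "i = level D (real_of_int q)"
    and \<theta>: "\<bar>offset a\<^sub>1 b\<^sub>1 a\<^sub>2 b\<^sub>2 q p r'\<bar> \<le> G" "j = level D (max \<bar>offset a\<^sub>1 b\<^sub>1 a\<^sub>2 b\<^sub>2 q p r'\<bar> (sqrt (c\<^sub>P / Q)))"
    by (auto simp: point_classes_def)
  define n t where "n = D powr real_of_int i" and "t = D powr real_of_int j"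
  define W where "W = (Q / n) powr \<delta>"
  define \<omega> where "\<omega> = sqrt (c\<^sub>P / Q)"
  have n: "1 \<le> n" "n \<le> Q"
    using level(1)[OF D(1), of "real_of_int q"] level_nonneg[OF D(1), of "real_of_int q"] q D
    by (auto simp: n_def ge_one_powr_ge_zero)
  have \<omega>: "0 < \<omega>" "\<omega> \<le> 1" "\<omega>^2 = c\<^sub>P / Q" "\<omega> \<le> Q powr -(1/2)"
  proof -
    show "0 < \<omega>" "\<omega>^2 = c\<^sub>P / Q" using D Q by (auto simp: \<omega>_def)
    have "\<omega> \<le> sqrt (1 / Q)" unfolding \<omega>_def using D Q by (intro real_sqrt_le_mono divide_right_mono) auto
    also have "\<dots> = Q powr -(1/2)" using Q by (simp add: real_sqrt_divide powr_minus powr_half_sqrt inverse_eq_divide)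
    finally show "\<omega> \<le> Q powr -(1/2)" .
    show "\<omega> \<le> 1" unfolding \<omega>_def using D Q by (simp add: field_simps)
  qed
  define y where "y = max \<bar>offset a\<^sub>1 b\<^sub>1 a\<^sub>2 b\<^sub>2 q p r'\<bar> \<omega>"
  have y: "0 < y" "\<omega> \<le> y" "y \<le> G" using \<omega> \<theta> D by (auto simp: y_def)
  have t: "0 < t" "t \<le> G" "\<omega> \<le> D * t"
  proof -
    have "j = level D y" by (simp add: \<theta>(2) y_def \<omega>_def)
    then show "0 < t" "t \<le> G" "\<omega> \<le> D * t"
      using level[OF D(1) y(1)] y(2,3) D(1) unfolding t_def by auto
  qed
  have W: "1 \<le> W" using n \<delta> by (simp add: W_def ge_one_powr_ge_zero)
  have WQ: "W \<le> Q powr \<delta>"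
    unfolding W_def using n Q \<delta> by (intro powr_mono2) (auto simp: field_simps mult_le_cancel_left1)
  have R_eq: "R = K * W * (2 * G^2 * c\<^sub>P / (n * Q * t))"
    by (simp add: R point_scale_def W_def n_def t_def powr_minus divide_inverse mult_ac)
  then have "0 < R" using D W n Q t by auto
  then show "0 < r" using D Q by (simp add: r shrink_def)
  show "Q powr -3 \<le> R"
  proof -
    have "Q powr -3 = 1 / Q^3" using Q by (simp add: powr_minus powr_numeral inverse_eq_divide)
    also have "\<dots> \<le> c\<^sub>P * Q / Q^3" using large Q by (intro divide_right_mono) auto
    also have "\<dots> = c\<^sub>P / (Q * Q)" using Q by (simp add: power3_eq_cube)
    also have "\<dots> \<le> 2 * G^2 * c\<^sub>P / (Q * Q * G)"
      using D Q by (simp add: field_simps power2_eq_square)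
    also have "\<dots> \<le> 1 * (2 * G^2 * c\<^sub>P / (n * Q * t))"
      using D Q n t by (simp, intro divide_left_mono mult_mono mult_pos_pos) auto
    also have "\<dots> \<le> R"
      unfolding R_eq using mult_mono[of 1 K 1 W] D W n Q t by (intro mult_right_mono) auto
    finally show ?thesis .
  qed
  show "R \<le> Q powr - \<delta>'"
  proof -
    have "c\<^sub>P / (n * Q * t) \<le> c\<^sub>P / (1 * Q * (\<omega> / D))"
      using D Q n t \<omega> by (intro divide_left_mono mult_mono mult_pos_pos) (auto simp: field_simps)
    also have "\<dots> = (c\<^sub>P / Q) * D / \<omega>" using D \<omega> by (simp add: field_simps)
    also have "\<dots> = \<omega>^2 * D / \<omega>" by (simp only: \<omega>(3))
    also have "\<dots> = D * \<omega>" using \<omega>(1) by (simp add: power2_eq_square)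
    also have "\<dots> \<le> D * Q powr -(1/2)" using \<omega> D by (intro mult_left_mono) auto
    finally have "c\<^sub>P / (n * Q * t) \<le> D * Q powr -(1/2)" .
    then have "R \<le> K * Q powr \<delta> * (2 * G^2 * (D * Q powr -(1/2)))"
      unfolding R_eq times_divide_eq_right[symmetric] using D WQ n Q t
      by (intro mult_mono mult_left_mono) auto
    also have "\<dots> = (2 * G^2 * D * K) * (Q powr \<delta> * Q powr -(1/2))" by simp
    also have "\<dots> \<le> Q powr \<eta> * (Q powr \<delta> * Q powr -(1/2))"
      using large by (intro mult_right_mono) auto
    also have "\<dots> = Q powr (\<eta> + \<delta> - 1/2)" by (simp add: powr_add[symmetric] add_diff_eq)
    also have "\<dots> \<le> Q powr - \<delta>'" using exps Q by (intro powr_mono) auto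
    finally show ?thesis .
  qed
qed

text \<open>Here the upper bound comes from the slope condition in \<open>line_classes\<close>: a
  rational line almost parallel to the given one would produce an interval too long for its
  scale.\<close>

lemma line_family_birth:
  assumes const: "admissible_constants D G K c\<^sub>P c\<^sub>L" and G: "\<bar>a\<^sub>1\<bar> \<le> G" "\<bar>a\<^sub>2\<bar> \<le> G" and \<delta>: "0 < \<delta>" and Q: "1 \<le> Q"
    and large: "2 * G \<le> c\<^sub>P * Q" "2 * G^2 * D * K \<le> Q powr \<eta>" and exps: "2 * \<delta> + \<eta> + \<delta>' \<le> \<kappa>"
    and mem: "(z, r, R) \<in> line_family a\<^sub>1 b\<^sub>1 a\<^sub>2 b\<^sub>2 D c\<^sub>L (Q powr (\<kappa> - 1)) \<delta> K Q"
  shows "0 < r" "Q powr -3 \<le> R" "R \<le> Q powr - \<delta>'"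
proof -
  have D: "1 < D" "1 \<le> G" "1 \<le> K" "0 < c\<^sub>P" "c\<^sub>P \<le> c\<^sub>L" "c\<^sub>L \<le> 1" using const by (auto simp: admissible_constants_def)
  obtain i j where ij: "(z, i, j) \<in> line_classes a\<^sub>1 b\<^sub>1 a\<^sub>2 b\<^sub>2 D (Q powr (\<kappa> - 1)) Q" and r: "r = shrink D \<delta> K Q i * R"
    and R: "R = line_scale D c\<^sub>L \<delta> K Q i * D powr - real_of_int j"
    using mem by (auto simp: line_family_def graded_def isolated_def)
  then obtain A B where L: "size2 A B \<le> Q" "i = level D (size2 A B)"
    and \<sigma>: "Q powr (\<kappa> - 1) \<le> \<bar>slope a\<^sub>1 a\<^sub>2 A B\<bar>" "j = level D \<bar>slope a\<^sub>1 a\<^sub>2 A B\<bar>"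
    by (auto simp: line_classes_def)
  define n t y where "n = D powr real_of_int i" and "t = D powr real_of_int j" and "y = \<bar>slope a\<^sub>1 a\<^sub>2 A B\<bar>"
  define W where "W = (Q / n) powr \<delta>"
  have n: "1 \<le> n" "n \<le> Q"
    using level(1)[OF D(1), of "size2 A B"] level_nonneg[OF D(1) size2_ge_1] size2_ge_1[of A B] L D
    by (auto simp: n_def ge_one_powr_ge_zero)
  have y: "Q powr (\<kappa> - 1) \<le> y" "0 < y" "y \<le> 2 * G * Q"
  proof -
    show "Q powr (\<kappa> - 1) \<le> y" using \<sigma> by (simp add: y_def)
    moreover have "0 < Q powr (\<kappa> - 1)" using Q by simp
    ultimately show "0 < y" by linarith
    have A: "\<bar>real_of_int A\<bar> * 1 \<le> size2 A B" and B: "1 * \<bar>real_of_int B\<bar> \<le> size2 A B"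
      unfolding size2_def by (intro mult_mono; simp)+
    have "y \<le> \<bar>real_of_int A * a\<^sub>1\<bar> + \<bar>real_of_int B * a\<^sub>2\<bar>" unfolding y_def slope_def by (rule abs_triangle_ineq)
    also have "\<dots> \<le> Q * G + Q * G"
      unfolding abs_mult using A B L G Q by (intro add_mono mult_mono) auto
    finally show "y \<le> 2 * G * Q" by simp
  qed
  have t: "0 < t" "t \<le> 2 * G * Q" "Q powr (\<kappa> - 1) \<le> D * t"
    using level[OF D(1) y(2)] y D \<sigma>(2) by (auto simp: t_def y_def)
  have W: "1 \<le> W" using n \<delta> by (simp add: W_def ge_one_powr_ge_zero)
  have WQ: "W \<le> Q powr \<delta>"
    unfolding W_def using n Q \<delta> by (intro powr_mono2) (auto simp: field_simps mult_le_cancel_left1)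
  have R_eq: "R = K * W^2 * (c\<^sub>L / (Q * t))"
    by (simp add: R line_scale_def W_def n_def t_def powr_minus divide_inverse mult_ac)
  then have "0 < R" using D W n Q t by auto
  then show "0 < r" using D Q by (simp add: r shrink_def)
  show "Q powr -3 \<le> R"
  proof -
    have "Q powr -3 = 1 / Q^3" using Q by (simp add: powr_minus powr_numeral inverse_eq_divide)
    also have "\<dots> \<le> (c\<^sub>P * Q / (2 * G)) / Q^3" using large Q D by (intro divide_right_mono) (auto simp: field_simps)
    also have "\<dots> = c\<^sub>P / (Q * (2 * G * Q))" using Q by (simp add: power3_eq_cube field_simps)
    also have "\<dots> \<le> 1 * (c\<^sub>L / (Q * t))"
      using D Q n t by (simp, intro frac_le mult_mono mult_pos_pos) auto
    also have "\<dots> \<le> R"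
      unfolding R_eq using mult_mono[of 1 K 1 "W^2"] D W n Q t by (intro mult_right_mono) (auto simp: one_le_power)
    finally show ?thesis .
  qed
  show "R \<le> Q powr - \<delta>'"
  proof -
    have s: "0 < Q powr (\<kappa> - 1)" using Q by simp
    have "c\<^sub>L / (Q * t) \<le> 1 / (Q * (Q powr (\<kappa> - 1) / D))"
      using D Q t s by (intro frac_le mult_mono mult_pos_pos) (auto simp: field_simps)
    also have "\<dots> = D * Q powr - \<kappa>"
      using D Q by (simp add: powr_diff powr_minus field_simps)
    finally have *: "c\<^sub>L / (Q * t) \<le> D * Q powr - \<kappa>" .
    have "W^2 \<le> (Q powr \<delta>)^2" using WQ W by (intro power_mono) auto
    also have "\<dots> = Q powr (2 * \<delta>)" using Q by (subst powr_power) (auto simp: mult.commute)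
    finally have "R \<le> K * Q powr (2 * \<delta>) * (D * Q powr - \<kappa>)"
      unfolding R_eq using * D Q t by (intro mult_mono mult_left_mono) auto
    also have "\<dots> = (1 * D * K) * (Q powr (2 * \<delta>) * Q powr - \<kappa>)" by simp
    also have "\<dots> \<le> (2 * G^2 * D * K) * (Q powr (2 * \<delta>) * Q powr - \<kappa>)"
    proof (intro mult_right_mono)
      show "1 \<le> 2 * G^2" using one_le_power[OF D(2), of 2] by linarith
    qed (use D in auto)
    also have "\<dots> \<le> Q powr \<eta> * (Q powr (2 * \<delta>) * Q powr - \<kappa>)"
      using large by (intro mult_right_mono) auto
    also have "\<dots> = Q powr (\<eta> + 2 * \<delta> - \<kappa>)" by (simp add: powr_add[symmetric] add_diff_eq)
    also have "\<dots> \<le> Q powr - \<delta>'" using exps Q by (intro powr_mono) auto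
    finally show ?thesis .
  qed
qed

text \<open>A homogeneous form of the Diophantine condition, symmetric in the coordinates and with a
  uniform constant. For the parametrisation (x, a x + b) the right-hand side is the maximum of |A +
  a B| and |b B + C|.\<close>

definition dioph where
  "dioph a\<^sub>1 b\<^sub>1 a\<^sub>2 b\<^sub>2 \<epsilon> \<kappa> \<longleftrightarrow> (\<forall>A B C. (A, B) \<noteq> (0, 0) \<longrightarrow>
     \<kappa> * max \<bar>real_of_int A\<bar> \<bar>real_of_int B\<bar> powr -(2 - \<epsilon>)
       \<le> max \<bar>slope a\<^sub>1 a\<^sub>2 A B\<bar> \<bar>lin a\<^sub>1 b\<^sub>1 a\<^sub>2 b\<^sub>2 A B C 0\<bar>)"

text \<open>If the slope is small, the two terms of the slope nearly cancel, so both coefficients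
  are at most of the order of the square root of the size. The Diophantine condition then bounds the
  slope or the value at 0 from below, while the assumed smallness together with the closeness at
  \<open>x\<close> bounds both from above; this is contradictory for large \<open>Q\<close>.\<close>

lemma slope_lower_bound:
  fixes a\<^sub>1 b\<^sub>1 a\<^sub>2 b\<^sub>2 G :: real
  assumes dioph: "dioph a\<^sub>1 b\<^sub>1 a\<^sub>2 b\<^sub>2 \<epsilon> \<kappa>" and \<kappa>: "0 < \<kappa>" and \<epsilon>: "0 < \<epsilon>" "\<epsilon> \<le> 1" and \<delta>: "0 < \<delta>" "\<delta> \<le> 1/4"
    and G: "1 \<le> G" "\<bar>a\<^sub>1\<bar> \<le> G" "\<bar>a\<^sub>2\<bar> \<le> G" "1 \<le> G * \<bar>a\<^sub>1\<bar>" "1 \<le> G * \<bar>a\<^sub>2\<bar>"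
    and Q: "1 \<le> Q" and large: "2 * G^2 * (2 + M) < \<kappa> * Q powr (\<epsilon>/4)" and x: "\<bar>x\<bar> \<le> M"
    and AB: "(A, B) \<noteq> (0, 0)" "size2 A B \<le> Q" and F: "\<bar>lin a\<^sub>1 b\<^sub>1 a\<^sub>2 b\<^sub>2 A B C x\<bar> \<le> (Q / size2 A B) powr \<delta> / Q"
  shows "Q powr (\<epsilon>/4 - 1) \<le> \<bar>slope a\<^sub>1 a\<^sub>2 A B\<bar>"
proof (rule ccontr)
  assume small: "\<not> ?thesis"
  define \<sigma> S H u where "\<sigma> = slope a\<^sub>1 a\<^sub>2 A B" and "S = size2 A B"
    and "H = max \<bar>real_of_int A\<bar> \<bar>real_of_int B\<bar>" and "u = Q / size2 A B"
  have \<sigma>: "\<bar>\<sigma>\<bar> < Q powr (\<epsilon>/4 - 1)" using small by (simp add: \<sigma>_def)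
  also have "\<dots> \<le> 1" using Q \<epsilon> powr_mono[of "\<epsilon>/4 - 1" 0 Q] by simp
  finally have \<sigma>1: "\<bar>\<sigma>\<bar> \<le> 1" by simp
  have S: "1 \<le> S" "S \<le> Q" using size2_ge_1 AB by (auto simp: S_def)
  have u: "1 \<le> u" using S Q by (simp add: u_def S_def)
  have H1: "1 \<le> H" using AB(1) by (auto simp: H_def le_max_iff_disj)
  have half: "\<bar>real_of_int A\<bar>^2 \<le> 2 * G^2 * size2 A B"
    if le: "\<bar>of_int A * a\<bar> \<le> \<bar>of_int B * a'\<bar> + 1" and a: "1 \<le> G * \<bar>a\<bar>" "\<bar>a'\<bar> \<le> G" for A B a a'
  proof -
    have "\<bar>real_of_int A\<bar>^2 \<le> (G * \<bar>a\<bar>) * \<bar>real_of_int A\<bar>^2"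
      using mult_right_mono[OF a(1), of "\<bar>real_of_int A\<bar>^2"] by simp
    also have "\<dots> = G * \<bar>real_of_int A\<bar> * \<bar>of_int A * a\<bar>" by (simp add: abs_mult power2_eq_square)
    also have "\<dots> \<le> G * \<bar>real_of_int A\<bar> * (\<bar>of_int B\<bar> * \<bar>a'\<bar> + 1)"
      using le G by (intro mult_left_mono) (auto simp: abs_mult)
    also have "\<dots> \<le> G * \<bar>real_of_int A\<bar> * (\<bar>of_int B\<bar> * G + 1)"
      using a G by (intro mult_left_mono add_mono) auto
    also have "\<dots> = G^2 * (\<bar>real_of_int A\<bar> * \<bar>of_int B\<bar>) + G * (\<bar>real_of_int A\<bar> * 1)"
      by (simp add: algebra_simps power2_eq_square)
    also have "\<dots> \<le> G^2 * size2 A B + G^2 * size2 A B"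
    proof (intro add_mono mult_mono)
      show "\<bar>real_of_int A\<bar> * \<bar>of_int B\<bar> \<le> size2 A B" "\<bar>real_of_int A\<bar> * 1 \<le> size2 A B"
        unfolding size2_def by (intro mult_mono; simp)+
      show "G \<le> G^2" using G by (simp add: power2_eq_square)
    qed (use G in auto)
    also have "\<dots> = 2 * G^2 * size2 A B" by simp
    finally show ?thesis .
  qed
  have "\<bar>of_int A * a\<^sub>1\<bar> \<le> \<bar>of_int B * a\<^sub>2\<bar> + 1" "\<bar>of_int B * a\<^sub>2\<bar> \<le> \<bar>of_int A * a\<^sub>1\<bar> + 1"
    using \<sigma>1 unfolding \<sigma>_def slope_def by linarith+
  then have "\<bar>real_of_int A\<bar>^2 \<le> 2 * G^2 * S" "\<bar>real_of_int B\<bar>^2 \<le> 2 * G^2 * S"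
    using half[of A a\<^sub>1 B a\<^sub>2] half[of B a\<^sub>2 A a\<^sub>1] G by (auto simp: S_def size2_swap[of B A])
  then have H2: "H^2 \<le> 2 * G^2 * S" by (auto simp: H_def max_def)
  have "H powr (2 - \<epsilon>) = (H^2) powr (1 - \<epsilon>/2)"
  proof -
    have "H^2 = H powr 2" using H1 by simp
    then have "(H^2) powr (1 - \<epsilon>/2) = H powr (2 * (1 - \<epsilon>/2))" by (simp only: powr_powr)
    then show ?thesis by (simp add: algebra_simps)
  qed
  also have "\<dots> \<le> (2 * G^2 * S) powr (1 - \<epsilon>/2)" using H2 \<epsilon> by (intro powr_mono2) auto
  also have "\<dots> = (2 * G^2) powr (1 - \<epsilon>/2) * S powr (1 - \<epsilon>/2)" using S by (simp add: powr_mult)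
  also have "\<dots> \<le> (2 * G^2) powr 1 * S powr (1 - \<epsilon>/2)"
    using one_le_power[OF G(1), of 2] \<epsilon> by (intro mult_right_mono powr_mono) auto
  also have "\<dots> = 2 * G^2 * S powr (1 - \<epsilon>/2)" using G by simp
  finally have H_le: "H powr (2 - \<epsilon>) \<le> 2 * G^2 * S powr (1 - \<epsilon>/2)" .
  define Y where "Y = max \<bar>\<sigma>\<bar> \<bar>lin a\<^sub>1 b\<^sub>1 a\<^sub>2 b\<^sub>2 A B C 0\<bar>"
  have lower: "\<kappa> \<le> Y * H powr (2 - \<epsilon>)"
  proof -
    have "\<kappa> * H powr -(2 - \<epsilon>) \<le> Y"
      using dioph AB(1) unfolding dioph_def Y_def H_def \<sigma>_def by blast
    then have "\<kappa> * H powr -(2 - \<epsilon>) * H powr (2 - \<epsilon>) \<le> Y * H powr (2 - \<epsilon>)" by (intro mult_right_mono) auto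
    moreover have "H powr -(2 - \<epsilon>) * H powr (2 - \<epsilon>) = 1" using H1 by (simp add: powr_add[symmetric])
    ultimately show ?thesis by (simp add: mult.assoc)
  qed
  have M: "0 \<le> M" using x by linarith
  \<comment> \<open>The power of \<open>u\<close> is chosen to match the power of \<open>S\<close>
    in \<open>H_le\<close>: since \<open>u * S = Q\<close>, the two merge into a power of
    \<open>Q\<close>.\<close>
  have Y_le: "Y \<le> (2 + M) * (Q powr (\<epsilon>/4 - 1) * u powr (1 - \<epsilon>/2))"
  proof -
    have "\<bar>lin a\<^sub>1 b\<^sub>1 a\<^sub>2 b\<^sub>2 A B C 0\<bar> \<le> \<bar>lin a\<^sub>1 b\<^sub>1 a\<^sub>2 b\<^sub>2 A B C x\<bar> + \<bar>\<sigma> * x\<bar>"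
      by (simp add: lin_def \<sigma>_def slope_def algebra_simps)
    also have "\<bar>\<sigma> * x\<bar> \<le> Q powr (\<epsilon>/4 - 1) * M" unfolding abs_mult using \<sigma> x by (intro mult_mono) auto
    finally have 1: "\<bar>lin a\<^sub>1 b\<^sub>1 a\<^sub>2 b\<^sub>2 A B C 0\<bar> \<le> u powr \<delta> / Q + Q powr (\<epsilon>/4 - 1) * M"
      using F by (simp add: u_def)
    have "u powr \<delta> / Q = Q powr -1 * u powr \<delta>" using Q by (simp add: powr_minus field_simps)
    also have "\<dots> \<le> Q powr (\<epsilon>/4 - 1) * u powr (1 - \<epsilon>/2)"
      using Q u \<epsilon> \<delta> by (intro mult_mono powr_mono) auto
    finally have 2: "u powr \<delta> / Q \<le> Q powr (\<epsilon>/4 - 1) * u powr (1 - \<epsilon>/2)" .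
    have "Q powr (\<epsilon>/4 - 1) * 1 \<le> Q powr (\<epsilon>/4 - 1) * u powr (1 - \<epsilon>/2)"
      using u \<epsilon> by (intro mult_left_mono ge_one_powr_ge_zero) auto
    then have 3: "Q powr (\<epsilon>/4 - 1) \<le> Q powr (\<epsilon>/4 - 1) * u powr (1 - \<epsilon>/2)" by simp
    then have "Q powr (\<epsilon>/4 - 1) * M \<le> Q powr (\<epsilon>/4 - 1) * u powr (1 - \<epsilon>/2) * M"
      using M by (intro mult_right_mono) auto
    then have "\<bar>lin a\<^sub>1 b\<^sub>1 a\<^sub>2 b\<^sub>2 A B C 0\<bar> \<le> (1 + M) * (Q powr (\<epsilon>/4 - 1) * u powr (1 - \<epsilon>/2))"
      using 1 2 by (simp add: algebra_simps)
    moreover have "\<bar>\<sigma>\<bar> \<le> 1 * (Q powr (\<epsilon>/4 - 1) * u powr (1 - \<epsilon>/2))" using \<sigma> 3 by simp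
    moreover have "1 * (Q powr (\<epsilon>/4 - 1) * u powr (1 - \<epsilon>/2)) \<le> (2 + M) * (Q powr (\<epsilon>/4 - 1) * u powr (1 - \<epsilon>/2))"
      "(1 + M) * (Q powr (\<epsilon>/4 - 1) * u powr (1 - \<epsilon>/2)) \<le> (2 + M) * (Q powr (\<epsilon>/4 - 1) * u powr (1 - \<epsilon>/2))"
      using M by (intro mult_right_mono; simp)+
    ultimately show ?thesis unfolding Y_def by linarith
  qed
  have "\<kappa> \<le> Y * H powr (2 - \<epsilon>)" by (rule lower)
  also have "\<dots> \<le> (2 + M) * (Q powr (\<epsilon>/4 - 1) * u powr (1 - \<epsilon>/2)) * (2 * G^2 * S powr (1 - \<epsilon>/2))"
    using Y_le H_le M by (intro mult_mono) auto
  also have "\<dots> = 2 * G^2 * (2 + M) * (Q powr (\<epsilon>/4 - 1) * (u * S) powr (1 - \<epsilon>/2))"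
    using u S by (simp add: powr_mult)
  also have "u * S = Q" using S by (simp add: u_def S_def)
  also have "Q powr (\<epsilon>/4 - 1) * Q powr (1 - \<epsilon>/2) = Q powr - (\<epsilon>/4)"
    by (simp add: powr_add[symmetric])
  finally have "\<kappa> * Q powr (\<epsilon>/4) \<le> 2 * G^2 * (2 + M) * Q powr - (\<epsilon>/4) * Q powr (\<epsilon>/4)"
    by (intro mult_right_mono) auto
  also have "\<dots> = 2 * G^2 * (2 + M)" using Q by (simp add: mult.assoc powr_add[symmetric])
  finally show False using large by linarith
qed

section \<open>Lacunary scales and the game on the line\<close>

lemma filterlim_powr_at_top:
  fixes e :: real
  assumes e: "0 < e"
  shows "filterlim (\<lambda>y::real. y powr e) at_top at_top"
  unfolding filterlim_at_top
proof
  fix Z :: real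
  show "eventually (\<lambda>y. Z \<le> y powr e) at_top"
    using eventually_ge_at_top[of "max 1 Z powr (1/e)"]
  proof eventually_elim
    case (elim y)
    have "Z \<le> (max 1 Z powr (1/e)) powr e" using e by (simp add: powr_powr)
    also have "\<dots> \<le> y powr e" using elim e by (intro powr_mono2) auto
    finally show ?case .
  qed
qed

text \<open>Half of the excess of the exponent over 1 is given up; the power of \<open>Q m\<close>
  gained thereby eventually outweighs the constant.\<close>

lemma lacunary_powr:
  fixes Q :: "nat \<Rightarrow> real"
  assumes pos: "\<And>m. Q m > 0" and lim: "filterlim Q at_top sequentially"
    and growth: "\<exists>\<tau>>1. (INF m. Q (Suc m) / Q m powr \<tau>) > 0"
  obtains \<tau> where "1 < \<tau>" "eventually (\<lambda>m. Q m powr \<tau> \<le> Q (Suc m)) sequentially"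
proof -
  obtain \<tau> where \<tau>: "1 < \<tau>" and inf: "(INF m. Q (Suc m) / Q m powr \<tau>) > 0" (is "?c > 0")
    using growth by blast
  define \<tau>' where "\<tau>' = (1 + \<tau>) / 2"
  have "eventually (\<lambda>y::real. 1 \<le> ?c * y powr (\<tau> - \<tau>')) at_top"
  proof -
    have "filterlim (\<lambda>y::real. y powr (\<tau> - \<tau>')) at_top at_top"
      using \<tau> by (intro filterlim_powr_at_top) (auto simp: \<tau>'_def)
    then have "eventually (\<lambda>y::real. 1 / ?c \<le> y powr (\<tau> - \<tau>')) at_top"
      by (auto simp: filterlim_at_top)
    then show ?thesis by eventually_elim (use inf in \<open>simp add: field_simps\<close>)
  qed
  then have "eventually (\<lambda>m. 1 \<le> ?c * Q m powr (\<tau> - \<tau>')) sequentially"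
    using lim by (rule eventually_compose_filterlim)
  then have "eventually (\<lambda>m. Q m powr \<tau>' \<le> Q (Suc m)) sequentially"
  proof eventually_elim
    case (elim m)
    have "Q m powr \<tau>' \<le> (?c * Q m powr (\<tau> - \<tau>')) * Q m powr \<tau>'"
      using mult_right_mono[OF elim, of "Q m powr \<tau>'"] by simp
    also have "\<dots> = ?c * Q m powr \<tau>" by (simp add: powr_add[symmetric] mult.assoc)
    also have "?c \<le> Q (Suc m) / Q m powr \<tau>"
      by (rule cINF_lower) (auto intro!: bdd_belowI[of _ 0] divide_nonneg_nonneg simp: less_imp_le[OF pos])
    then have "?c * Q m powr \<tau> \<le> Q (Suc m)" using pos[of m] by (simp add: field_simps)
    finally show ?case .
  qed
  moreover have "1 < \<tau>'" using \<tau> by (simp add: \<tau>'_def)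
  ultimately show ?thesis using that by blast
qed

lemma lacunary_window:
  fixes Q :: "nat \<Rightarrow> real"
  assumes \<tau>: "1 < \<tau>" and step: "\<And>m. m\<^sub>0 \<le> m \<Longrightarrow> Q m powr \<tau> \<le> Q (Suc m)" and ge: "\<And>m. m\<^sub>0 \<le> m \<Longrightarrow> 1 \<le> Q m"
    and m: "m\<^sub>0 \<le> m" and n: "C \<le> \<tau> ^ n"
  shows "Q m powr C \<le> Q (m + n)"
proof -
  have "Q m powr (\<tau> ^ n) \<le> Q (m + n)"
  proof (induction n)
    case 0
    then show ?case using ge[OF m] by simp
  next
    case (Suc n)
    have "Q m powr (\<tau> ^ Suc n) = (Q m powr (\<tau> ^ n)) powr \<tau>" by (simp add: powr_powr mult.commute)
    also have "\<dots> \<le> Q (m + n) powr \<tau>" using Suc \<tau> by (intro powr_mono2) auto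
    also have "\<dots> \<le> Q (m + Suc n)" using step[of "m + n"] m by simp
    finally show ?case .
  qed
  then show ?thesis using powr_mono[OF n ge[OF m]] by linarith
qed

text \<open>A scale matters at radius \<open>\<rho>\<close> only if
  \<open>\<rho> \<le> Q m powr - \<delta>'\<close> and \<open>Q m powr -3 < D * \<rho>\<close>. At
  least \<open>N\<close> steps later the first bound has dropped to \<open>Q m powr -4\<close>, and
  as \<open>D \<le> Q m\<close> both scales cannot matter for the same \<open>\<rho>\<close>. So at
  most \<open>N\<close> scales matter; the exponent 4 is 3 plus one for the factor
  \<open>D\<close>.\<close>

lemma light_lacunary:
  fixes Q :: "nat \<Rightarrow> real"
  assumes D: "0 < D" and \<delta>': "0 < \<delta>'" and mono: "mono Q"
    and ge: "\<And>m. m\<^sub>0 \<le> m \<Longrightarrow> 1 \<le> Q m \<and> D \<le> Q m"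
    and window: "\<And>m. m\<^sub>0 \<le> m \<Longrightarrow> Q m powr (4 / \<delta>') \<le> Q (m + N)"
    and birth: "\<And>m z r R. m\<^sub>0 \<le> m \<Longrightarrow> (z, r, R) \<in> Fam m \<Longrightarrow> Q m powr -3 \<le> R \<and> R \<le> Q m powr - \<delta>'"
    and light: "\<And>m. m\<^sub>0 \<le> m \<Longrightarrow> light D \<gamma> (Fam m) x \<rho> w" and w: "0 \<le> w"
  shows "light D \<gamma> (\<Union>m\<in>{m\<^sub>0..}. Fam m) x \<rho> (of_nat N * w)"
proof -
  define M where "M = {m. m\<^sub>0 \<le> m \<and> \<rho> \<le> Q m powr - \<delta>' \<and> Q m powr -3 < D * \<rho>}"
  have close: "m' < m + N" if "m \<in> M" "m' \<in> M" for m m'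
  proof (rule ccontr)
    assume "\<not> m' < m + N"
    have m: "m\<^sub>0 \<le> m" "1 \<le> Q m" "D \<le> Q m" and m': "m\<^sub>0 \<le> m'" "1 \<le> Q m'"
      using that ge by (auto simp: M_def)
    have "Q m powr (4 / \<delta>') \<le> Q m'"
      using window[OF m(1)] monoD[OF mono, of "m + N" m'] \<open>\<not> m' < m + N\<close> by simp
    then have "(Q m powr (4 / \<delta>')) powr \<delta>' \<le> Q m' powr \<delta>'"
      using \<delta>' by (intro powr_mono2) auto
    then have "Q m ^ 4 \<le> Q m' powr \<delta>'"
      using \<delta>' m by (simp add: powr_powr powr_numeral)
    then have "Q m' powr - \<delta>' \<le> 1 / Q m ^ 4"
      using m m' by (simp add: powr_minus inverse_eq_divide frac_le)
    moreover have "\<rho> \<le> Q m' powr - \<delta>'" "Q m powr -3 < D * \<rho>" using that by (auto simp: M_def)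
    ultimately have "Q m powr -3 < D * (1 / Q m ^ 4)"
      using D by (meson mult_left_mono less_imp_le less_le_trans order_trans)
    also have "\<dots> \<le> Q m * (1 / Q m ^ 4)" using m by (intro mult_right_mono) auto
    also have "\<dots> = Q m powr -3"
      using m by (simp add: powr_minus powr_numeral divide_simps eval_nat_numeral)
    finally show False by simp
  qed
  have M: "finite M \<and> card M \<le> N"
  proof (cases "M = {}")
    case False
    define m where "m = (LEAST m. m \<in> M)"
    obtain m' where "m' \<in> M" using False by blast
    then have m: "m \<in> M" unfolding m_def by (rule LeastI)
    have "m \<le> m'" if "m' \<in> M" for m' unfolding m_def using that by (rule Least_le)
    then have "M \<subseteq> {m..<m + N}" using close[OF m] by auto
    then show ?thesis using finite_subset[of M "{m..<m + N}"] card_mono[of "{m..<m + N}" M] by simp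
  qed simp
  have "hits D (\<Union>m\<in>{m\<^sub>0..}. Fam m) x \<rho> = hits D (\<Union>m\<in>M. Fam m) x \<rho>"
  proof -
    have "m \<in> M" if "m\<^sub>0 \<le> m" "(z, r, R) \<in> Fam m" "\<rho> \<le> R" "R < D * \<rho>" for m z r R
      using birth[OF that(1,2)] that by (auto simp: M_def)
    then show ?thesis unfolding hits_def M_def by blast
  qed
  moreover have "light D \<gamma> (\<Union>m\<in>M. Fam m) x \<rho> (of_nat N * w)"
  proof (rule light_mono[OF light_UN])
    show "(\<Sum>m\<in>M. w) \<le> of_nat N * w" using M w by (auto intro!: mult_right_mono)
  qed (use M light in \<open>auto simp: M_def\<close>)
  ultimately show ?thesis by (rule light_hits_cong)
qed

text \<open>The number 80 collects four families, five intervals per level in each, and the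
  available quarter of the budget.\<close>

lemma ratio_constant_exists:
  fixes D \<gamma> q N :: real
  assumes D: "1 < D" and \<gamma>: "0 < \<gamma>" and q: "q < 1" and N: "1 \<le> N"
  shows "\<exists>K\<ge>D. \<forall>\<rho>>0. N * (20 * (D * \<rho> / K) powr \<gamma> / (1 - q)) \<le> (\<rho> / D) powr \<gamma> / 4"
proof -
  define X where "X = max 1 ((80 * N / (1 - q)) powr (1/\<gamma>))"
  have X: "1 \<le> X" "80 * N / (1 - q) \<le> X powr \<gamma>"
  proof -
    show "1 \<le> X" by (simp add: X_def)
    have "80 * N / (1 - q) = ((80 * N / (1 - q)) powr (1/\<gamma>)) powr \<gamma>"
      using N q \<gamma> by (simp add: powr_powr)
    also have "\<dots> \<le> X powr \<gamma>" using \<gamma> by (intro powr_mono2) (auto simp: X_def)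
    finally show "80 * N / (1 - q) \<le> X powr \<gamma>" .
  qed
  have "N * (20 * (D * \<rho> / (D^2 * X)) powr \<gamma> / (1 - q)) \<le> (\<rho> / D) powr \<gamma> / 4" if "0 < \<rho>" for \<rho>
  proof -
    have "D * \<rho> / (D^2 * X) = (\<rho> / D) / X" using D by (simp add: power2_eq_square)
    then have "(D * \<rho> / (D^2 * X)) powr \<gamma> = (\<rho> / D) powr \<gamma> / X powr \<gamma>"
      using D X that by (simp only: powr_divide)
    then have "N * (20 * (D * \<rho> / (D^2 * X)) powr \<gamma> / (1 - q)) = (80 * N / (1 - q)) * ((\<rho> / D) powr \<gamma> / 4) / X powr \<gamma>"
      using q X by (simp add: field_simps)
    also have "\<dots> \<le> X powr \<gamma> * ((\<rho> / D) powr \<gamma> / 4) / X powr \<gamma>"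
      using X by (intro divide_right_mono mult_right_mono) auto
    also have "\<dots> = (\<rho> / D) powr \<gamma> / 4" using X by simp
    finally show ?thesis .
  qed
  moreover have "D \<le> D^2 * X" using mult_mono[of 1 D 1 X] D X by (simp add: power2_eq_square)
  ultimately show ?thesis by blast
qed

lemma min_prod_ge:
  assumes "1 \<le> Q" and "\<And>q::nat. 1 \<le> q \<Longrightarrow> real q \<le> Q \<Longrightarrow> c \<le> dist_int (real q * x) * dist_int (real q * y)"
  shows "c \<le> min_prod x y Q"
proof -
  have "{q::nat. 1 \<le> q \<and> real q \<le> Q} \<subseteq> {..nat \<lfloor>Q\<rfloor>}" by (auto simp: le_nat_floor)
  then have "finite {q::nat. 1 \<le> q \<and> real q \<le> Q}" by (rule finite_subset) simp
  moreover have "1 \<in> {q::nat. 1 \<le> q \<and> real q \<le> Q}" using assms(1) by simp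
  ultimately show ?thesis unfolding min_prod_def using assms(2) by (subst Min_ge_iff) auto
qed

lemma min_prod_le:
  assumes "1 \<le> q" "real q \<le> Q"
  shows "min_prod x y Q \<le> dist_int (real q * x) * dist_int (real q * y)"
proof -
  have "{q::nat. 1 \<le> q \<and> real q \<le> Q} \<subseteq> {..nat \<lfloor>Q\<rfloor>}" by (auto simp: le_nat_floor)
  then have "finite {q::nat. 1 \<le> q \<and> real q \<le> Q}" by (rule finite_subset) simp
  then show ?thesis unfolding min_prod_def using assms by (intro Min_le) auto
qed

text \<open>The order of choices matters: \<open>\<delta>\<close> and \<open>\<delta>'\<close>
  depend on \<open>\<epsilon>\<close>, \<open>N\<close> on \<open>\<delta>'\<close> and the growth
  of \<open>Q\<close>, \<open>K\<close> on \<open>N\<close>, and the constants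
  \<open>c\<^sub>P\<close>, \<open>c\<^sub>L\<close> on \<open>K\<close>. Only the first index
  \<open>m\<^sub>0\<close> depends on Bob's first ball, which is harmless for a lower limit.\<close>

lemma winning_on_line:
  fixes Q :: "nat \<Rightarrow> real" and a b :: real
  assumes mono: "mono Q" and pos: "\<And>m. Q m > 0" and lim: "filterlim Q at_top sequentially"
    and growth: "\<exists>\<tau>>1. (INF m. Q (Suc m) / Q m powr \<tau>) > 0"
    and a: "a \<noteq> 0" and \<epsilon>: "0 < \<epsilon>" "\<epsilon> \<le> 1" and \<kappa>: "0 < \<kappa>" and dioph: "dioph 1 0 a b \<epsilon> \<kappa>"
    and \<beta>: "0 < \<beta>" "\<beta> < 1"
  shows "\<exists>\<sigma>. winning_strategy \<beta> (UNIV :: real set) {x. (x, a * x + b) \<in> E_seq Q} \<sigma>"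
proof -
  obtain \<tau> where \<tau>: "1 < \<tau>" "eventually (\<lambda>m. Q m powr \<tau> \<le> Q (Suc m)) sequentially"
    using lacunary_powr[OF pos lim growth] .
  \<comment> \<open>The largest exponent for which
    \<open>\<beta> powr \<gamma> \<ge> 2/3\<close>.\<close>
  define \<gamma> where "\<gamma> = log \<beta> (2/3)"
  have \<gamma>: "0 < \<gamma>" using \<beta> by (simp add: \<gamma>_def log_def divide_neg_neg)
  have \<beta>\<gamma>: "2/3 \<le> \<beta> powr \<gamma>" using \<beta> by (simp add: \<gamma>_def)
  define D where "D = 1 / \<beta>"
  have D: "1 < D" using \<beta> by (simp add: D_def)
  \<comment> \<open>These values satisfy
    \<open>2 * \<delta> + \<epsilon>/8 + \<delta>' = \<epsilon>/4\<close>, as needed for the lines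
    with the exponent \<open>\<epsilon>/4\<close> from \<open>slope_lower_bound\<close>.\<close>
  define \<delta> \<delta>' where "\<delta> = \<epsilon> / 32" and "\<delta>' = \<epsilon> / 16"
  have \<delta>: "0 < \<delta>" "\<delta> \<le> 1/4" "0 < \<delta>'" using \<epsilon> by (auto simp: \<delta>_def \<delta>'_def)
  obtain n\<^sub>0 where "4 / \<delta>' < \<tau> ^ n\<^sub>0" using real_arch_pow[OF \<tau>(1)] by blast
  define N where "N = Suc n\<^sub>0"
  have "\<tau> ^ n\<^sub>0 \<le> \<tau> ^ N" using \<tau>(1) by (intro power_increasing) (auto simp: N_def)
  then have N: "4 / \<delta>' \<le> \<tau> ^ N" "1 \<le> N"
    using \<open>4 / \<delta>' < \<tau> ^ n\<^sub>0\<close> by (linarith, simp add: N_def)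
  define g0 where "g0 = D powr - (\<delta> * \<gamma>)"
  have g0: "g0 < 1" using D \<delta> \<gamma> by (simp add: g0_def powr_less_one)
  obtain K where K: "D \<le> K" "\<And>\<rho>. 0 < \<rho> \<Longrightarrow> real N * (20 * (D * \<rho> / K) powr \<gamma> / (1 - g0)) \<le> (\<rho> / D) powr \<gamma> / 4"
    using ratio_constant_exists[OF D \<gamma> g0, of "real N"] N(2) by auto
  define G where "G = 1 + \<bar>a\<bar> + 1 / \<bar>a\<bar>"
  have G: "1 \<le> G" "\<bar>1\<bar> \<le> G" "\<bar>a\<bar> \<le> G" "1 \<le> G * \<bar>1\<bar>" "1 \<le> G * \<bar>a\<bar>"
  proof -
    have "G * \<bar>a\<bar> = 1 + \<bar>a\<bar> + \<bar>a\<bar> * \<bar>a\<bar>" using a by (simp add: G_def algebra_simps)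
    then show "1 \<le> G * \<bar>a\<bar>" by simp
  qed (auto simp: G_def)
  obtain c\<^sub>P c\<^sub>L where const: "admissible_constants D G K c\<^sub>P c\<^sub>L"
    using admissible_constants_exist[OF D G(1), of K] K D by auto
  have cP: "0 < c\<^sub>P" using const by (simp add: admissible_constants_def)
  define Fam where "Fam m = danger_family 1 0 a b D G c\<^sub>P c\<^sub>L (Q m powr (\<epsilon>/4 - 1)) \<delta> K (Q m)" for m
  show ?thesis
  proof (rule winning_strategy_of_light_families[OF \<beta> \<gamma> \<beta>\<gamma>])
    fix x\<^sub>0 \<rho>\<^sub>0 :: real assume \<rho>\<^sub>0: "0 < \<rho>\<^sub>0"
    define M where "M = \<bar>x\<^sub>0\<bar> + \<rho>\<^sub>0"
    have "eventually (\<lambda>y::real. 1 \<le> y \<and> D \<le> y \<and> 2 * G \<le> c\<^sub>P * y \<and> 2 * G^2 * D * K \<le> y powr (\<epsilon>/8) \<and>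
        2 * G^2 * (2 + M) < \<kappa> * y powr (\<epsilon>/4) \<and> y powr - \<delta>' < \<rho>\<^sub>0) at_top"
    proof (intro eventually_conj)
      have pw: "filterlim (\<lambda>y::real. y powr e) at_top at_top" if "0 < e" for e :: real
        using that by (rule filterlim_powr_at_top)
      show "eventually (\<lambda>y. 2 * G \<le> c\<^sub>P * y) at_top"
        using eventually_ge_at_top[of "2 * G / c\<^sub>P"] by eventually_elim (use cP in \<open>simp add: field_simps\<close>)
      show "eventually (\<lambda>y. 2 * G^2 * D * K \<le> y powr (\<epsilon>/8)) at_top"
        using pw[of "\<epsilon>/8"] \<epsilon> by (auto simp: filterlim_at_top)
      have "eventually (\<lambda>y. 2 * G^2 * (2 + M) / \<kappa> < y powr (\<epsilon>/4)) at_top"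
        using pw[of "\<epsilon>/4"] \<epsilon> by (auto simp: filterlim_at_top_dense)
      then show "eventually (\<lambda>y. 2 * G^2 * (2 + M) < \<kappa> * y powr (\<epsilon>/4)) at_top"
        by eventually_elim (use \<kappa> in \<open>simp add: field_simps\<close>)
      have "((\<lambda>y::real. y powr - \<delta>') \<longlongrightarrow> 0) at_top"
        using \<delta> by (intro tendsto_neg_powr filterlim_ident) auto
      then show "eventually (\<lambda>y. y powr - \<delta>' < \<rho>\<^sub>0) at_top"
        using \<rho>\<^sub>0 by (rule order_tendstoD(2))
    qed (rule eventually_ge_at_top)+
    from eventually_conj[OF eventually_compose_filterlim[OF this lim] \<tau>(2)]
    have "eventually (\<lambda>m. (1 \<le> Q m \<and> D \<le> Q m \<and> 2 * G \<le> c\<^sub>P * Q m \<and> 2 * G^2 * D * K \<le> Q m powr (\<epsilon>/8) \<and>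
        2 * G^2 * (2 + M) < \<kappa> * Q m powr (\<epsilon>/4) \<and> Q m powr - \<delta>' < \<rho>\<^sub>0) \<and> Q m powr \<tau> \<le> Q (Suc m)) sequentially"
      by simp
    then obtain m\<^sub>0 where m\<^sub>0: "\<And>m. m\<^sub>0 \<le> m \<Longrightarrow> 1 \<le> Q m \<and> D \<le> Q m \<and> 2 * G \<le> c\<^sub>P * Q m \<and> 2 * G^2 * D * K \<le> Q m powr (\<epsilon>/8) \<and>
        2 * G^2 * (2 + M) < \<kappa> * Q m powr (\<epsilon>/4) \<and> Q m powr - \<delta>' < \<rho>\<^sub>0"
      and step: "\<And>m. m\<^sub>0 \<le> m \<Longrightarrow> Q m powr \<tau> \<le> Q (Suc m)"
      by (auto simp: eventually_sequentially)
    have birth: "0 < r \<and> Q m powr -3 \<le> R \<and> R \<le> Q m powr - \<delta>'"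
      if m: "m\<^sub>0 \<le> m" and mem: "(z, r, R) \<in> Fam m" for m z r R
    proof -
      have Qm: "1 \<le> Q m" "1 \<le> c\<^sub>P * Q m" "2 * G \<le> c\<^sub>P * Q m" "2 * G^2 * D * K \<le> Q m powr (\<epsilon>/8)"
        using m\<^sub>0[OF m] G(1) by auto
      have e1: "\<delta> + \<epsilon>/8 + \<delta>' \<le> 1/2" and e2: "2 * \<delta> + \<epsilon>/8 + \<delta>' \<le> \<epsilon>/4" using \<epsilon> by (auto simp: \<delta>_def \<delta>'_def)
      note pt = point_family_birth[OF const \<delta>(1) Qm(1,2,4) e1]
      note ln1 = line_family_birth[OF const G(2,3) \<delta>(1) Qm(1,3,4) e2]
      note ln2 = line_family_birth[OF const G(3,2) \<delta>(1) Qm(1,3,4) e2]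
      consider "(z, r, R) \<in> point_family 1 0 a b D G c\<^sub>P \<delta> K (Q m)"
        | "(z, r, R) \<in> line_family 1 0 a b D c\<^sub>L (Q m powr (\<epsilon>/4 - 1)) \<delta> K (Q m)"
        | "(z, r, R) \<in> point_family a b 1 0 D G c\<^sub>P \<delta> K (Q m)"
        | "(z, r, R) \<in> line_family a b 1 0 D c\<^sub>L (Q m powr (\<epsilon>/4 - 1)) \<delta> K (Q m)"
        using mem unfolding Fam_def danger_family_def by blast
      then show ?thesis
      proof cases
        case 1 then show ?thesis using pt[OF 1] by simp
      next
        case 2 then show ?thesis using ln1[OF 2] by simp
      next
        case 3 then show ?thesis using pt[OF 3] by simp
      next
        case 4 then show ?thesis using ln2[OF 4] by simp
      qed
    qed
    show "\<exists>F. (\<forall>z r R. (z, r, R) \<in> F \<longrightarrow> 0 < r \<and> 0 < R \<and> R < \<rho>\<^sub>0) \<and>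
        (\<forall>x \<rho>. 0 < \<rho> \<longrightarrow> light (1/\<beta>) \<gamma> F x \<rho> ((\<beta> * \<rho>) powr \<gamma> / 4)) \<and>
        (\<forall>x. \<bar>x - x\<^sub>0\<bar> \<le> \<rho>\<^sub>0 \<longrightarrow> (\<forall>z r R. (z, r, R) \<in> F \<longrightarrow> r < \<bar>x - z\<bar>) \<longrightarrow>
           x \<in> {x. (x, a * x + b) \<in> E_seq Q})"
    proof (intro exI[of _ "\<Union>m\<in>{m\<^sub>0..}. Fam m"] conjI allI impI)
      fix z r R assume "(z, r, R) \<in> (\<Union>m\<in>{m\<^sub>0..}. Fam m)"
      then obtain m where m: "m\<^sub>0 \<le> m" "(z, r, R) \<in> Fam m" by auto
      show "0 < r" "R < \<rho>\<^sub>0" using birth[OF m] m\<^sub>0[OF m(1)] by auto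
      have "0 < Q m powr -3" using pos[of m] by simp
      then show "0 < R" using birth[OF m] by linarith
    next
      fix x \<rho> :: real assume \<rho>: "0 < \<rho>"
      have "light D \<gamma> (\<Union>m\<in>{m\<^sub>0..}. Fam m) x \<rho> (real N * (20 * (D * \<rho> / K) powr \<gamma> / (1 - g0)))"
      proof (rule light_lacunary[OF _ \<delta>(3) mono])
        show "1 \<le> Q m \<and> D \<le> Q m" if "m\<^sub>0 \<le> m" for m using m\<^sub>0[OF that] by blast
        then show "Q m powr (4 / \<delta>') \<le> Q (m + N)" if "m\<^sub>0 \<le> m" for m
          using that step N by (intro lacunary_window[OF \<tau>(1)]) auto
        show "Q m powr -3 \<le> R \<and> R \<le> Q m powr - \<delta>'" if "m\<^sub>0 \<le> m" "(z, r, R) \<in> Fam m" for m z r R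
          using birth[OF that] by blast
        show "light D \<gamma> (Fam m) x \<rho> (20 * (D * \<rho> / K) powr \<gamma> / (1 - g0))" if "m\<^sub>0 \<le> m" for m
          unfolding Fam_def g0_def using m\<^sub>0[OF that] by (intro light_danger_family[OF const K(1) \<delta>(1) \<gamma> _ \<rho>]) auto
      qed (use D g0 in auto)
      then have "light D \<gamma> (\<Union>m\<in>{m\<^sub>0..}. Fam m) x \<rho> ((\<rho> / D) powr \<gamma> / 4)"
        using K(2)[OF \<rho>] by (rule light_mono)
      then show "light (1/\<beta>) \<gamma> (\<Union>m\<in>{m\<^sub>0..}. Fam m) x \<rho> ((\<beta> * \<rho>) powr \<gamma> / 4)"
        by (simp add: D_def mult.commute)
    next
      fix x assume x: "\<bar>x - x\<^sub>0\<bar> \<le> \<rho>\<^sub>0"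
        and avoid: "\<forall>z r R. (z, r, R) \<in> (\<Union>m\<in>{m\<^sub>0..}. Fam m) \<longrightarrow> r < \<bar>x - z\<bar>"
      have xM: "\<bar>x\<bar> \<le> M" using x by (simp add: M_def)
      have "c\<^sub>P \<le> Q m * min_prod x (a * x + b) (Q m)" if m: "m\<^sub>0 \<le> m" for m
      proof -
        have Qm: "1 \<le> Q m" using m\<^sub>0[OF m] by blast
        have "c\<^sub>P / Q m \<le> min_prod x (a * x + b) (Q m)"
        proof (rule min_prod_ge[OF Qm])
          fix q :: nat assume q: "1 \<le> q" "real q \<le> Q m"
          have "c\<^sub>P / Q m \<le> \<bar>defect 1 0 (int q) p x * defect a b (int q) r x\<bar>" for p r
          proof (rule avoid_imp_badly_approximable[OF const G(2,3,4,5) \<delta>(1,2)])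
            show "0 < Q m powr (\<epsilon>/4 - 1)" using Qm by simp
            show "\<rho> < \<bar>x - z\<bar>" if "(z, \<rho>, R) \<in> danger_family 1 0 a b D G c\<^sub>P c\<^sub>L (Q m powr (\<epsilon>/4 - 1)) \<delta> K (Q m)" for z \<rho> R
              using avoid that m unfolding Fam_def by blast
            show "Q m powr (\<epsilon>/4 - 1) \<le> \<bar>slope 1 a A B\<bar>"
              if "(A, B) \<noteq> (0, 0)" "size2 A B \<le> Q m" "\<bar>lin 1 0 a b A B C x\<bar> \<le> (Q m / size2 A B) powr \<delta> / Q m" for A B C
              using m\<^sub>0[OF m] that by (intro slope_lower_bound[OF dioph \<kappa> \<epsilon> \<delta>(1,2) G Qm _ xM]) auto
          qed (use q in auto)
          from this[of "round (real q * x)" "round (real q * (a * x + b))"]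
          show "c\<^sub>P / Q m \<le> dist_int (real q * x) * dist_int (real q * (a * x + b))"
            by (simp add: defect_def dist_int_def abs_mult)
        qed
        then show ?thesis using Qm by (simp add: field_simps)
      qed
      then have "ereal c\<^sub>P \<le> Liminf sequentially (\<lambda>m. ereal (Q m * min_prod x (a * x + b) (Q m)))"
        by (intro Liminf_bounded) (auto simp: eventually_sequentially)
      moreover have "0 < ereal c\<^sub>P" using cP by simp
      ultimately have "0 < Liminf sequentially (\<lambda>m. ereal (Q m * min_prod x (a * x + b) (Q m)))"
        by (rule less_le_trans[rotated])
      then show "x \<in> {x. (x, a * x + b) \<in> E_seq Q}" by (simp add: E_seq_def)
    qed
  qed
qed

section \<open>The Diophantine hypothesis on the line, rational lines, and the conclusion\<close>

lemma dist_int_le: "dist_int x \<le> \<bar>x - of_int k\<bar>"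
  using round_diff_minimal[of x k] by (simp add: dist_int_def)

lemma dist_int_mult_le: "dist_int (real n * x) \<le> real n * dist_int x"
proof -
  have "dist_int (real n * x) \<le> \<bar>real n * x - of_int (int n * round x)\<bar>" by (rule dist_int_le)
  also have "\<dots> = real n * dist_int x" by (simp add: dist_int_def abs_mult flip: right_diff_distrib)
  finally show ?thesis .
qed

lemma dist_int_nonneg: "0 \<le> dist_int x"
  by (simp add: dist_int_def)

text \<open>The lower limit controls only large \<open>q\<close>. Every \<open>q\<close> is
  therefore replaced by a multiple with a fixed factor \<open>m\<close>, which enlarges distances to
  the integers at most by \<open>m\<close> and so changes only the constant.\<close>

lemma dioph_of_Liminf:
  fixes a b \<epsilon> :: real
  assumes \<epsilon>: "0 < \<epsilon>"
    and Lim: "Liminf sequentially (\<lambda>q. ereal (real q powr (2 - \<epsilon>) *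
                max (dist_int (real q * a)) (dist_int (real q * b)))) > 0"
  shows "\<exists>\<kappa>>0. dioph 1 0 a b (min 1 \<epsilon>) \<kappa>"
proof -
  define e where "e = min 1 \<epsilon>"
  obtain c where c: "0 < ereal c" "ereal c < Liminf sequentially (\<lambda>q. ereal (real q powr (2 - \<epsilon>) *
                max (dist_int (real q * a)) (dist_int (real q * b))))"
    using ereal_dense2[OF Lim] by blast
  have "eventually (\<lambda>q. ereal c < ereal (real q powr (2 - \<epsilon>) *
                max (dist_int (real q * a)) (dist_int (real q * b)))) sequentially"
    using c(2) by (rule less_LiminfD)
  then obtain n where n: "\<And>q. n \<le> q \<Longrightarrow> c < real q powr (2 - \<epsilon>) * max (dist_int (real q * a)) (dist_int (real q * b))"
    by (auto simp: eventually_sequentially)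
  have c0: "0 < c" using c by simp
  define m where "m = Suc n"
  \<comment> \<open>The minimum with 1 serves the case \<open>B = 0\<close>, in which the slope is a
    nonzero integer.\<close>
  define \<kappa> where "\<kappa> = min 1 (c / (real m * real m powr (2 - e)))"
  have m_pos: "0 < real m * real m powr (2 - e)" by (simp add: m_def)
  have \<kappa>: "0 < \<kappa>" using c0 by (simp add: \<kappa>_def m_def)
  have all: "\<kappa> * real q powr -(2 - e) \<le> max (dist_int (real q * a)) (dist_int (real q * b))" (is "_ \<le> ?d q")
    if q: "1 \<le> q" for q
  proof -
    have mq: "n \<le> m * q" "1 \<le> real (m * q)" using mult_le_mono[of n m 1 q] mult_le_mono[of 1 m 1 q] q
      by (auto simp: m_def simp del: of_nat_mult)
    have "c < real (m * q) powr (2 - \<epsilon>) * ?d (m * q)" by (rule n[OF mq(1)])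
    also have "\<dots> \<le> real (m * q) powr (2 - e) * (real m * ?d q)"
    proof (intro mult_mono powr_mono)
      have "dist_int (real (m * q) * y) \<le> real m * dist_int (real q * y)" for y
        using dist_int_mult_le[of m "real q * y"] by (simp add: mult.assoc)
      then show "?d (m * q) \<le> real m * ?d q"
        by (meson max.boundedI max.cobounded1 max.cobounded2 mult_left_mono of_nat_0_le_iff order_trans)
    qed (use mq dist_int_nonneg in \<open>auto simp: e_def le_max_iff_disj\<close>)
    also have "\<dots> = (real m * real m powr (2 - e)) * (real q powr (2 - e) * ?d q)"
      by (simp add: powr_mult)
    finally have "c / (real m * real m powr (2 - e)) \<le> real q powr (2 - e) * ?d q"
      unfolding pos_divide_le_eq[OF m_pos] by (simp add: mult.commute)
    then have "\<kappa> \<le> real q powr (2 - e) * ?d q" by (simp add: \<kappa>_def)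
    then have "\<kappa> * real q powr -(2 - e) \<le> (real q powr (2 - e) * ?d q) * real q powr -(2 - e)"
      by (intro mult_right_mono) auto
    also have "\<dots> = ?d q * (real q powr (2 - e) * real q powr -(2 - e))" by (simp only: mult_ac)
    also have "real q powr (2 - e) * real q powr -(2 - e) = 1"
      using q by (simp only: powr_add[symmetric]) simp
    also have "?d q * 1 = ?d q" by simp
    finally show ?thesis .
  qed
  have "dioph 1 0 a b e \<kappa>"
    unfolding dioph_def
  proof (intro allI impI)
    fix A B C :: int assume AB: "(A, B) \<noteq> (0, 0)"
    define H where "H = max \<bar>real_of_int A\<bar> \<bar>real_of_int B\<bar>"
    have H1: "1 \<le> H" using AB by (auto simp: H_def le_max_iff_disj)
    have e: "e \<le> 1" by (simp add: e_def)
    show "\<kappa> * H powr -(2 - e) \<le> max \<bar>slope 1 a A B\<bar> \<bar>lin 1 0 a b A B C 0\<bar>"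
    proof (cases "B = 0")
      case True
      have "\<kappa> * H powr -(2 - e) \<le> 1 * H powr 0" using H1 e by (intro mult_mono powr_mono) (auto simp: \<kappa>_def)
      also have "\<dots> \<le> \<bar>slope 1 a A B\<bar>" using True AB H1 by (simp add: slope_def)
      finally show ?thesis by simp
    next
      case False
      define q where "q = nat \<bar>B\<bar>"
      have q: "1 \<le> q" "real q = \<bar>real_of_int B\<bar>" using False by (auto simp: q_def)
      have "\<kappa> * H powr -(2 - e) \<le> \<kappa> * real q powr -(2 - e)"
        using q e \<kappa> by (intro mult_left_mono powr_mono2') (auto simp: H_def)
      also have "\<dots> \<le> ?d q" by (rule all[OF q(1)])
      also have "\<dots> \<le> max \<bar>slope 1 a A B\<bar> \<bar>lin 1 0 a b A B C 0\<bar>"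
      proof (rule max.mono)
        show "dist_int (real q * a) \<le> \<bar>slope 1 a A B\<bar>"
          using dist_int_le[of "real q * a" "- sgn B * A"] q(2)
          by (cases "B > 0") (auto simp: slope_def algebra_simps abs_if split: if_splits)
        show "dist_int (real q * b) \<le> \<bar>lin 1 0 a b A B C 0\<bar>"
          using dist_int_le[of "real q * b" "- sgn B * C"] q(2)
          by (cases "B > 0") (auto simp: lin_def algebra_simps abs_if split: if_splits)
      qed
      finally show ?thesis .
    qed
  qed
  then show ?thesis using \<kappa> unfolding e_def by blast
qed

lemma E_seq_subset_E_set:
  assumes lim: "filterlim Q at_top sequentially"
  shows "E_seq Q \<subseteq> E_set"
proof (clarsimp simp: E_seq_def E_set_def)
  fix x y :: real
  let ?f = "\<lambda>Q. ereal (Q * min_prod x y Q)"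
  assume pos: "0 < Liminf sequentially (\<lambda>m. ?f (Q m))"
  then obtain c where c: "0 < c" "c < Liminf sequentially (\<lambda>m. ?f (Q m))" using dense by blast
  show "0 < Limsup at_top ?f"
  proof (rule ccontr)
    assume "\<not> ?thesis"
    then have "Limsup at_top ?f < c" using c(1) by auto
    then have "eventually (\<lambda>Q. ?f Q < c) at_top" by (rule Limsup_lessD)
    then have "eventually (\<lambda>m. ?f (Q m) < c) sequentially" using lim by (rule eventually_compose_filterlim)
    moreover have "eventually (\<lambda>m. c < ?f (Q m)) sequentially" using c(2) by (rule less_LiminfD)
    ultimately have "eventually (\<lambda>m::nat. False) sequentially" by eventually_elim auto
    then show False by simp
  qed
qed

text \<open>Take a Dirichlet denominator \<open>k\<close> of \<open>x\<close> and multiply it by a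
  common denominator \<open>N\<close> of \<open>a\<close> and \<open>b\<close>. Then N k x and N k
  (a x + b) are both within order 1/Q of integers, so \<open>Q\<close> times the product is of order
  1/Q.\<close>

lemma rational_line_disjoint:
  assumes "a \<in> \<rat>" "b \<in> \<rat>"
  shows "line a b \<inter> E_set = {}"
proof -
  obtain a\<^sub>1 b\<^sub>1 :: int and a\<^sub>2 b\<^sub>2 :: nat where a: "a\<^sub>2 \<noteq> 0" "a = of_int a\<^sub>1 / of_nat a\<^sub>2" and b: "b\<^sub>2 \<noteq> 0" "b = of_int b\<^sub>1 / of_nat b\<^sub>2"
    using assms by (elim Rats_cases') (metis of_int_of_nat_eq zero_less_imp_eq_int less_irrefl)
  define N where "N = a\<^sub>2 * b\<^sub>2"
  have N: "1 \<le> N" using a b by (simp add: N_def)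
  have Na: "real N * a = of_int (int b\<^sub>2 * a\<^sub>1)" and Nb: "real N * b = of_int (int a\<^sub>2 * b\<^sub>1)"
    using a b by (auto simp: N_def)
  have small: "Q * min_prod x (a * x + b) Q \<le> real N * \<bar>real N * a\<bar> * (4 * real N ^ 2) / Q" if Q: "2 * real N \<le> Q" for x Q
  proof -
    \<comment> \<open>The bound for \<open>k\<close> leaves room for the factor \<open>N\<close>;
      \<open>2 * real N \<le> Q\<close> keeps the integer part comparable to
      \<open>Q / real N\<close>.\<close>
    define n where "n = nat \<lfloor>Q / real N\<rfloor>"
    have QN: "2 \<le> Q / real N" using Q N by (simp add: field_simps)
    then have n1: "1 \<le> n" "real n \<le> Q / real N" "Q / real N \<le> 2 * real n"
      unfolding n_def by linarith+
    obtain h k where k: "0 < k" "k \<le> int n" "\<bar>of_int k * x - of_int h\<bar> < 1 / real n"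
      by (rule Dirichlet_approx[of n x]) (use n1 in auto)
    define q where "q = N * nat k"
    have q: "1 \<le> q" "real q \<le> Q"
    proof -
      show "1 \<le> q" using N k by (simp add: q_def)
      have "real q \<le> real N * real n" using k by (simp add: q_def mult_left_mono)
      also have "\<dots> \<le> Q" using n1(2) N by (simp add: field_simps)
      finally show "real q \<le> Q" .
    qed
    have "dist_int (real q * x) \<le> \<bar>real q * x - of_int (int N * h)\<bar>" by (rule dist_int_le)
    also have "\<dots> = real N * \<bar>of_int k * x - of_int h\<bar>"
    proof -
      have "real q * x - of_int (int N * h) = real N * (of_int k * x - of_int h)"
        using k by (simp add: q_def algebra_simps)
      then show ?thesis by (simp add: abs_mult)
    qed
    finally have d1: "dist_int (real q * x) \<le> real N * (1 / real n)"
      using k(3) by (meson mult_left_mono less_imp_le of_nat_0_le_iff order_trans)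
    have "dist_int (real q * (a * x + b)) \<le> \<bar>real q * (a * x + b) - of_int (int b\<^sub>2 * a\<^sub>1 * h + int a\<^sub>2 * b\<^sub>1 * k)\<bar>"
      by (rule dist_int_le)
    also have "real q * (a * x + b) - of_int (int b\<^sub>2 * a\<^sub>1 * h + int a\<^sub>2 * b\<^sub>1 * k) =
        (real N * a) * (of_int k * x - of_int h)"
    proof -
      have "real q * (a * x + b) = of_int k * ((real N * a) * x + real N * b)"
        using k by (simp add: q_def algebra_simps)
      then show ?thesis unfolding Na Nb by (simp add: algebra_simps)
    qed
    also have "\<bar>\<dots>\<bar> \<le> \<bar>real N * a\<bar> * (1 / real n)"
      unfolding abs_mult[of "real N * a"] using k(3) by (intro mult_left_mono) auto
    finally have d2: "dist_int (real q * (a * x + b)) \<le> \<bar>real N * a\<bar> * (1 / real n)" .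
    have Q0: "0 < Q" using Q N by linarith
    have "min_prod x (a * x + b) Q \<le> dist_int (real q * x) * dist_int (real q * (a * x + b))"
      by (rule min_prod_le[OF q])
    also have "\<dots> \<le> real N * (1 / real n) * (\<bar>real N * a\<bar> * (1 / real n))"
      using d1 d2 by (intro mult_mono) (auto simp: dist_int_nonneg)
    also have "\<dots> = real N * \<bar>real N * a\<bar> * (1 / real n)^2" by (simp add: power2_eq_square)
    also have "\<dots> \<le> real N * \<bar>real N * a\<bar> * (2 * real N / Q)^2"
      using n1 N Q0 by (intro mult_left_mono power_mono) (auto simp: field_simps)
    finally have "Q * min_prod x (a * x + b) Q \<le> Q * (real N * \<bar>real N * a\<bar> * (2 * real N / Q)^2)"
      using Q0 by (intro mult_left_mono) auto
    also have "\<dots> = real N * \<bar>real N * a\<bar> * (4 * real N ^ 2) / Q"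
      using Q0 by (simp add: power2_eq_square field_simps)
    finally show ?thesis .
  qed
  have "(x, a * x + b) \<notin> E_set" for x
  proof
    assume "(x, a * x + b) \<in> E_set"
    then have pos: "0 < Limsup at_top (\<lambda>Q. ereal (Q * min_prod x (a * x + b) Q))" by (simp add: E_set_def)
    have "Limsup at_top (\<lambda>Q. ereal (Q * min_prod x (a * x + b) Q)) \<le> ereal e" if e: "0 < e" for e
    proof (rule Limsup_bounded)
      let ?C = "real N * \<bar>real N * a\<bar> * (4 * real N ^ 2)"
      show "eventually (\<lambda>Q. ereal (Q * min_prod x (a * x + b) Q) \<le> ereal e) at_top"
        using eventually_ge_at_top[of "2 * real N"] eventually_ge_at_top[of "?C / e"] eventually_gt_at_top[of 0]
      proof eventually_elim
        case (elim Q)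
        have "Q * min_prod x (a * x + b) Q \<le> ?C / Q" by (rule small[OF elim(1)])
        also have "\<dots> \<le> e" using elim e by (simp add: field_simps)
        finally show ?case by simp
      qed
    qed
    moreover obtain e where "0 < ereal e" "ereal e < Limsup at_top (\<lambda>Q. ereal (Q * min_prod x (a * x + b) Q))"
      using ereal_dense2[OF pos] by blast
    ultimately show False by (metis ereal_less(2) not_le)
  qed
  then show ?thesis by (auto simp: line_def)
qed

lemma HAW_on_line:
  assumes win: "\<And>\<beta>. 0 < \<beta> \<Longrightarrow> \<beta> < 1/3 \<Longrightarrow>
      \<exists>\<sigma>. winning_strategy \<beta> (UNIV :: real set) {x. (x, a * x + b) \<in> S} \<sigma>"
  shows "HAW_on_manifold (line a b) (line_atlas a b) (S \<inter> line a b)"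
proof -
  have "fst ` line a b = UNIV" by (auto simp: line_def image_iff)
  moreover have "fst ` (S \<inter> line a b \<inter> line a b) = {x. (x, a * x + b) \<in> S}"
    by (force simp: line_def image_iff)
  ultimately show ?thesis
    using win C1_atlas_line[of a b] by (auto simp: HAW_on_manifold_def HAW_on_def line_atlas_def)
qed

lemma winning_strategy_mono:
  assumes "winning_strategy \<beta> U S \<sigma>" "S \<subseteq> T"
  shows "winning_strategy \<beta> U T \<sigma>"
  using assms unfolding winning_strategy_def by blast

theorem theorem1p8:
  fixes Q :: "nat \<Rightarrow> real" and a b :: real
  assumes "strict_mono Q"
    and "\<And>m. Q m > 0"
    and "Q 0 > 1"
    and "filterlim Q at_top sequentially"
    and "\<exists>\<tau>>1. (INF m. Q (Suc m) / Q m powr \<tau>) > 0"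
  shows "(a \<noteq> 0 \<and>
          (\<exists>\<epsilon>>0. Liminf sequentially
             (\<lambda>q. ereal (real q powr (2 - \<epsilon>) *
                max (dist_int (real q * a)) (dist_int (real q * b)))) > 0) \<longrightarrow>
            HAW_on_manifold (line a b) (line_atlas a b) (E_set \<inter> line a b) \<and>
            HAW_on_manifold (line a b) (line_atlas a b) (E_seq Q \<inter> line a b))
       \<and> (a \<in> \<rat> \<and> b \<in> \<rat> \<longrightarrow>
            line a b \<inter> E_set = {} \<and> line a b \<inter> E_seq Q = {})"
proof (intro conjI impI)
  \<comment> \<open>By this inclusion, winning needs a proof only for \<open>E_seq Q\<close>, and
    emptiness only for \<open>E_set\<close>.\<close>
  have sub: "E_seq Q \<subseteq> E_set" by (rule E_seq_subset_E_set[OF assms(4)])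
  {
    assume "a \<noteq> 0 \<and> (\<exists>\<epsilon>>0. Liminf sequentially
             (\<lambda>q. ereal (real q powr (2 - \<epsilon>) *
                max (dist_int (real q * a)) (dist_int (real q * b)))) > 0)"
    then obtain \<epsilon> \<kappa> where a: "a \<noteq> 0" and \<epsilon>: "0 < \<epsilon>" and \<kappa>: "0 < \<kappa>" "dioph 1 0 a b (min 1 \<epsilon>) \<kappa>"
      using dioph_of_Liminf by blast
    have win: "\<exists>\<sigma>. winning_strategy \<beta> (UNIV :: real set) {x. (x, a * x + b) \<in> E_seq Q} \<sigma>"
      if "0 < \<beta>" "\<beta> < 1/3" for \<beta>
      using that \<epsilon> strict_mono_mono[OF assms(1)] by (intro winning_on_line[OF _ assms(2,4,5) a _ _ \<kappa>]) auto
    have win': "\<exists>\<sigma>. winning_strategy \<beta> (UNIV :: real set) {x. (x, a * x + b) \<in> E_set} \<sigma>"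
      if "0 < \<beta>" "\<beta> < 1/3" for \<beta>
      using win[OF that] sub by (blast intro: winning_strategy_mono)
    show "HAW_on_manifold (line a b) (line_atlas a b) (E_set \<inter> line a b)"
      by (rule HAW_on_line[OF win'])
    show "HAW_on_manifold (line a b) (line_atlas a b) (E_seq Q \<inter> line a b)"
      by (rule HAW_on_line[OF win])
  }
  {
    assume "a \<in> \<rat> \<and> b \<in> \<rat>"
    then show "line a b \<inter> E_set = {}" using rational_line_disjoint by blast
    then show "line a b \<inter> E_seq Q = {}" using sub by blast
  }
qed

end
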